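(* Let $X_d=X^{\otimes d}$, $\alpha\in(0,2)$, $(a_d)$ a real sequence, $(b_d)$ a positive sequence with $b_d\to\infty$. Then $$\ln n^{X_d}(\varepsilon)=a_d+S_{\alpha,1}^{-1}(1-\varepsilon^2)b_d+o(b_d),\quad d\to\infty,\quad\text{for all }\varepsilon\in(0,1)$$ holds if and only if: (i) $\sum_{k=1}^\infty\bar\lambda^X_k\mathbf 1(\bar\lambda^X_k<e^{-x})=x^{-\alpha}\varphi(x)$, $x\ge0$, for some slowly varying function $\varphi$; (ii) $a_d=a^*_d+o(b_d)$; (iii) $\lim_{d\to\infty}d\sum_{k=1}^\infty\bar\lambda^X_k\mathbf 1(\bar\lambda^X_k<e^{-b_d})=1$. Here $a^*_d=0$ for $\alpha\in(0,1)$, $a^*_d=dE^X$ for $\alpha\in(1,2)$, and for $\alpha=1$, $a^*_d=d\sum_{k=1}^\infty|\ln\bar\lambda^X_k|\bar\lambda^X_k\mathbf 1(\bar\lambda^X_k>e^{-b_d})+(1-\gamma_E)b_d$ with $\gamma_E$ the Euler constant. Moreover, under (i), condition (iii) is equivalent to $b_d\sim d^{1/\alpha}\varphi_\alpha(d)$ as $d\to\infty$, where $\varphi_\alpha(d)=\bigl((1/\varphi)^{1/\alpha}\bigr)^\#(d^{1/\alpha})$.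
   Context: Let $X$ be a centered random element of a separable Hilbert space $H$ with $\mathbb E\|X\|^2<\infty$, covariance eigenvalues $\lambda^X_1\ge\lambda^X_2\ge\dots\ge0$ (with multiplicity, padded with zeros), $\lambda^X_1>0$, trace $\Lambda^X$, and $\bar\lambda^X_k=\lambda^X_k/\Lambda^X$. $X_d=X^{\otimes d}$ is the centered random element of $H^{\otimes d}$ with covariance operator $(K^X)^{\otimes d}$; its eigenvalues are $\prod_{j=1}^d\lambda^X_{k_j}$. With $\bar\lambda^{X_d}_k$ the normalized nonincreasing eigenvalues of $X_d$, $n^{X_d}(\varepsilon)=\min\{n\in\mathbb N:\sum_{k>n}\bar\lambda^{X_d}_k\le\varepsilon^2\}$. $E^X=\sum_{k:\bar\lambda^X_k>0}|\ln\bar\lambda^X_k|\bar\lambda^X_k$. $S_{\alpha,1}$ is the distribution function with characteristic function $\exp\{-\kappa_\alpha|t|^\alpha(1-i\,\mathrm{sign}(t)\,\omega(t,\alpha))\}$, where $\kappa_\alpha=\Gamma(2-\alpha)\cos(\pi\alpha/2)/(1-\alpha)$, $\omega(t,\alpha)=\tan(\pi\alpha/2)$ for $\alpha\ne1$, and $\kappa_1=\pi/2$, $\omega(t,1)=-(2/\pi)\ln|t|$. $F^{-1}(y)=\inf\{x:F(x)\ge y\}$. A slowly varying function (SVF) is a positive measurable $\varphi$ on some $[T,\infty)$ with $\varphi(cx)/\varphi(x)\to1$ for every $c>0$; its de Bruijn conjugate $\varphi^\#$ is the SVF, unique up to asymptotic equivalence, with $\varphi(x)\varphi^\#(x\varphi(x))\to1$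 and $\varphi^\#(x)\varphi(x\varphi^\#(x))\to1$ as $x\to\infty$. *)

theory Defs
  imports "HOL-Probability.Probability" "HOL-Library.Landau_Symbols"
begin

text \<open>Eigenvalues of the covariance operator of X are given as a sequence
  lam 0 \<ge> lam 1 \<ge> ... \<ge> 0 (indexing from 0 instead of 1).\<close>

definition trace_ev :: "(nat \<Rightarrow> real) \<Rightarrow> real" where
  "trace_ev lam = (\<Sum>k. lam k)"

definition barlam :: "(nat \<Rightarrow> real) \<Rightarrow> nat \<Rightarrow> real" where
  "barlam lam k = lam k / trace_ev lam"

definition multi_idx :: "nat \<Rightarrow> (nat \<Rightarrow> nat) set" where
  "multi_idx d = {..<d} \<rightarrow>\<^sub>E (UNIV :: nat set)"

definition tensor_barlam :: "(nat \<Rightarrow> real) \<Rightarrow> nat \<Rightarrow> (nat \<Rightarrow> nat) \<Rightarrow> real" where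
  "tensor_barlam lam d k = (\<Prod>j<d. barlam lam (k j))"

definition top_sum :: "(nat \<Rightarrow> real) \<Rightarrow> nat \<Rightarrow> nat \<Rightarrow> real" where
  "top_sum lam d n = Sup {(\<Sum>k\<in>A. tensor_barlam lam d k) | A.
       A \<subseteq> multi_idx d \<and> finite A \<and> card A \<le> n}"

text \<open>sum_{k>n} of the nonincreasing normalized eigenvalues of X_d
  (the normalized eigenvalues sum to 1).\<close>

definition tail_sum :: "(nat \<Rightarrow> real) \<Rightarrow> nat \<Rightarrow> nat \<Rightarrow> real" where
  "tail_sum lam d n = 1 - top_sum lam d n"

definition n_eps :: "(nat \<Rightarrow> real) \<Rightarrow> nat \<Rightarrow> real \<Rightarrow> nat" where
  "n_eps lam d \<epsilon> = (LEAST n. tail_sum lam d n \<le> \<epsilon>\<^sup>2)"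

definition entropy_ev :: "(nat \<Rightarrow> real) \<Rightarrow> real" where
  "entropy_ev lam = (\<Sum>k. if barlam lam k > 0
       then \<bar>ln (barlam lam k)\<bar> * barlam lam k else 0)"

definition small_tail :: "(nat \<Rightarrow> real) \<Rightarrow> real \<Rightarrow> real" where
  "small_tail lam x = (\<Sum>k. if barlam lam k < exp (- x) then barlam lam k else 0)"

definition kappa :: "real \<Rightarrow> real" where
  "kappa \<alpha> = (if \<alpha> = 1 then pi / 2
     else Gamma (2 - \<alpha>) * cos (pi * \<alpha> / 2) / (1 - \<alpha>))"

definition omega :: "real \<Rightarrow> real \<Rightarrow> real" where
  "omega t \<alpha> = (if \<alpha> = 1 then - (2 / pi) * ln \<bar>t\<bar> else tan (pi * \<alpha> / 2))"

definition stable_cf :: "real \<Rightarrow> real \<Rightarrow> complex" where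
  "stable_cf \<alpha> t = exp (- (complex_of_real (kappa \<alpha> * \<bar>t\<bar> powr \<alpha>))
       * (1 - \<i> * complex_of_real (sgn t * omega t \<alpha>)))"

definition stable_cdf :: "real \<Rightarrow> real \<Rightarrow> real" where
  "stable_cdf \<alpha> = (THE F. \<exists>M. real_distribution M
       \<and> (\<forall>t. char M t = stable_cf \<alpha> t) \<and> F = cdf M)"

definition gen_inverse :: "(real \<Rightarrow> real) \<Rightarrow> real \<Rightarrow> real" where
  "gen_inverse F y = Inf {x. F x \<ge> y}"

definition slowly_varying :: "(real \<Rightarrow> real) \<Rightarrow> bool" where
  "slowly_varying \<phi> \<longleftrightarrow> (\<exists>T. (\<forall>x\<ge>T. \<phi> x > 0)
     \<and> (\<lambda>x. indicator {T..} x * \<phi> x) \<in> borel_measurable borel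
     \<and> (\<forall>c>0. ((\<lambda>x. \<phi> (c * x) / \<phi> x) \<longlongrightarrow> 1) at_top))"

definition debruijn_conj :: "(real \<Rightarrow> real) \<Rightarrow> (real \<Rightarrow> real) \<Rightarrow> bool" where
  "debruijn_conj \<phi> \<psi> \<longleftrightarrow> slowly_varying \<psi>
     \<and> ((\<lambda>x. \<phi> x * \<psi> (x * \<phi> x)) \<longlongrightarrow> 1) at_top
     \<and> ((\<lambda>x. \<psi> x * \<phi> (x * \<psi> x)) \<longlongrightarrow> 1) at_top"

definition a_star :: "(nat \<Rightarrow> real) \<Rightarrow> real \<Rightarrow> (nat \<Rightarrow> real) \<Rightarrow> nat \<Rightarrow> real" where
  "a_star lam \<alpha> b d =
     (if \<alpha> < 1 then 0
      else if \<alpha> > 1 then real d * entropy_ev lam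
      else real d * (\<Sum>k. if barlam lam k > exp (- b d)
                          then \<bar>ln (barlam lam k)\<bar> * barlam lam k else 0)
           + (1 - euler_mascheroni) * b d)"

end

theory Submission
  imports Defs "HOL-Real_Asymp.Real_Asymp"
begin

text \<open>Draw an eigenvalue of the tensor power with probability equal to its normalized size. Minus its
  logarithm is a sum \<open>S\<close> of \<open>d\<close> iid nonnegative variables \<open>U = - ln p\<close>, whose tail is the left-hand side
  of condition (i). The largest eigenvalues carrying mass \<open>1 - \<epsilon>\<^sup>2\<close> are those with \<open>S\<close> at most its
  quantile \<open>q\<close>; there are at most \<open>exp q\<close> of them, and \<open>exp (q - \<delta> b)\<close> eigenvalues are too few. So
  the asymptotics of \<open>ln n\<close> amounts to weak convergence of \<open>(S - a) / b\<close> to the stable law, whose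
  quantile function is continuous.

  Sufficiency: Potter bounds and dominated convergence give the limit of the characteristic functions
  as a Levy exponent, which is evaluated by its homogeneity along rays of the right half plane.
  Necessity: the symmetrization \<open>V\<close> of \<open>U\<close> has a real characteristic function. Multiplying the scaled
  laws by \<open>1 - cos (\<delta> x)\<close> turns the convergence of its logarithm into weak convergence of probability
  measures, hence of the tails of \<open>V\<close>, and \<open>U \<ge> 0\<close> makes the tails of \<open>U\<close> and \<open>V\<close> comparable.
  The centering \<open>a\<close> is then determined up to \<open>o(b)\<close>.\<close>

section \<open>Layer cake formula and the stable Levy measure\<close>

text \<open>Fubini on {0 < y < x} turns the integral of \<open>F (x / b d)\<close> into that of the
  derivative of \<open>F\<close> against \<open>d * T (b d * y)\<close>, the only quantity whose
  limit is given; Potter bounds dominate it, although \<open>b\<close> need not be monotone. The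
  compensator \<open>min x 1\<close> is the same for every index, so one kernel covers all \<alpha>
  in (0,2) and varies continuously with \<alpha>. The three shapes of \<open>a_star\<close> appear
  only when the mean of \<open>min (U / b d) 1\<close>, times \<open>d\<close>, is evaluated. The
  constant \<open>1 - euler_mascheroni\<close> has two sources: 1 is the limit of \<open>d\<close>
  times the probability of \<open>U \<ge> b d\<close>, the part of \<open>min\<close> above the
  cutoff, and the Euler constant is minus the derivative of Gamma at 1, coming from the exponent of
  index 1. As \<open>stable_cdf\<close> is a definite description, a law with the prescribed
  characteristic function has to be built; normalized Pareto sums supply it. In the converse
  direction the unknown centering and the complex logarithm are the obstacle; both disappear in the
  squared modulus.\<close>

lemma layer_cake:
  fixes \<kappa> :: "real \<Rightarrow> 'a::{banach, second_countable_topology}"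
  assumes N: "sigma_finite_measure N" and sets_N [measurable_cong]: "sets N = sets borel"
    and [measurable]: "\<kappa> \<in> borel_measurable borel"
    and fin: "\<And>y. 0 < y \<Longrightarrow> emeasure N {y<..} < \<infinity>"
    and int: "integrable lborel (\<lambda>y. indicator {0<..} y *\<^sub>R (measure N {y<..} *\<^sub>R \<kappa> y))"
  shows "integrable N (\<lambda>x. \<integral>y. indicator {0<..<x} y *\<^sub>R \<kappa> y \<partial>lborel)"
    and "(\<integral>x. (\<integral>y. indicator {0<..<x} y *\<^sub>R \<kappa> y \<partial>lborel) \<partial>N)
       = (\<integral>y. indicator {0<..} y *\<^sub>R (measure N {y<..} *\<^sub>R \<kappa> y) \<partial>lborel)"
proof -
  interpret N: sigma_finite_measure N by fact
  interpret P: pair_sigma_finite lborel N ..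
  define h :: "real \<times> real \<Rightarrow> 'a"
    where "h = (\<lambda>(y, x). (if 0 < y \<and> y < x then 1 else 0) *\<^sub>R \<kappa> y)"
  have [measurable]: "h \<in> borel_measurable (lborel \<Otimes>\<^sub>M N)"
    unfolding h_def by measurable
  have h_y: "h (y, x) = indicator {y<..} x *\<^sub>R (indicator {0<..} y *\<^sub>R \<kappa> y)" for x y
    by (auto simp: h_def indicator_def)
  have h_x: "h (y, x) = indicator {0<..<x} y *\<^sub>R \<kappa> y" for x y
    by (auto simp: h_def indicator_def)
  have inner: "integrable N (\<lambda>x. h (y, x))" "(\<integral>x. h (y, x) \<partial>N) = indicator {0<..} y *\<^sub>R (measure N {y<..} *\<^sub>R \<kappa> y)"
     "(\<integral>x. norm (h (y, x)) \<partial>N) = norm (indicator {0<..} y *\<^sub>R (measure N {y<..} *\<^sub>R \<kappa> y))" for y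
  proof -
    \<comment> \<open>For \<open>y \<le> 0\<close> both integrands vanish, so finiteness of the tail
      is asked only for \<open>y > 0\<close>, and \<open>N\<close> may have infinite mass near
      0.\<close>
    consider "y \<le> 0" | "0 < y" by linarith
    then have "integrable N (\<lambda>x. h (y, x)) \<and> (\<integral>x. h (y, x) \<partial>N) = indicator {0<..} y *\<^sub>R (measure N {y<..} *\<^sub>R \<kappa> y)
      \<and> (\<integral>x. norm (h (y, x)) \<partial>N) = norm (indicator {0<..} y *\<^sub>R (measure N {y<..} *\<^sub>R \<kappa> y))"
    proof cases
      case 1
      then show ?thesis unfolding h_y by simp
    next
      case 2
      have m: "{y<..} \<in> sets N" by (simp add: sets_N)
      have e: "norm (h (y, x)) = indicator {y<..} x *\<^sub>R norm (\<kappa> y)" for x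
        using 2 unfolding h_y by (auto simp: indicator_def)
      have sp: "{y<..} \<inter> space N = {y<..}"
        using sets_eq_imp_space_eq[OF sets_N] by simp
      have "integrable N (indicator {y<..} :: real \<Rightarrow> real)"
        using fin[OF 2] m by (intro integrable_real_indicator) auto
      moreover have "integral\<^sup>L N (indicator {y<..} :: real \<Rightarrow> real) = measure N {y<..}"
        using sp by simp
      ultimately show ?thesis using 2 unfolding e unfolding h_y by simp
    qed
    then show "integrable N (\<lambda>x. h (y, x))" "(\<integral>x. h (y, x) \<partial>N) = indicator {0<..} y *\<^sub>R (measure N {y<..} *\<^sub>R \<kappa> y)"
     "(\<integral>x. norm (h (y, x)) \<partial>N) = norm (indicator {0<..} y *\<^sub>R (measure N {y<..} *\<^sub>R \<kappa> y))" by auto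
  qed
  have H: "integrable (lborel \<Otimes>\<^sub>M N) h"
  proof (rule P.Fubini_integrable)
    show "integrable lborel (\<lambda>y. \<integral>x. norm (h (y, x)) \<partial>N)"
      unfolding inner(3) by (rule integrable_norm[OF int])
  qed (use inner(1) in simp_all)
  have H': "integrable (lborel \<Otimes>\<^sub>M N) (\<lambda>(y, x). h (y, x))" using H by simp
  have "integrable N (\<lambda>x. \<integral>y. h (y, x) \<partial>lborel)"
    using P.integrable_snd[OF H'] by simp
  then show "integrable N (\<lambda>x. \<integral>y. indicator {0<..<x} y *\<^sub>R \<kappa> y \<partial>lborel)"
    unfolding h_x .
  have "(\<integral>x. (\<integral>y. h (y, x) \<partial>lborel) \<partial>N) = (\<integral>y. (\<integral>x. h (y, x) \<partial>N) \<partial>lborel)"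
    using P.integral_snd[OF H'] P.integral_fst[OF H'] by simp
  then show "(\<integral>x. (\<integral>y. indicator {0<..<x} y *\<^sub>R \<kappa> y \<partial>lborel) \<partial>N)
       = (\<integral>y. indicator {0<..} y *\<^sub>R (measure N {y<..} *\<^sub>R \<kappa> y) \<partial>lborel)"
    unfolding inner(2) unfolding h_x .
qed

text \<open>Away from 0 this is the limit of \<open>d\<close> times the law of
  \<open>U / b d\<close>. Its tail is \<open>y powr (- \<alpha>)\<close> and its mass near 0 is
  infinite, so only functions vanishing fast enough at 0 can be integrated.\<close>

definition levy_measure :: "real \<Rightarrow> real measure" where
  "levy_measure \<alpha> = density lborel (\<lambda>x. ennreal (indicator {0<..} x * (\<alpha> * x powr (- \<alpha> - 1))))"

lemma sets_levy_measure [simp, measurable_cong]: "sets (levy_measure \<alpha>) = sets borel"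
  and space_levy_measure [simp]: "space (levy_measure \<alpha>) = UNIV"
  by (simp_all add: levy_measure_def)

lemma measurable_levy_measure1 [simp]: "borel_measurable (levy_measure \<alpha>) = borel_measurable borel"
  by (rule measurable_cong_sets) simp_all

lemma emeasure_levy_measure_Ioi:
  assumes "0 < \<alpha>" "0 < y"
  shows "emeasure (levy_measure \<alpha>) {y<..} = ennreal (y powr (- \<alpha>))"
proof -
  have "emeasure (levy_measure \<alpha>) {y<..} = (\<integral>\<^sup>+x. ennreal (indicator {0<..} x * (\<alpha> * x powr (- \<alpha> - 1))) * indicator {y<..} x \<partial>lborel)"
    unfolding levy_measure_def by (subst emeasure_density) auto
  also have "\<dots> = (\<integral>\<^sup>+x. ennreal (\<alpha> * x powr (- \<alpha> - 1)) * indicator {y..} x \<partial>lborel)"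
    using assms(2) by (intro nn_integral_cong_AE eventually_mono[OF AE_lborel_singleton[of y]])
      (auto simp: indicator_def)
  also have "\<dots> = ennreal (0 - (- (y powr (- \<alpha>))))"
  proof (rule nn_integral_FTC_atLeast)
    fix x assume "y \<le> x"
    then have "x > 0" using assms by simp
    then show "((\<lambda>x. - (x powr (- \<alpha>))) has_real_derivative \<alpha> * x powr (- \<alpha> - 1)) (at x)"
      by (auto intro!: derivative_eq_intros simp: powr_diff)
    show "0 \<le> \<alpha> * x powr (- \<alpha> - 1)" using assms by simp
  next
    have "((\<lambda>x. - (x powr (- \<alpha>))) \<longlongrightarrow> - 0) at_top"
      using assms by (intro tendsto_minus tendsto_neg_powr filterlim_ident) auto
    then show "((\<lambda>x. - (x powr (- \<alpha>))) \<longlongrightarrow> 0) at_top" by simp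
  qed simp
  finally show ?thesis by simp
qed

lemma measure_levy_measure_Ioi:
  "0 < \<alpha> \<Longrightarrow> 0 < y \<Longrightarrow> measure (levy_measure \<alpha>) {y<..} = y powr (- \<alpha>)"
  by (simp add: measure_def emeasure_levy_measure_Ioi)

lemma AE_levy_measure_pos: "AE x in levy_measure \<alpha>. 0 < x"
  unfolding levy_measure_def by (subst AE_density) (auto simp: indicator_def)

lemma sigma_finite_levy_measure:
  shows "sigma_finite_measure (levy_measure \<alpha>)"
  unfolding levy_measure_def
  by (subst sigma_finite_measure.sigma_finite_iff_density_finite[OF sigma_finite_lborel]) auto

lemma levy_measure_integral:
  fixes f :: "real \<Rightarrow> 'a::{banach, second_countable_topology}"
  assumes "0 < \<alpha>" "f \<in> borel_measurable borel"
  shows "integral\<^sup>L (levy_measure \<alpha>) f = (\<integral>x. (indicator {0<..} x * (\<alpha> * x powr (- \<alpha> - 1))) *\<^sub>R f x \<partial>lborel)"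
    and "integrable (levy_measure \<alpha>) f \<longleftrightarrow> integrable lborel (\<lambda>x. (indicator {0<..} x * (\<alpha> * x powr (- \<alpha> - 1))) *\<^sub>R f x)"
  unfolding levy_measure_def using assms
  by (subst integral_density integrable_density; force)+

lemma has_bochner_integral_levy_measure_iff:
  fixes f :: "real \<Rightarrow> 'a::{banach, second_countable_topology}"
  assumes "0 < \<alpha>" "f \<in> borel_measurable borel"
  shows "has_bochner_integral (levy_measure \<alpha>) f I \<longleftrightarrow>
    has_bochner_integral lborel (\<lambda>x. (indicator {0<..} x * (\<alpha> * x powr (- \<alpha> - 1))) *\<^sub>R f x) I"
  using assms by (simp add: has_bochner_integral_iff levy_measure_integral)

text \<open>Without integrability both sides are 0 by convention. This lets the scaling rule for the
  Levy measure hold without an integrability hypothesis.\<close>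

lemma integral_scaleR_right_unconditional:
  fixes f :: "'a \<Rightarrow> 'b::{banach, second_countable_topology}"
  assumes "c \<noteq> 0"
  shows "(\<integral>x. c *\<^sub>R f x \<partial>M) = c *\<^sub>R integral\<^sup>L M f"
proof (cases "integrable M f")
  case False
  then have "\<not> integrable M (\<lambda>x. c *\<^sub>R f x)"
    using assms integrable_scaleR_right[of "inverse c" M "\<lambda>x. c *\<^sub>R f x"] by auto
  with False show ?thesis by (simp add: not_integrable_integral_eq)
qed simp

text \<open>Substituting \<open>c * x\<close> multiplies the density by a power of \<open>c\<close>.
  This homogeneity is the source of all scaling relations of the exponent.\<close>

lemma levy_measure_scale:
  fixes f :: "real \<Rightarrow> 'a::{banach, second_countable_topology}"
  assumes \<alpha>: "0 < \<alpha>" and [measurable]: "f \<in> borel_measurable borel" and c: "0 < c"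
  shows "(\<integral>x. f (c * x) \<partial>levy_measure \<alpha>) = c powr \<alpha> *\<^sub>R (\<integral>x. f x \<partial>levy_measure \<alpha>)"
proof -
  have "(\<integral>x. f x \<partial>levy_measure \<alpha>) = c *\<^sub>R (\<integral>x. (indicator {0<..} (c * x) * (\<alpha> * (c * x) powr (- \<alpha> - 1))) *\<^sub>R f (c * x) \<partial>lborel)"
    using lborel_integral_real_affine[of c "\<lambda>x. (indicator {0<..} x * (\<alpha> * x powr (- \<alpha> - 1))) *\<^sub>R f x" 0] c
    by (simp add: levy_measure_integral \<alpha>)
  also have "\<dots> = c *\<^sub>R (\<integral>x. c powr (- \<alpha> - 1) *\<^sub>R ((indicator {0<..} x * (\<alpha> * x powr (- \<alpha> - 1))) *\<^sub>R f (c * x)) \<partial>lborel)"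
    using c by (intro arg_cong[where f="\<lambda>x. c *\<^sub>R x"] Bochner_Integration.integral_cong)
      (auto simp: indicator_def powr_mult zero_less_mult_iff)
  also have "\<dots> = (c * c powr (- \<alpha> - 1)) *\<^sub>R (\<integral>x. f (c * x) \<partial>levy_measure \<alpha>)"
    using c by (subst integral_scaleR_right_unconditional) (simp_all add: levy_measure_integral \<alpha>)
  also have "c * c powr (- \<alpha> - 1) = c powr (-\<alpha>)"
    using c by (simp add: powr_diff)
  finally have "c powr \<alpha> *\<^sub>R (\<integral>x. f x \<partial>levy_measure \<alpha>) = (c powr \<alpha> * c powr (-\<alpha>)) *\<^sub>R (\<integral>x. f (c * x) \<partial>levy_measure \<alpha>)"
    by simp
  also have "c powr \<alpha> * c powr (-\<alpha>) = 1" using c by (simp add: powr_minus)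
  finally show ?thesis by simp
qed

section \<open>Explicit integrals against the Levy measure\<close>

lemma has_bochner_integral_powr_unit_interval:
  fixes \<beta> :: real
  assumes "\<beta> > -1"
  shows "has_bochner_integral lborel (\<lambda>y. indicator {0<..<1} y * y powr \<beta>) (1 / (\<beta> + 1))"
proof -
  have 1: "(((\<lambda>y. y powr (\<beta> + 1) / (\<beta> + 1)) \<circ> real_of_ereal) \<longlongrightarrow> 0) (at_right (ereal 0))"
  proof (subst ereal_tendsto_simps1)
    have "((\<lambda>y. y powr (\<beta> + 1) / (\<beta> + 1)) \<longlongrightarrow> 0 powr (\<beta> + 1) / (\<beta> + 1)) (at_right 0)"
      using assms by (intro tendsto_intros tendsto_powr2) (auto simp: eventually_at_filter)
    then show "((\<lambda>y. y powr (\<beta> + 1) / (\<beta> + 1)) \<longlongrightarrow> 0) (at_right 0)" by simp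
  qed
  have 2: "(((\<lambda>y. y powr (\<beta> + 1) / (\<beta> + 1)) \<circ> real_of_ereal) \<longlongrightarrow> 1 / (\<beta> + 1)) (at_left (ereal 1))"
  proof (subst ereal_tendsto_simps1)
    have "((\<lambda>y. y powr (\<beta> + 1) / (\<beta> + 1)) \<longlongrightarrow> 1 powr (\<beta> + 1) / (\<beta> + 1)) (at_left 1)"
      using assms by (intro tendsto_intros) auto
    then show "((\<lambda>y. y powr (\<beta> + 1) / (\<beta> + 1)) \<longlongrightarrow> 1 / (\<beta> + 1)) (at_left 1)" by simp
  qed
  have "set_integrable lborel (einterval (ereal 0) (ereal 1)) (\<lambda>y. y powr \<beta>)"
    "(LBINT x=ereal 0..ereal 1. x powr \<beta>) = 1 / (\<beta> + 1) - 0"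
    by (rule interval_integral_FTC_nonneg[OF _ _ _ _ 1 2];
        use assms in \<open>auto intro!: derivative_eq_intros continuous_intros\<close>)+
  then show ?thesis
    by (simp add: has_bochner_integral_iff set_integrable_def set_lebesgue_integral_def
        interval_lebesgue_integral_def)
qed

lemma has_bochner_integral_Gamma:
  assumes "s > (0::real)"
  shows "has_bochner_integral lborel (\<lambda>t. indicator {0<..} t * (t powr (s - 1) * exp (- t))) (Gamma s)"
proof (rule has_bochner_integral_nn_integral)
  have "(\<integral>\<^sup>+t. ennreal (indicator {0<..} t * (t powr (s - 1) * exp (- t))) \<partial>lborel)
      = (\<integral>\<^sup>+t. ennreal (indicator {0..} t * t powr (s - 1) / exp t) \<partial>lborel)"
    by (intro nn_integral_cong) (auto simp: indicator_def exp_minus field_simps)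
  then show "(\<integral>\<^sup>+t. ennreal (indicator {0<..} t * (t powr (s - 1) * exp (- t))) \<partial>lborel) = ennreal (Gamma s)"
    using Gamma_conv_nn_integral_real[OF assms] by simp
qed (use Gamma_real_pos[OF assms] in auto)

lemma integral_Ioo_FTC:
  fixes \<kappa> :: "real \<Rightarrow> 'a::euclidean_space"
  assumes "0 \<le> x" and F: "\<And>y. 0 \<le> y \<Longrightarrow> y \<le> x \<Longrightarrow> (F has_vector_derivative \<kappa> y) (at y)"
    and "continuous_on {0..x} \<kappa>"
  shows "(\<integral>y. indicator {0<..<x} y *\<^sub>R \<kappa> y \<partial>lborel) = F x - F 0"
proof -
  have "(LBINT y=ereal 0..ereal x. \<kappa> y) = F x - F 0"
    using assms by (intro interval_integral_FTC_finite) (auto simp: min_def max_def intro: has_vector_derivative_at_within)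
  then show ?thesis
    using assms(1) by (simp add: interval_lebesgue_integral_def set_lebesgue_integral_def zero_ereal_def)
qed

text \<open>Integration by parts: \<open>F\<close> is the primitive of \<kappa> vanishing at 0, and
  the tail of the Levy measure becomes the weight of \<kappa>. Each explicit integral below is this
  rule with a suitable \<kappa>.\<close>

lemma layer_cake_levy:
  fixes \<kappa> F :: "real \<Rightarrow> 'a::euclidean_space"
  assumes \<alpha>: "0 < \<alpha>"
    and [measurable]: "\<kappa> \<in> borel_measurable borel" "F \<in> borel_measurable borel"
    and int: "integrable lborel (\<lambda>y. (indicator {0<..} y * y powr (- \<alpha>)) *\<^sub>R \<kappa> y)"
    and F: "\<And>x. 0 < x \<Longrightarrow> (\<integral>y. indicator {0<..<x} y *\<^sub>R \<kappa> y \<partial>lborel) = F x"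
  shows "integrable (levy_measure \<alpha>) F"
    and "integral\<^sup>L (levy_measure \<alpha>) F = (\<integral>y. (indicator {0<..} y * y powr (- \<alpha>)) *\<^sub>R \<kappa> y \<partial>lborel)"
proof -
  have eq: "(indicator {0<..} y * y powr (- \<alpha>)) *\<^sub>R \<kappa> y = indicator {0<..} y *\<^sub>R (measure (levy_measure \<alpha>) {y<..} *\<^sub>R \<kappa> y)" for y
    using \<alpha> by (auto simp: indicator_def measure_levy_measure_Ioi)
  have 1: "AE x in levy_measure \<alpha>. (\<integral>y. indicator {0<..<x} y *\<^sub>R \<kappa> y \<partial>lborel) = F x"
    using AE_levy_measure_pos[of \<alpha>] by eventually_elim (rule F)
  note L = layer_cake[OF sigma_finite_levy_measure sets_levy_measure, of \<kappa> \<alpha>]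
  have m [measurable]: "(\<lambda>x. \<integral>y. indicator {0<..<x} y *\<^sub>R \<kappa> y \<partial>lborel) \<in> borel_measurable borel"
    using L(1) int \<alpha> by (auto simp: eq emeasure_levy_measure_Ioi dest: borel_measurable_integrable)
  have i: "integrable (levy_measure \<alpha>) (\<lambda>x. \<integral>y. indicator {0<..<x} y *\<^sub>R \<kappa> y \<partial>lborel)"
    using L(1) int \<alpha> by (auto simp: eq emeasure_levy_measure_Ioi)
  then show "integrable (levy_measure \<alpha>) F"
    by (rule integrable_cong_AE_imp) (use 1 in \<open>auto\<close>)
  have "integral\<^sup>L (levy_measure \<alpha>) F = (\<integral>x. \<integral>y. indicator {0<..<x} y *\<^sub>R \<kappa> y \<partial>lborel \<partial>levy_measure \<alpha>)"
    by (rule integral_cong_AE) (use 1 in \<open>auto\<close>)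
  also have "\<dots> = (\<integral>y. (indicator {0<..} y * y powr (- \<alpha>)) *\<^sub>R \<kappa> y \<partial>lborel)"
    using L(2) int \<alpha> by (auto simp: eq emeasure_levy_measure_Ioi)
  finally show "integral\<^sup>L (levy_measure \<alpha>) F = (\<integral>y. (indicator {0<..} y * y powr (- \<alpha>)) *\<^sub>R \<kappa> y \<partial>lborel)" .
qed

lemma levy_integral_one_minus_exp:
  assumes "0 < \<alpha>" "\<alpha> < 1"
  shows "has_bochner_integral (levy_measure \<alpha>) (\<lambda>x. 1 - exp (- x)) (Gamma (1 - \<alpha>))"
proof -
  have G: "has_bochner_integral lborel (\<lambda>y. (indicator {0<..} y * y powr (- \<alpha>)) *\<^sub>R exp (- y)) (Gamma (1 - \<alpha>))"
    using has_bochner_integral_Gamma[of "1 - \<alpha>"] assms by (simp add: mult.assoc)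
  have F: "(\<integral>y. indicator {0<..<x} y *\<^sub>R exp (- y) \<partial>lborel) = 1 - exp (- x)" if "0 < x" for x :: real
    by (subst integral_Ioo_FTC[of x "\<lambda>y. - exp (- y)" "\<lambda>y. exp (- y)"]) (use that in \<open>auto intro!: derivative_eq_intros continuous_intros simp flip: has_real_derivative_iff_has_vector_derivative\<close>)
  show ?thesis
    using layer_cake_levy[OF assms(1), of "\<lambda>y. exp (-y)" "\<lambda>x. 1 - exp (- x)"] G F
    by (simp add: has_bochner_integral_iff)
qed

lemma levy_integral_min:
  assumes "0 < \<alpha>" "\<alpha> < 1"
  shows "has_bochner_integral (levy_measure \<alpha>) (\<lambda>x. min x 1) (1 / (1 - \<alpha>))"
proof -
  have eq: "(indicator {0<..} y * y powr (- \<alpha>)) *\<^sub>R indicator {0<..<1} y = indicator {0<..<1} y * y powr (- \<alpha>)" for y :: real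
    by (auto simp: indicator_def)
  have G: "has_bochner_integral lborel (\<lambda>y. (indicator {0<..} y * y powr (- \<alpha>)) *\<^sub>R indicator {0<..<1} y) (1 / (1 - \<alpha>))"
    using has_bochner_integral_powr_unit_interval[of "- \<alpha>"] assms unfolding eq by simp
  have F: "(\<integral>y. indicator {0<..<x} y *\<^sub>R indicator {0<..<1} y \<partial>lborel) = min x 1" if "0 < x" for x :: real
  proof -
    have "(\<integral>y. indicator {0<..<x} y *\<^sub>R (indicator {0<..<1} y :: real) \<partial>lborel) = (\<integral>y. indicator {0<..<min x 1} y \<partial>lborel)"
      by (intro Bochner_Integration.integral_cong) (auto simp: indicator_def)
    then show ?thesis using that by simp
  qed
  show ?thesis
    using layer_cake_levy[OF assms(1), of "indicator {0<..<1}" "\<lambda>x. min x 1"] G F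
    by (simp add: has_bochner_integral_iff)
qed

lemma levy_integral_excess:
  assumes "1 < \<alpha>"
  shows "has_bochner_integral (levy_measure \<alpha>) (\<lambda>x. x - min x 1) (1 / (\<alpha> - 1))"
proof -
  \<comment> \<open>Up to a factor, \<open>y powr (- \<alpha>)\<close> is the density of the Levy
    measure of index \<alpha> - 1, so integration by parts lowers the index by one.\<close>
  have eq: "(indicator {0<..} y * y powr (- \<alpha>)) *\<^sub>R indicator {1<..} y = (indicator {0<..} y * ((\<alpha> - 1) * y powr (- (\<alpha> - 1) - 1))) *\<^sub>R (indicator {1<..} y / (\<alpha> - 1))" for y :: real
    using assms by (auto simp: indicator_def)
  have e: "emeasure (levy_measure (\<alpha> - 1)) {1<..} = ennreal 1" "measure (levy_measure (\<alpha> - 1)) {1<..} = 1"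
    using emeasure_levy_measure_Ioi[of "\<alpha> - 1" 1] measure_levy_measure_Ioi[of "\<alpha> - 1" 1] assms by simp_all
  then have "has_bochner_integral (levy_measure (\<alpha> - 1)) (indicator {1<..}) (1::real)"
    using has_bochner_integral_real_indicator[of "{1<..}" "levy_measure (\<alpha> - 1)"] by simp
  then have "has_bochner_integral (levy_measure (\<alpha> - 1)) (\<lambda>x. indicator {1<..} x / (\<alpha> - 1)) (1 / (\<alpha> - 1))"
    using assms by (intro has_bochner_integral_divide) auto
  then have G: "has_bochner_integral lborel (\<lambda>y. (indicator {0<..} y * y powr (- \<alpha>)) *\<^sub>R indicator {1<..} y) (1 / (\<alpha> - 1))"
    using assms unfolding eq by (subst (asm) has_bochner_integral_levy_measure_iff) simp_all
  have F: "(\<integral>y. indicator {0<..<x} y *\<^sub>R indicator {1<..} y \<partial>lborel) = x - min x 1" if "0 < x" for x :: real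
  proof -
    have "(\<integral>y. indicator {0<..<x} y *\<^sub>R (indicator {1<..} y :: real) \<partial>lborel) = (\<integral>y. indicator {1<..<max x 1} y \<partial>lborel)"
      by (intro Bochner_Integration.integral_cong) (auto simp: indicator_def)
    then show ?thesis using that by (simp add: max_def min_def)
  qed
  show ?thesis
    using layer_cake_levy[of \<alpha> "indicator {1<..}" "\<lambda>x. x - min x 1"] G F assms
    by (simp add: has_bochner_integral_iff)
qed

text \<open>One integration by parts leads to \<open>1 - exp (- y)\<close> at the index \<alpha> -
  1, which lies in (0,1), where the integral is already known.\<close>

lemma levy_integral_exp_compensated:
  assumes "1 < \<alpha>" "\<alpha> < 2"
  shows "has_bochner_integral (levy_measure \<alpha>) (\<lambda>x. exp (- x) - 1 + x) (Gamma (2 - \<alpha>) / (\<alpha> - 1))"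
proof -
  have eq: "(indicator {0<..} y * y powr (- \<alpha>)) *\<^sub>R (1 - exp (- y)) = (indicator {0<..} y * ((\<alpha> - 1) * y powr (- (\<alpha> - 1) - 1))) *\<^sub>R ((1 - exp (- y)) / (\<alpha> - 1))" for y :: real
    using assms by (auto simp: indicator_def)
  have "has_bochner_integral (levy_measure (\<alpha> - 1)) (\<lambda>x. 1 - exp (- x)) (Gamma (2 - \<alpha>))"
    using levy_integral_one_minus_exp[of "\<alpha> - 1"] assms by simp
  then have "has_bochner_integral (levy_measure (\<alpha> - 1)) (\<lambda>x. (1 - exp (- x)) / (\<alpha> - 1)) (Gamma (2 - \<alpha>) / (\<alpha> - 1))"
    using assms by (intro has_bochner_integral_divide) auto
  then have G: "has_bochner_integral lborel (\<lambda>y. (indicator {0<..} y * y powr (- \<alpha>)) *\<^sub>R (1 - exp (- y))) (Gamma (2 - \<alpha>) / (\<alpha> - 1))"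
    using assms unfolding eq by (subst (asm) has_bochner_integral_levy_measure_iff) simp_all
  have F: "(\<integral>y. indicator {0<..<x} y *\<^sub>R (1 - exp (- y)) \<partial>lborel) = exp (- x) - 1 + x" if "0 < x" for x :: real
    by (subst integral_Ioo_FTC[of x "\<lambda>y. exp (- y) + y" "\<lambda>y. 1 - exp (- y)"]) (use that in \<open>auto intro!: derivative_eq_intros continuous_intros simp flip: has_real_derivative_iff_has_vector_derivative\<close>)
  show ?thesis
    using layer_cake_levy[of \<alpha> "\<lambda>y. 1 - exp (-y)" "\<lambda>x. exp (- x) - 1 + x"] G F assms
    by (simp add: has_bochner_integral_iff)
qed

text \<open>After integration by parts the integrand near 0 is a multiple of
  \<open>y powr (1 - \<alpha>)\<close>, integrable because \<alpha> < 2. A multiple of this function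
  dominates all kernels below.\<close>

lemma levy_integrable_min_square:
  assumes "0 < \<alpha>" "\<alpha> < 2"
  shows "integrable (levy_measure \<alpha>) (\<lambda>x. min (x^2) 1)"
proof -
  have eq: "(indicator {0<..} y * y powr (- \<alpha>)) *\<^sub>R (2 * y * indicator {0<..<1} y) = 2 * (indicator {0<..<1} y * y powr (1 - \<alpha>))" for y :: real
    by (auto simp: indicator_def powr_diff powr_minus field_simps)
  have G: "integrable lborel (\<lambda>y. (indicator {0<..} y * y powr (- \<alpha>)) *\<^sub>R (2 * y * indicator {0<..<1::real} y))"
    using has_bochner_integral_powr_unit_interval[of "1 - \<alpha>"] assms unfolding eq by (intro integrable_mult_right) (auto simp: has_bochner_integral_iff)
  have F: "(\<integral>y. indicator {0<..<x} y *\<^sub>R (2 * y * indicator {0<..<1} y) \<partial>lborel) = min (x^2) 1" if "0 < x" for x :: real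
  proof -
    have "(\<integral>y. indicator {0<..<x} y *\<^sub>R (2 * y * indicator {0<..<1} y) \<partial>lborel) = (\<integral>y. indicator {0<..<min x 1} y *\<^sub>R (2 * y) \<partial>lborel)"
      by (intro Bochner_Integration.integral_cong) (auto simp: indicator_def)
    also have "\<dots> = (min x 1)^2 - 0^2"
      by (subst integral_Ioo_FTC[of "min x 1" "\<lambda>y. y^2" "\<lambda>y. 2 * y"]) (use that in \<open>auto intro!: derivative_eq_intros continuous_intros simp flip: has_real_derivative_iff_has_vector_derivative\<close>)
    also have "\<dots> = min (x^2) 1" using that by (auto simp: min_def power2_eq_square mult_le_one not_le)
      (smt (verit) mult_less_cancel_left1 mult_le_one)+
    finally show ?thesis .
  qed
  show ?thesis
    using layer_cake_levy[of \<alpha> "\<lambda>y. 2 * y * indicator {0<..<1} y" "\<lambda>x. min (x^2) 1"] G F assms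
    by simp
qed

section \<open>The Levy exponent and the stable characteristic function\<close>

text \<open>The compensator \<open>min x 1\<close> takes the place of the usual case distinction on
  \<alpha> (none, truncated, full mean). It makes the kernel quadratic at 0 and bounded at infinity
  for every index, and being independent of \<alpha> it allows the passage to \<alpha> = 1. At
  \<open>w = - \<i> * t\<close> the kernel is the compensated integrand of a characteristic
  exponent.\<close>

definition levy_ker :: "complex \<Rightarrow> real \<Rightarrow> complex" where
  "levy_ker w x = exp (- (w * of_real x)) - 1 + w * of_real (min x 1)"

definition levy_exponent :: "real \<Rightarrow> complex \<Rightarrow> complex" where
  "levy_exponent \<alpha> w = (\<integral>x. levy_ker w x \<partial>levy_measure \<alpha>)"

lemma levy_ker_measurable [measurable]: "levy_ker w \<in> borel_measurable borel"
  unfolding levy_ker_def by measurable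

lemma norm_exp_diff_1: "norm (exp z - 1) \<le> exp (norm z) * norm z" for z :: complex
  using Taylor_exp_field[of z 0] by simp

lemma norm_exp_diff_2: "norm (exp z - 1 - z) \<le> exp (norm z) * (norm z)\<^sup>2" for z :: complex
  using Taylor_exp_field[of z 1] by (simp add: power2_eq_square algebra_simps)

definition ker_const :: "real \<Rightarrow> real" where
  "ker_const r = exp r * r\<^sup>2 + 2 + r"

text \<open>Up to 1 the compensator cancels the first-order term and a quadratic remainder is left;
  beyond 1 the exponential has modulus at most 1 in the right half plane, which gives
  \<open>2 + r\<close>. \<open>ker_const r\<close> adds the two bounds. It depends only on a bound
  for \<open>norm w\<close>, so it dominates a whole bounded family of kernels.\<close>

lemma norm_levy_ker_le:
  assumes "0 \<le> Re w" "0 < x" "norm w \<le> r"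
  shows "norm (levy_ker w x) \<le> ker_const r * min (x\<^sup>2) 1"
proof (cases "x \<le> 1")
  case True
  let ?z = "- (w * of_real x)"
  have r: "0 \<le> r" using assms(3) norm_ge_zero[of w] by linarith
  have nz: "norm ?z = norm w * x" using assms by (simp add: norm_mult)
  have nz': "norm w * x \<le> r * x" using assms by (simp add: mult_right_mono)
  have "norm w * x \<le> r" using nz' True r by (smt (verit) assms(2) mult_left_le)
  then have "norm (levy_ker w x) \<le> exp r * (r * x)\<^sup>2"
    using norm_exp_diff_2[of ?z] True nz nz' assms(2)
    unfolding levy_ker_def
    by (intro order_trans[OF _ mult_mono[of "exp (norm w * x)" "exp r" "(norm w * x)\<^sup>2" "(r * x)\<^sup>2"]])
       (auto simp: algebra_simps intro!: power_mono)
  also have "\<dots> = exp r * r\<^sup>2 * x\<^sup>2" by (simp add: power_mult_distrib)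
  also have "\<dots> \<le> ker_const r * x\<^sup>2"
    using r by (intro mult_right_mono) (auto simp: ker_const_def)
  also have "x\<^sup>2 = min (x\<^sup>2) 1" using True assms(2) by (simp add: power_le_one min_absorb1)
  finally show ?thesis .
next
  case False
  have "norm (exp (- (w * of_real x))) \<le> 1" using assms by simp
  then have "norm (levy_ker w x) \<le> 1 + 1 + norm w"
    using False unfolding levy_ker_def
    by (intro order_trans[OF norm_triangle_ineq] add_mono order_trans[OF norm_triangle_ineq4]) auto
  also have "\<dots> \<le> ker_const r" using assms(3) by (simp add: ker_const_def add_increasing)
  also have "\<dots> = ker_const r * min (x\<^sup>2) 1" using False by (simp add: min_absorb2)
  finally show ?thesis .
qed

lemma integrable_levy_ker:
  assumes "0 < \<alpha>" "\<alpha> < 2" "0 \<le> Re w"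
  shows "integrable (levy_measure \<alpha>) (levy_ker w)"
proof (rule Bochner_Integration.integrable_bound)
  show "integrable (levy_measure \<alpha>) (\<lambda>x. ker_const (norm w) * min (x\<^sup>2) 1)"
    using levy_integrable_min_square[OF assms(1,2)] by simp
  show "AE x in levy_measure \<alpha>. norm (levy_ker w x) \<le> norm (ker_const (norm w) * min (x\<^sup>2) 1)"
    using AE_levy_measure_pos
  proof eventually_elim
    case (elim x)
    then show ?case using norm_levy_ker_le[OF assms(3), of x "norm w"] by simp
  qed
qed simp

text \<open>Continuity up to the imaginary axis is the point: the closed form is obtained in the
  open half plane, while characteristic functions live on its boundary.\<close>

lemma tendsto_levy_exponent:
  assumes "0 < \<alpha>" "\<alpha> < 2" and re: "\<And>n. 0 \<le> Re (u n)" and lim: "u \<longlonglongrightarrow> w"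
  shows "(\<lambda>n. levy_exponent \<alpha> (u n)) \<longlonglongrightarrow> levy_exponent \<alpha> w"
proof -
  have "bounded (range u)" using lim by (intro convergent_imp_bounded) (auto simp: convergent_def)
  then obtain r where r: "\<And>n. norm (u n) \<le> r" by (auto simp: bounded_iff)
  show ?thesis unfolding levy_exponent_def
  proof (rule integral_dominated_convergence[where w="\<lambda>x. ker_const r * min (x\<^sup>2) 1"])
    show "integrable (levy_measure \<alpha>) (\<lambda>x. ker_const r * min (x\<^sup>2) 1)"
      using levy_integrable_min_square[OF assms(1,2)] by simp
    show "AE x in levy_measure \<alpha>. norm (levy_ker (u n) x) \<le> ker_const r * min (x\<^sup>2) 1" for n
      using AE_levy_measure_pos by eventually_elim (rule norm_levy_ker_le[OF re _ r])
    show "AE x in levy_measure \<alpha>. (\<lambda>n. levy_ker (u n) x) \<longlonglongrightarrow> levy_ker w x"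
      unfolding levy_ker_def by (intro always_eventually allI tendsto_intros lim)
  qed auto
qed

lemma levy_exponent_has_field_derivative:
  assumes \<alpha>: "0 < \<alpha>" "\<alpha> < 2" and w: "0 < Re w"
  shows "(levy_exponent \<alpha> has_field_derivative
     (\<integral>x. of_real (min x 1) - of_real x * exp (- (w * of_real x)) \<partial>levy_measure \<alpha>)) (at w)"
proof -
  \<comment> \<open>An increment of norm below \<delta> keeps \<open>w + z\<close> in the half
    plane, and its growth \<open>exp (\<delta> * x)\<close> is beaten by the decay
    \<open>exp (- (2 * \<delta> * x))\<close> of the factor with \<open>w\<close>.\<close>
  define \<delta> where "\<delta> = min 1 (Re w / 2)"
  have \<delta>: "0 < \<delta>" "\<delta> \<le> 1" "\<delta> \<le> Re w / 2" using w by (auto simp: \<delta>_def)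
  \<comment> \<open>The difference quotient of \<open>levy_ker\<close> at \<open>w\<close> with
    increment \<open>z\<close>, written so that the compensator stands apart.\<close>
  define q where "q z x = exp (- (w * of_real x)) * ((exp (- (z * of_real x)) - 1) / z) + of_real (min x 1)" for z :: complex and x :: real
  have [measurable]: "q z \<in> borel_measurable borel" for z unfolding q_def[abs_def] by measurable
  define C where "C = exp 1 + norm w * exp (norm w) + 1 / \<delta> + 1"
  have bound: "norm (q z x) \<le> C * min (x\<^sup>2) 1" if z: "z \<noteq> 0" "norm z < \<delta>" and x: "0 < x" for z x
  proof (cases "x \<le> 1")
    case True
    let ?e = "exp (- (w * of_real x))"
    \<comment> \<open>For \<open>x \<le> 1\<close> the first-order terms cancel, and each of the two
      remaining parts is of order \<open>x\<^sup>2\<close>.\<close>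
    have eq: "q z x = ?e * ((exp (- (z * of_real x)) - 1 - (- (z * of_real x))) / z) - of_real x * (?e - 1)"
      using True z by (simp add: q_def min_absorb1 field_simps)
    have "norm ((exp (- (z * of_real x)) - 1 - (- (z * of_real x))) / z) \<le> exp (norm z * x) * (norm z * x)\<^sup>2 / norm z"
      using norm_exp_diff_2[of "- (z * of_real x)"] x by (simp add: norm_divide norm_mult divide_right_mono)
    also have "\<dots> = exp (norm z * x) * norm z * x\<^sup>2" using z by (simp add: power2_eq_square)
    also have "\<dots> \<le> exp 1 * 1 * x\<^sup>2"
      using z \<delta> True x by (intro mult_right_mono mult_mono) (auto intro: mult_le_one)
    finally have 1: "norm ((exp (- (z * of_real x)) - 1 - (- (z * of_real x))) / z) \<le> exp 1 * x\<^sup>2" by simp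
    have "norm (?e - 1) \<le> exp (norm w * x) * (norm w * x)"
      using norm_exp_diff_1[of "- (w * of_real x)"] x by (simp add: norm_mult)
    also have "\<dots> \<le> exp (norm w) * (norm w * x)" using True x by (intro mult_right_mono) (auto intro: mult_left_le)
    finally have 2: "norm (?e - 1) \<le> exp (norm w) * (norm w * x)" .
    have e: "norm ?e \<le> 1" using w x by simp
    have "norm (q z x) \<le> 1 * (exp 1 * x\<^sup>2) + x * (exp (norm w) * (norm w * x))"
      unfolding eq using 1 2 e x
      by (intro order_trans[OF norm_triangle_ineq4] add_mono) (auto simp only: norm_mult norm_of_real intro!: mult_mono, auto)
    also have "\<dots> = (exp 1 + norm w * exp (norm w)) * x\<^sup>2" by (simp add: power2_eq_square algebra_simps)
    also have "\<dots> \<le> C * x\<^sup>2" using \<delta> by (intro mult_right_mono) (auto simp: C_def)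
    also have "x\<^sup>2 = min (x\<^sup>2) 1" using True x by (simp add: power_le_one min_absorb1)
    finally show ?thesis .
  next
    case False
    have "norm ((exp (- (z * of_real x)) - 1) / z) \<le> exp (norm z * x) * (norm z * x) / norm z"
      unfolding norm_divide using norm_exp_diff_1[of "- (z * of_real x)"] x by (intro divide_right_mono) (simp_all add: norm_mult)
    also have "\<dots> = exp (norm z * x) * x" using z by simp
    also have "\<dots> \<le> exp (\<delta> * x) * x" using z x by simp
    finally have 1: "norm ((exp (- (z * of_real x)) - 1) / z) \<le> exp (\<delta> * x) * x" .
    have 2: "norm (exp (- (w * of_real x))) \<le> exp (- (2 * \<delta> * x))" using \<delta> x by simp
    have "norm (q z x) \<le> exp (- (2 * \<delta> * x)) * (exp (\<delta> * x) * x) + 1"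
      unfolding q_def using 1 2 False
      by (intro order_trans[OF norm_triangle_ineq] add_mono) (auto simp only: norm_mult intro!: mult_mono, auto)
    also have "exp (- (2 * \<delta> * x)) * (exp (\<delta> * x) * x) = x * exp (- (\<delta> * x))"
      by (simp add: mult.assoc[symmetric] exp_add[symmetric])
    also have "x * exp (- (\<delta> * x)) \<le> 1 / \<delta>"
    proof -
      have "\<delta> * x \<le> exp (\<delta> * x)" using exp_ge_add_one_self[of "\<delta> * x"] by linarith
      then show ?thesis using \<delta> by (simp add: exp_minus field_simps)
    qed
    also have "1 / \<delta> + 1 \<le> C" by (simp add: C_def)
    also have "C = C * min (x\<^sup>2) 1" using False by (simp add: min_absorb2)
    finally show ?thesis by simp
  qed
  have "((\<lambda>z. (levy_exponent \<alpha> (w + z) - levy_exponent \<alpha> w) / z) \<longlongrightarrow>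
     (\<integral>x. of_real (min x 1) - of_real x * exp (- (w * of_real x)) \<partial>levy_measure \<alpha>)) (at 0 within ball 0 \<delta>)"
    unfolding tendsto_at_iff_sequentially
  proof (intro allI impI, unfold comp_def)
    fix X assume X: "\<forall>i. X i \<in> ball 0 \<delta> - {0::complex}" "X \<longlonglongrightarrow> 0"
    have re: "0 \<le> Re (w + X i)" for i
    proof -
      have "norm (X i) < \<delta>" using X(1)[rule_format, of i] by simp
      then show ?thesis using \<delta> abs_Re_le_cmod[of "X i"] by simp
    qed
    have eq: "(levy_exponent \<alpha> (w + X i) - levy_exponent \<alpha> w) / X i = (\<integral>x. q (X i) x \<partial>levy_measure \<alpha>)" for i
    proof -
      have "(levy_exponent \<alpha> (w + X i) - levy_exponent \<alpha> w) / X i = (\<integral>x. (levy_ker (w + X i) x - levy_ker w x) / X i \<partial>levy_measure \<alpha>)"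
        unfolding levy_exponent_def using integrable_levy_ker[OF \<alpha> re[of i]] integrable_levy_ker[OF \<alpha>, of w] w by simp
      also have "(\<lambda>x. (levy_ker (w + X i) x - levy_ker w x) / X i) = q (X i)"
        using X(1)[rule_format, of i]
        by (auto simp: levy_ker_def q_def fun_eq_iff field_simps exp_add[symmetric])
      finally show ?thesis .
    qed
    show "(\<lambda>i. (levy_exponent \<alpha> (w + X i) - levy_exponent \<alpha> w) / X i) \<longlonglongrightarrow>
      (\<integral>x. of_real (min x 1) - of_real x * exp (- (w * of_real x)) \<partial>levy_measure \<alpha>)"
      unfolding eq
    proof (rule integral_dominated_convergence[where w="\<lambda>x. C * min (x\<^sup>2) 1"])
      show "integrable (levy_measure \<alpha>) (\<lambda>x. C * min (x\<^sup>2) 1)"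
        using levy_integrable_min_square[OF \<alpha>] by simp
      show "AE x in levy_measure \<alpha>. norm (q (X i) x) \<le> C * min (x\<^sup>2) 1" for i
        using AE_levy_measure_pos by eventually_elim (use bound X(1) in auto)
      have "(\<lambda>i. q (X i) x) \<longlonglongrightarrow> of_real (min x 1) - of_real x * exp (- (w * of_real x))" for x
      proof -
        have d: "((\<lambda>z. exp (- (z * complex_of_real x))) has_field_derivative (- of_real x)) (at 0)"
          by (auto intro!: derivative_eq_intros)
        have "((\<lambda>z. (exp (- (z * complex_of_real x)) - 1) / z) \<longlongrightarrow> - of_real x) (at 0)"
          using d unfolding DERIV_def by simp
        then have "(\<lambda>i. (exp (- (X i * of_real x)) - 1) / X i) \<longlonglongrightarrow> - of_real x"
          unfolding tendsto_at_iff_sequentially comp_def using X by auto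
        then have "(\<lambda>i. q (X i) x) \<longlonglongrightarrow> exp (- (w * of_real x)) * (- of_real x) + of_real (min x 1)"
          unfolding q_def by (intro tendsto_intros)
        then show ?thesis by (simp add: algebra_simps)
      qed
      then show "AE x in levy_measure \<alpha>. (\<lambda>i. q (X i) x) \<longlonglongrightarrow> of_real (min x 1) - of_real x * exp (- (w * of_real x))"
        by simp
    qed auto
  qed
  moreover have "at 0 within ball 0 \<delta> = at (0::complex)"
    by (rule at_within_open) (use \<delta> in auto)
  ultimately show ?thesis
    unfolding DERIV_def by (simp only:)
qed

section \<open>Closed form of the Levy exponent by homogeneity\<close>

lemma ray_invariant_imp_constant:
  fixes G :: "complex \<Rightarrow> complex"
  assumes d: "\<And>w. 0 < Re w \<Longrightarrow> G field_differentiable at w"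
    and ray: "\<And>c w. 0 < c \<Longrightarrow> 0 < Re w \<Longrightarrow> G (of_real c * w) = G w"
    and w: "0 < Re w"
  shows "G w = G 1"
proof -
  have "(G has_field_derivative 0) (at w within {w. 0 < Re w})" if w: "w \<in> {w. 0 < Re w}" for w
  proof -
    obtain D where D: "(G has_field_derivative D) (at w)" using d w by (auto simp: field_differentiable_def)
    \<comment> \<open>The derivative along the ray is \<open>w * D\<close>, and invariance makes it
      0. As \<open>G\<close> is complex differentiable, one vanishing direction forces the whole
      derivative to vanish.\<close>
    have "((\<lambda>c. G (of_real c * w)) has_vector_derivative (w * D)) (at 1)"
    proof -
      have "((\<lambda>c. complex_of_real c * w) has_vector_derivative w) (at 1)"
        by (auto intro!: derivative_eq_intros)
      from field_vector_diff_chain_at[OF this, of G D] D show ?thesis by (simp add: o_def)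
    qed
    moreover have "((\<lambda>c. G (of_real c * w)) has_vector_derivative 0) (at 1)"
    proof (rule has_vector_derivative_transform_within_open[of "\<lambda>_. G w" _ _ "{0<..}"])
      show "\<And>x. x \<in> {0<..} \<Longrightarrow> G w = G (complex_of_real x * w)" using ray w by simp
    qed (auto)
    ultimately have "w * D = 0" by (rule vector_derivative_unique_at)
    then have "D = 0" using w by auto
    then show ?thesis using D by (simp add: has_field_derivative_at_within)
  qed
  moreover have "convex {w. 0 < Re w}" by (rule convex_halfspace_Re_gt)
  ultimately obtain c where "\<forall>w\<in>{w. 0 < Re w}. G w = c"
    using has_field_derivative_zero_constant by blast
  then show ?thesis using w by simp
qed

text \<open>Moving the cutoff from 1 to \<open>c\<close> changes the compensator by this function.
  \<open>min x c\<close> is integrable for \<alpha> < 1 and \<open>x - min x c\<close> for \<alpha>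
  > 1, so the difference is split differently in the two cases; each piece follows from its value at
  \<open>c = 1\<close> by scaling.\<close>

lemma levy_integral_min_diff:
  assumes \<alpha>: "0 < \<alpha>" "\<alpha> \<noteq> 1" and c: "0 < c"
  shows "has_bochner_integral (levy_measure \<alpha>) (\<lambda>x. min x c - min x 1) ((c powr (1 - \<alpha>) - 1) / (1 - \<alpha>))"
proof (cases "\<alpha> < 1")
  case True
  have cm: "c * min (x / c) 1 = min x c" for x using c by (auto simp: min_def field_simps)
  have m1: "(\<integral>x. min x 1 \<partial>levy_measure \<alpha>) = 1 / (1 - \<alpha>)" and i1: "integrable (levy_measure \<alpha>) (\<lambda>x. min x 1)"
    using levy_integral_min[OF \<alpha>(1) True] by (auto simp: has_bochner_integral_iff)
  have ic: "integrable (levy_measure \<alpha>) (\<lambda>x. min x c)"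
  proof (rule Bochner_Integration.integrable_bound)
    show "integrable (levy_measure \<alpha>) (\<lambda>x. max 1 c * min x 1)" using i1 by simp
    show "AE x in levy_measure \<alpha>. norm (min x c) \<le> norm (max 1 c * min x 1)"
      using AE_levy_measure_pos
    proof eventually_elim
      case (elim x)
      then show ?case using c mult_left_mono[of 1 "max 1 c" x] by (auto simp: min_def max_def abs_mult split: if_splits)
    qed
  qed simp
  have "(\<integral>x. min (c * x) c \<partial>levy_measure \<alpha>) = c powr \<alpha> * (\<integral>x. min x c \<partial>levy_measure \<alpha>)"
    using levy_measure_scale[OF \<alpha>(1) _ c, of "\<lambda>x. min x c"] by simp
  moreover have "(\<lambda>x. min (c * x) c) = (\<lambda>x. c * min x 1)" using c by (auto simp: min_def)
  ultimately have "c * (1 / (1 - \<alpha>)) = c powr \<alpha> * (\<integral>x. min x c \<partial>levy_measure \<alpha>)"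
    by (simp add: m1)
  then have "(\<integral>x. min x c \<partial>levy_measure \<alpha>) = c powr (1 - \<alpha>) / (1 - \<alpha>)"
    using c True by (simp add: powr_diff divide_simps) (simp add: algebra_simps)
  then show ?thesis using m1 i1 ic by (simp add: has_bochner_integral_iff diff_divide_distrib)
next
  case False
  then have a1: "1 < \<alpha>" using \<alpha> by simp
  have m1: "(\<integral>x. x - min x 1 \<partial>levy_measure \<alpha>) = 1 / (\<alpha> - 1)" and i1: "integrable (levy_measure \<alpha>) (\<lambda>x. x - min x 1)"
    using levy_integral_excess[OF a1] by (auto simp: has_bochner_integral_iff)
  have "integrable lborel (\<lambda>x. (indicator {0<..} x * (\<alpha> * x powr (- \<alpha> - 1))) *\<^sub>R (x - min x 1))"
    using i1 \<alpha> by (simp add: levy_measure_integral)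
  \<comment> \<open>The scaling rule yields values but not integrability, so integrability is
    transported separately by the substitution \<open>x / c\<close> in the density.\<close>
  then have "integrable lborel (\<lambda>x. (indicator {0<..} (0 + (1/c) * x) * (\<alpha> * (0 + (1/c) * x) powr (- \<alpha> - 1))) *\<^sub>R ((0 + (1/c) * x) - min (0 + (1/c) * x) 1))"
    by (rule lborel_integrable_real_affine) (use c in simp)
  then have "integrable lborel (\<lambda>x. c powr (- \<alpha>) * ((indicator {0<..} ((1/c) * x) * (\<alpha> * ((1/c) * x) powr (- \<alpha> - 1))) *\<^sub>R (((1/c) * x) - min ((1/c) * x) 1)))"
    by simp
  moreover have "c powr (- \<alpha>) * ((indicator {0<..} ((1/c) * x) * (\<alpha> * ((1/c) * x) powr (- \<alpha> - 1))) *\<^sub>R (((1/c) * x) - min ((1/c) * x) 1))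
     = (indicator {0<..} x * (\<alpha> * x powr (- \<alpha> - 1))) *\<^sub>R (x - min x c)" for x
  proof (cases "0 < x")
    case True
    have "c powr (- \<alpha>) * ((1/c) * x) powr (- \<alpha> - 1) = c * x powr (- \<alpha> - 1)"
      using c True by (simp add: powr_divide powr_diff powr_minus field_simps)
    moreover have "c * (((1/c) * x) - min ((1/c) * x) 1) = x - min x c"
      using c by (auto simp: min_def field_simps)
    ultimately show ?thesis using True c by (simp add: indicator_def) (metis (no_types) mult.assoc mult.commute)
  qed (use c in \<open>auto simp: indicator_def zero_less_divide_iff\<close>)
  ultimately have ic: "integrable (levy_measure \<alpha>) (\<lambda>x. x - min x c)"
    using \<alpha> by (simp only: levy_measure_integral) (simp add: levy_measure_integral)
  have "(\<integral>x. c * x - min (c * x) c \<partial>levy_measure \<alpha>) = c powr \<alpha> * (\<integral>x. x - min x c \<partial>levy_measure \<alpha>)"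
    using levy_measure_scale[OF \<alpha>(1) _ c, of "\<lambda>x. x - min x c"] by simp
  moreover have "(\<lambda>x. c * x - min (c * x) c) = (\<lambda>x. c * (x - min x 1))" using c by (auto simp: min_def algebra_simps)
  ultimately have "c * (1 / (\<alpha> - 1)) = c powr \<alpha> * (\<integral>x. x - min x c \<partial>levy_measure \<alpha>)"
    by (simp add: m1)
  then have mc: "(\<integral>x. x - min x c \<partial>levy_measure \<alpha>) = c powr (1 - \<alpha>) / (\<alpha> - 1)"
    using c a1 by (simp add: powr_diff divide_simps) (simp add: algebra_simps)
  have "has_bochner_integral (levy_measure \<alpha>) (\<lambda>x. (x - min x 1) - (x - min x c)) (1 / (\<alpha> - 1) - c powr (1 - \<alpha>) / (\<alpha> - 1))"
    using m1 i1 ic mc by (intro has_bochner_integral_diff) (auto simp: has_bochner_integral_iff)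
  moreover have "1 / (\<alpha> - 1) - c powr (1 - \<alpha>) / (\<alpha> - 1) = (c powr (1 - \<alpha>) - 1) / (1 - \<alpha>)"
    by (metis diff_divide_distrib minus_diff_eq minus_divide_divide)
  ultimately show ?thesis by simp
qed

text \<open>Scaling the variable turns the cutoff 1 of the compensator into \<open>c\<close>. Hence
  the exponent is homogeneous of degree \<alpha> only up to a term linear in \<open>w\<close>, the
  cost of moving the cutoff back.\<close>

lemma levy_exponent_scale:
  assumes \<alpha>: "0 < \<alpha>" "\<alpha> < 2" "\<alpha> \<noteq> 1" and c: "0 < c" and w: "0 \<le> Re w"
  shows "levy_exponent \<alpha> (of_real c * w) = of_real (c powr \<alpha>) * levy_exponent \<alpha> w + w * of_real ((c - c powr \<alpha>) / (1 - \<alpha>))"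
proof -
  \<comment> \<open>The kernel with its cutoff moved to \<open>c\<close>; evaluated at
    \<open>c * x\<close> it is the original kernel at \<open>c * w\<close>.\<close>
  define f where "f x = levy_ker w x + w * of_real (min x c - min x 1)" for x
  have [measurable]: "f \<in> borel_measurable borel" unfolding f_def by measurable
  have "levy_exponent \<alpha> (of_real c * w) = (\<integral>x. f (c * x) \<partial>levy_measure \<alpha>)"
    unfolding levy_exponent_def
  proof (rule Bochner_Integration.integral_cong)
    fix x
    have "min (c * x) c = c * min x 1" using c by (auto simp: min_def)
    then show "levy_ker (of_real c * w) x = f (c * x)"
      by (simp add: levy_ker_def f_def algebra_simps)
  qed simp
  also have "\<dots> = c powr \<alpha> *\<^sub>R (\<integral>x. f x \<partial>levy_measure \<alpha>)"
    by (rule levy_measure_scale[OF \<alpha>(1) _ c]) simp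
  also have "(\<integral>x. f x \<partial>levy_measure \<alpha>) = levy_exponent \<alpha> w + w * of_real ((c powr (1 - \<alpha>) - 1) / (1 - \<alpha>))"
  proof -
    have h: "has_bochner_integral (levy_measure \<alpha>) (\<lambda>x. complex_of_real (min x c - min x 1)) (of_real ((c powr (1 - \<alpha>) - 1) / (1 - \<alpha>)))"
      by (intro has_bochner_integral_of_real levy_integral_min_diff \<alpha> c)
    have "has_bochner_integral (levy_measure \<alpha>) f (levy_exponent \<alpha> w + w * of_real ((c powr (1 - \<alpha>) - 1) / (1 - \<alpha>)))"
      unfolding f_def levy_exponent_def
      by (intro has_bochner_integral_add has_bochner_integral_mult_right h has_bochner_integral_integrable integrable_levy_ker \<alpha> w)
    then show ?thesis by (rule has_bochner_integral_integral_eq)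
  qed
  also have "c powr \<alpha> *\<^sub>R (levy_exponent \<alpha> w + w * of_real ((c powr (1 - \<alpha>) - 1) / (1 - \<alpha>)))
     = of_real (c powr \<alpha>) * levy_exponent \<alpha> w + w * of_real (c powr \<alpha> * ((c powr (1 - \<alpha>) - 1) / (1 - \<alpha>)))"
    by (simp add: scaleR_conv_of_real algebra_simps)
  also have "c powr \<alpha> * ((c powr (1 - \<alpha>) - 1) / (1 - \<alpha>)) = (c - c powr \<alpha>) / (1 - \<alpha>)"
  proof -
    have "c powr \<alpha> * c powr (1 - \<alpha>) = c" using c by (simp flip: powr_add)
    then have "c powr \<alpha> * (c powr (1 - \<alpha>) - 1) = c - c powr \<alpha>" by (simp add: algebra_simps)
    then show ?thesis by simp
  qed
  finally show ?thesis .
qed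

text \<open>At \<open>w = 1\<close> the kernel is real and a difference of two explicit integrals.
  This value fixes the constant that invariance along rays leaves open.\<close>

lemma levy_exponent_at_1:
  assumes \<alpha>: "0 < \<alpha>" "\<alpha> < 2" "\<alpha> \<noteq> 1"
  shows "levy_exponent \<alpha> 1 = of_real ((1 - Gamma (2 - \<alpha>)) / (1 - \<alpha>))"
proof -
  have "has_bochner_integral (levy_measure \<alpha>) (\<lambda>x. exp (- x) - 1 + min x 1) ((1 - Gamma (2 - \<alpha>)) / (1 - \<alpha>))"
  proof (cases "\<alpha> < 1")
    case True
    have "has_bochner_integral (levy_measure \<alpha>) (\<lambda>x. min x 1 - (1 - exp (- x))) (1 / (1 - \<alpha>) - Gamma (1 - \<alpha>))"
      by (intro has_bochner_integral_diff levy_integral_min levy_integral_one_minus_exp \<alpha> True)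
    moreover have "Gamma (2 - \<alpha>) = (1 - \<alpha>) * Gamma (1 - \<alpha>)"
      using Gamma_plus1[of "1 - \<alpha>"] True by (auto simp: nonpos_Ints_def)
    moreover have "1 / (1 - \<alpha>) - Gamma (1 - \<alpha>) = (1 - (1 - \<alpha>) * Gamma (1 - \<alpha>)) / (1 - \<alpha>)"
      using True by (simp add: field_simps)
    moreover have "(\<lambda>x. min x 1 - (1 - exp (- x))) = (\<lambda>x::real. exp (- x) - 1 + min x 1)" by auto
    ultimately show ?thesis by (simp only:)
  next
    case False
    have "has_bochner_integral (levy_measure \<alpha>) (\<lambda>x. (exp (- x) - 1 + x) - (x - min x 1)) (Gamma (2 - \<alpha>) / (\<alpha> - 1) - 1 / (\<alpha> - 1))"
      by (intro has_bochner_integral_diff levy_integral_excess levy_integral_exp_compensated) (use \<alpha> False in auto)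
    moreover have "Gamma (2 - \<alpha>) / (\<alpha> - 1) - 1 / (\<alpha> - 1) = (1 - Gamma (2 - \<alpha>)) / (1 - \<alpha>)"
      by (metis diff_divide_distrib minus_diff_eq minus_divide_divide)
    moreover have "(\<lambda>x. (exp (- x) - 1 + x) - (x - min x 1)) = (\<lambda>x::real. exp (- x) - 1 + min x 1)" by auto
    ultimately show ?thesis by (simp only:)
  qed
  then have "has_bochner_integral (levy_measure \<alpha>) (\<lambda>x. complex_of_real (exp (- x) - 1 + min x 1)) (of_real ((1 - Gamma (2 - \<alpha>)) / (1 - \<alpha>)))"
    by (rule has_bochner_integral_of_real)
  moreover have "(\<lambda>x. complex_of_real (exp (- x) - 1 + min x 1)) = levy_ker 1"
    by (auto simp: levy_ker_def fun_eq_iff exp_of_real[symmetric])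
  ultimately show ?thesis unfolding levy_exponent_def by (simp add: has_bochner_integral_iff)
qed

text \<open>Subtracting \<open>w / (1 - \<alpha>)\<close> removes the linear term of the scaling
  law. The rest is homogeneous of degree \<alpha>, so its quotient \<open>G\<close> by
  \<open>w powr \<alpha>\<close> is holomorphic and constant along rays, hence constant.\<close>

lemma levy_exponent_halfplane:
  assumes \<alpha>: "0 < \<alpha>" "\<alpha> < 2" "\<alpha> \<noteq> 1" and w: "0 < Re w"
  shows "levy_exponent \<alpha> w = (w - of_real (Gamma (2 - \<alpha>)) * w powr of_real \<alpha>) / of_real (1 - \<alpha>)"
proof -
  define G where "G w = (levy_exponent \<alpha> w - w / of_real (1 - \<alpha>)) / w powr of_real \<alpha>" for w
  have nz: "w powr of_real \<alpha> \<noteq> 0" if "0 < Re w" for w using that by auto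
  have G: "G w = G 1"
  proof (rule ray_invariant_imp_constant[OF _ _ w])
    fix w :: complex assume w: "0 < Re w"
    have np: "w \<notin> \<real>\<^sub>\<le>\<^sub>0" using w by (auto simp: complex_nonpos_Reals_iff)
    have "(\<lambda>w. w powr of_real \<alpha>) field_differentiable at w"
      using has_field_derivative_powr[OF np, of "of_real \<alpha>"] by (auto simp: field_differentiable_def)
    moreover have "levy_exponent \<alpha> field_differentiable at w"
      using levy_exponent_has_field_derivative[OF \<alpha>(1,2) w] by (auto simp: field_differentiable_def)
    ultimately show "G field_differentiable at w"
      unfolding G_def using nz[OF w] np \<alpha>
      by (intro field_differentiable_divide field_differentiable_diff field_differentiable_const
           field_differentiable_ident) auto
  next
    fix c :: real and w :: complex assume c: "0 < c" and w: "0 < Re w"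
    have "w \<noteq> 0" using w by auto
    have p: "(of_real c * w) powr of_real \<alpha> = of_real (c powr \<alpha>) * w powr of_real \<alpha>"
      using c w by (subst powr_times_real_left) (auto simp: powr_of_real)
    have "levy_exponent \<alpha> (of_real c * w) - of_real c * w / of_real (1 - \<alpha>) = of_real (c powr \<alpha>) * (levy_exponent \<alpha> w - w / of_real (1 - \<alpha>))"
      using levy_exponent_scale[OF \<alpha> c less_imp_le[OF w]] \<alpha>(3) by (simp add: field_simps)
    then show "G (of_real c * w) = G w"
      unfolding G_def p using c by simp
  qed
  have "G 1 = - (of_real (Gamma (2 - \<alpha>)) / of_real (1 - \<alpha>))"
    unfolding G_def levy_exponent_at_1[OF \<alpha>] by (simp add: diff_divide_distrib)
  then have "levy_exponent \<alpha> w - w / of_real (1 - \<alpha>) = - (of_real (Gamma (2 - \<alpha>)) / of_real (1 - \<alpha>)) * w powr of_real \<alpha>"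
    using G nz[OF w] by (simp add: G_def[of w] field_simps)
  then show ?thesis by (simp add: diff_divide_distrib algebra_simps)
qed

lemma levy_exponent_closed_halfplane:
  assumes \<alpha>: "0 < \<alpha>" "\<alpha> < 2" "\<alpha> \<noteq> 1" and w: "0 \<le> Re w" "w \<noteq> 0"
  shows "levy_exponent \<alpha> w = (w - of_real (Gamma (2 - \<alpha>)) * w powr of_real \<alpha>) / of_real (1 - \<alpha>)"
proof -
  \<comment> \<open>Approach from the interior. The power is continuous at \<open>w\<close> because
    a nonzero \<open>w\<close> with \<open>Re w \<ge> 0\<close> avoids the branch cut.\<close>
  define u where "u n = w + of_real (1 / real (Suc n))" for n
  have u: "0 < Re (u n)" for n using w by (simp add: u_def add_nonneg_pos)
  have lim: "u \<longlonglongrightarrow> w"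
  proof -
    have "(\<lambda>n. w + of_real (1 / real (Suc n))) \<longlonglongrightarrow> w + of_real 0"
      using LIMSEQ_inverse_real_of_nat by (intro tendsto_intros) (simp add: inverse_eq_divide)
    then show ?thesis by (simp add: u_def[abs_def])
  qed
  have np: "w \<notin> \<real>\<^sub>\<le>\<^sub>0" using w by (auto simp: complex_nonpos_Reals_iff complex_eq_iff)
  have "(\<lambda>n. levy_exponent \<alpha> (u n)) \<longlonglongrightarrow> levy_exponent \<alpha> w"
    by (rule tendsto_levy_exponent[OF \<alpha>(1,2) less_imp_le[OF u] lim])
  moreover have "(\<lambda>n. (u n - of_real (Gamma (2 - \<alpha>)) * u n powr of_real \<alpha>) / of_real (1 - \<alpha>)) \<longlonglongrightarrow>
    (w - of_real (Gamma (2 - \<alpha>)) * w powr of_real \<alpha>) / of_real (1 - \<alpha>)"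
    using \<alpha>(3) np by (intro tendsto_intros lim tendsto_powr_complex) auto
  ultimately show ?thesis
    by (simp add: levy_exponent_halfplane[OF \<alpha> u]) (rule LIMSEQ_unique)
qed

text \<open>The index 1 is reached as a limit; this turns \<open>(1 - Gamma (2 - \<alpha>)) / (1 - \<alpha>)\<close> into the Euler constant.\<close>

lemma levy_exponent_tendsto_1:
  assumes w: "0 \<le> Re w"
  shows "(\<lambda>n. levy_exponent (1 + 1 / real (n + 2)) w) \<longlonglongrightarrow> levy_exponent 1 w"
proof -
  define \<alpha> where "\<alpha> n = 1 + 1 / real (n + 2)" for n
  have a: "1 \<le> \<alpha> n" "\<alpha> n \<le> 3/2" for n by (auto simp: \<alpha>_def field_simps)
  have lim: "\<alpha> \<longlonglongrightarrow> 1"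
  proof -
    have "(\<lambda>n. 1 + 1 / real (n + 2)) \<longlonglongrightarrow> 1 + 0"
      using LIMSEQ_ignore_initial_segment[OF lim_1_over_n, of 2] by (intro tendsto_intros) auto
    then show ?thesis by (simp add: \<alpha>_def[abs_def])
  qed
  let ?C = "ker_const (norm w)"
  \<comment> \<open>The Levy density of index \<beta>. All indices \<open>\<alpha> n\<close> lie
    between 1 and 3/2, so up to the factor 2 their densities are dominated by the sum of the two
    extreme ones: index 3/2 near 0 and index 1 near infinity.\<close>
  let ?d = "\<lambda>\<beta> x. (indicator {0<..} x * (\<beta> * x powr (- \<beta> - 1))) :: real"
  have C: "0 \<le> ?C" by (simp add: ker_const_def)
  have "(\<lambda>n. \<integral>x. ?d (\<alpha> n) x *\<^sub>R levy_ker w x \<partial>lborel) \<longlonglongrightarrow> (\<integral>x. ?d 1 x *\<^sub>R levy_ker w x \<partial>lborel)"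
  proof (rule integral_dominated_convergence[where w="\<lambda>x. 2 * ?C * (?d (3/2) x * min (x\<^sup>2) 1 + ?d 1 x * min (x\<^sup>2) 1)"])
    show "integrable lborel (\<lambda>x. 2 * ?C * (?d (3/2) x * min (x\<^sup>2) 1 + ?d 1 x * min (x\<^sup>2) 1))"
      using levy_integrable_min_square[of "3/2"] levy_integrable_min_square[of 1]
      by (intro integrable_mult_right Bochner_Integration.integrable_add) (simp_all add: levy_measure_integral)
    show "AE x in lborel. (\<lambda>n. ?d (\<alpha> n) x *\<^sub>R levy_ker w x) \<longlonglongrightarrow> ?d 1 x *\<^sub>R levy_ker w x"
    proof (intro always_eventually allI)
      fix x :: real
      show "(\<lambda>n. ?d (\<alpha> n) x *\<^sub>R levy_ker w x) \<longlonglongrightarrow> ?d 1 x *\<^sub>R levy_ker w x"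
        by (cases "0 < x") (auto intro!: tendsto_eq_intros lim)
    qed
    show "AE x in lborel. norm (?d (\<alpha> n) x *\<^sub>R levy_ker w x) \<le> 2 * ?C * (?d (3/2) x * min (x\<^sup>2) 1 + ?d 1 x * min (x\<^sup>2) 1)" for n
    proof (intro always_eventually allI)
      fix x :: real
      show "norm (?d (\<alpha> n) x *\<^sub>R levy_ker w x) \<le> 2 * ?C * (?d (3/2) x * min (x\<^sup>2) 1 + ?d 1 x * min (x\<^sup>2) 1)"
      proof (cases "0 < x")
        case True
        have "x powr (- \<alpha> n - 1) \<le> x powr (- (3/2) - 1) + x powr (- 1 - 1)"
        proof (cases "x \<le> 1")
          case le: True
          have "x powr (- \<alpha> n - 1) \<le> x powr (- (3/2) - 1)"
            by (rule powr_mono') (use a[of n] le True in auto)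
          then show ?thesis by (simp add: add_increasing2)
        next
          case False
          have "x powr (- \<alpha> n - 1) \<le> x powr (- 1 - 1)"
            by (rule powr_mono) (use a[of n] False in auto)
          then show ?thesis by (simp add: add_increasing)
        qed
        then have "\<alpha> n * x powr (- \<alpha> n - 1) \<le> 2 * (x powr (- (3/2) - 1) + x powr (- 1 - 1))"
          using a[of n] by (intro mult_mono) auto
        also have "\<dots> \<le> 2 * (?d (3/2) x + ?d 1 x)" using True by simp
        finally have "?d (\<alpha> n) x \<le> 2 * (?d (3/2) x + ?d 1 x)" using True by simp
        moreover have "0 \<le> ?d (\<alpha> n) x" using a[of n] by simp
        ultimately have "norm (?d (\<alpha> n) x *\<^sub>R levy_ker w x) \<le> (2 * (?d (3/2) x + ?d 1 x)) * (?C * min (x\<^sup>2) 1)"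
          unfolding norm_scaleR using norm_levy_ker_le[OF w True order_refl]
          by (intro mult_mono) auto
        then show ?thesis by (simp add: algebra_simps)
      qed simp
    qed
  qed measurable
  then show ?thesis
    using a order_less_le_trans[OF zero_less_one a(1)]
    by (simp add: levy_exponent_def levy_measure_integral \<alpha>_def)
qed

text \<open>With \<open>h = 1 - \<alpha>\<close> the closed form is
  \<open>- ((g h - g 0) / h)\<close>, because \<open>g 0 = w\<close>. Its limit is minus the
  derivative of \<open>g\<close> at 0, where Gamma contributes the Euler constant and the exponent
  \<open>1 - h\<close> the logarithm.\<close>

lemma levy_exponent_index_1:
  assumes w: "0 \<le> Re w" "w \<noteq> 0"
  shows "levy_exponent 1 w = w * Ln w + of_real euler_mascheroni * w"
proof -
  define g where "g h = Gamma (1 + h) * w powr (1 - h)" for h :: complex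
  have "(g has_field_derivative (- of_real euler_mascheroni * w - w * Ln w)) (at 0)"
  proof -
    have "((\<lambda>z. w powr z) has_field_derivative Ln w * w powr 1) (at (1 - 0))"
      using has_field_derivative_powr_right[OF w(2), of 1] by simp
    moreover have "((\<lambda>h::complex. 1 - h) has_field_derivative - 1) (at 0)"
      by (auto intro!: derivative_eq_intros)
    ultimately have 1: "((\<lambda>h. w powr (1 - h)) has_field_derivative Ln w * w powr 1 * - 1) (at 0)"
      by (rule DERIV_chain2)
    have "(Gamma has_field_derivative Gamma 1 * Digamma 1) (at (1 + 0 :: complex))"
      unfolding add_0_right by (rule has_field_derivative_Gamma) auto
    moreover have "((\<lambda>h::complex. 1 + h) has_field_derivative 1) (at 0)"
      by (auto intro!: derivative_eq_intros)
    ultimately have 2: "((\<lambda>h. Gamma (1 + h :: complex)) has_field_derivative Gamma 1 * Digamma 1 * 1) (at 0)"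
      by (rule DERIV_chain2)
    show ?thesis unfolding g_def
      using DERIV_mult[OF 2 1] w(2) by (simp add: algebra_simps)
  qed
  then have d: "((\<lambda>h. (g h - w) / h) \<longlongrightarrow> (- of_real euler_mascheroni * w - w * Ln w)) (at 0)"
    using w(2) by (simp add: DERIV_def g_def)
  define h where "h n = - complex_of_real (1 / real (n + 2))" for n
  have h0: "h \<longlonglongrightarrow> 0"
  proof -
    have "(\<lambda>n. - complex_of_real (1 / real (n + 2))) \<longlonglongrightarrow> - complex_of_real 0"
      using LIMSEQ_ignore_initial_segment[OF lim_1_over_n, of 2] by (intro tendsto_intros) auto
    then show ?thesis by (simp add: h_def[abs_def])
  qed
  have nz: "h n \<noteq> 0" for n
    unfolding h_def using of_real_eq_0_iff[of "1 / real (n + 2)"] by (metis divide_eq_0_iff neg_equal_0_iff_equal of_nat_eq_0_iff zero_neq_one add_is_0 zero_neq_numeral)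
  have "(\<lambda>n. (g (h n) - w) / h n) \<longlonglongrightarrow> (- of_real euler_mascheroni * w - w * Ln w)"
    using d h0 nz unfolding tendsto_at_iff_sequentially comp_def by auto
  then have "(\<lambda>n. - ((g (h n) - w) / h n)) \<longlonglongrightarrow> - (- of_real euler_mascheroni * w - w * Ln w)"
    by (rule tendsto_minus)
  moreover have "- ((g (h n) - w) / h n) = levy_exponent (1 + 1 / real (n + 2)) w" for n
  proof -
    define \<alpha> where "\<alpha> = 1 + 1 / real (n + 2)"
    have a: "0 < \<alpha>" "\<alpha> < 2" "\<alpha> \<noteq> 1" by (auto simp: \<alpha>_def field_simps)
    have h: "h n = of_real (1 - \<alpha>)" by (simp add: h_def \<alpha>_def)
    have "levy_exponent \<alpha> w = (w - of_real (Gamma (2 - \<alpha>)) * w powr of_real \<alpha>) / of_real (1 - \<alpha>)"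
      by (rule levy_exponent_closed_halfplane[OF a w])
    also have "complex_of_real (Gamma (2 - \<alpha>)) = Gamma (1 + h n)"
      unfolding h by (simp flip: Gamma_complex_of_real)
    also have "complex_of_real \<alpha> = 1 - h n" unfolding h by simp
    finally have "levy_exponent \<alpha> w = (w - g (h n)) / h n" by (simp add: g_def h)
    then show ?thesis unfolding \<alpha>_def by (simp add: divide_simps nz)
  qed
  ultimately have "(\<lambda>n. levy_exponent (1 + 1 / real (n + 2)) w) \<longlonglongrightarrow> w * Ln w + of_real euler_mascheroni * w"
    by (simp add: algebra_simps)
  with levy_exponent_tendsto_1[OF w(1)] show ?thesis by (rule LIMSEQ_unique)
qed

text \<open>The coefficient that cancels the linear part left by the compensator
  \<open>min x 1\<close>, so that the exponent acquires the centering built into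
  \<open>stable_cf\<close>.\<close>

definition stable_shift :: "real \<Rightarrow> real" where
  "stable_shift \<alpha> = (if \<alpha> = 1 then euler_mascheroni else 1 / (1 - \<alpha>))"

lemma Ln_minus_ii_times: "0 < t \<Longrightarrow> Ln (- (\<i> * complex_of_real t)) = of_real (ln t) - \<i> * of_real (pi / 2)"
  using Ln_times_of_real[of t "- \<i>"] by (simp add: mult.commute Ln_of_real)

lemma stable_cf_pos:
  assumes \<alpha>: "0 < \<alpha>" "\<alpha> < 2" and t: "0 < t"
  shows "stable_cf \<alpha> t = exp (levy_exponent \<alpha> (- (\<i> * of_real t)) + \<i> * of_real (t * stable_shift \<alpha>))"
proof -
  define w where "w = - (\<i> * complex_of_real t)"
  have w: "0 \<le> Re w" "w \<noteq> 0" using t by (auto simp: w_def)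
  have ln: "Ln w = of_real (ln t) - \<i> * of_real (pi / 2)" using Ln_minus_ii_times[OF t] by (simp add: w_def)
  have "- (complex_of_real (kappa \<alpha> * \<bar>t\<bar> powr \<alpha>)) * (1 - \<i> * complex_of_real (sgn t * omega t \<alpha>))
     = levy_exponent \<alpha> w + \<i> * of_real (t * stable_shift \<alpha>)"
  proof (cases "\<alpha> = 1")
    case True
    show ?thesis
      unfolding True levy_exponent_index_1[OF w] ln
      using t by (simp add: kappa_def omega_def stable_shift_def w_def complex_eq_iff algebra_simps)
  next
    case False
    \<comment> \<open>On (0,2) the cosine vanishes only at \<alpha> = 1. Elsewhere
      \<open>cos * tan = sin\<close> turns the polar form of \<open>w powr \<alpha>\<close> into the
      factor containing \<open>omega\<close>.\<close>
    have cnz: "cos (pi * \<alpha> / 2) \<noteq> 0"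
    proof
      assume "cos (pi * \<alpha> / 2) = 0"
      then obtain i :: int where i: "odd i" "pi * \<alpha> / 2 = of_int i * (pi / 2)" by (auto simp: cos_zero_iff_int)
      then have "\<alpha> = of_int i" by simp
      with \<alpha> have "i = 1" by linarith
      with \<open>\<alpha> = of_int i\<close> False show False by simp
    qed
    have P: "w powr of_real \<alpha> = of_real (t powr \<alpha>) * (of_real (cos (pi * \<alpha> / 2)) - \<i> * of_real (sin (pi * \<alpha> / 2)))"
    proof -
      have "w powr of_real \<alpha> = exp (of_real (\<alpha> * ln t) + \<i> * of_real (- (pi * \<alpha> / 2)))"
        using w by (simp add: powr_def ln algebra_simps)
      also have "\<dots> = of_real (t powr \<alpha>) * (of_real (cos (pi * \<alpha> / 2)) - \<i> * of_real (sin (pi * \<alpha> / 2)))"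
        using t unfolding exp_add exp_of_real by (subst exp_Euler) (simp add: powr_def flip: cos_of_real sin_of_real)
      finally show ?thesis .
    qed
    have c: "of_real (cos (pi * \<alpha> / 2)) * (1 - \<i> * of_real (tan (pi * \<alpha> / 2))) = of_real (cos (pi * \<alpha> / 2)) - \<i> * of_real (sin (pi * \<alpha> / 2))"
      using cnz by (simp add: complex_eq_iff tan_def)
    have "levy_exponent \<alpha> w + \<i> * of_real (t * stable_shift \<alpha>) = - (of_real (Gamma (2 - \<alpha>)) * w powr of_real \<alpha>) / of_real (1 - \<alpha>)"
      unfolding levy_exponent_closed_halfplane[OF \<alpha> False w] using False
      by (simp add: stable_shift_def diff_divide_distrib) (simp add: w_def divide_simps)
    also have "\<dots> = - (of_real (Gamma (2 - \<alpha>)) * (of_real (t powr \<alpha>) * (of_real (cos (pi * \<alpha> / 2)) * (1 - \<i> * of_real (tan (pi * \<alpha> / 2)))))) / of_real (1 - \<alpha>)"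
      unfolding P c ..
    also have "\<dots> = - (complex_of_real (kappa \<alpha> * \<bar>t\<bar> powr \<alpha>)) * (1 - \<i> * complex_of_real (sgn t * omega t \<alpha>))"
      using t False by (simp add: kappa_def omega_def)
    finally show ?thesis ..
  qed
  then show ?thesis by (simp add: stable_cf_def w_def)
qed

lemma levy_ker_cnj: "levy_ker (cnj w) x = cnj (levy_ker w x)"
  by (simp add: levy_ker_def exp_cnj)

lemma levy_exponent_cnj: "levy_exponent \<alpha> (cnj w) = cnj (levy_exponent \<alpha> w)"
  by (simp add: levy_exponent_def levy_ker_cnj)

lemma stable_cf_uminus: "stable_cf \<alpha> (- t) = cnj (stable_cf \<alpha> t)"
  by (simp add: stable_cf_def exp_cnj omega_def sgn_minus)

text \<open>Both sides are conjugated when \<open>t\<close> changes sign, so negative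
  \<open>t\<close> reduce to positive ones, where \<open>Ln (- (\<i> * t))\<close> is
  explicit.\<close>

theorem stable_cf_levy:
  assumes \<alpha>: "0 < \<alpha>" "\<alpha> < 2"
  shows "stable_cf \<alpha> t = exp (levy_exponent \<alpha> (- (\<i> * of_real t)) + \<i> * of_real (t * stable_shift \<alpha>))"
proof (cases t "0::real" rule: linorder_cases)
  case less
  then show ?thesis
    using stable_cf_pos[OF \<alpha>, of "- t"] arg_cong[OF stable_cf_uminus[of \<alpha> t], of cnj] levy_exponent_cnj[of \<alpha> "\<i> * of_real t"]
    by (simp add: exp_cnj)
next
  case equal
  then show ?thesis by (simp add: stable_cf_def levy_exponent_def levy_ker_def \<alpha>)
next
  case greater
  then show ?thesis by (rule stable_cf_pos[OF \<alpha>])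
qed

lemma norm_stable_cf:
  "0 < \<alpha> \<Longrightarrow> norm (stable_cf \<alpha> t) = exp (- (kappa \<alpha> * \<bar>t\<bar> powr \<alpha>))"
  by (simp add: stable_cf_def)

lemma levy_ker_imaginary:
  "levy_ker (- (\<i> * of_real t)) x = iexp (t * x) - 1 - \<i> * of_real (t * min x 1)"
  by (simp add: levy_ker_def algebra_simps)

text \<open>The modulus of \<open>stable_cf\<close> is explicit, and it is also the exponential of
  the real part of the Levy exponent. Comparing the two exponents evaluates the integral.\<close>

lemma levy_integral_cos:
  assumes \<alpha>: "0 < \<alpha>" "\<alpha> < 2"
  shows "has_bochner_integral (levy_measure \<alpha>) (\<lambda>x. 1 - cos (t * x)) (kappa \<alpha> * \<bar>t\<bar> powr \<alpha>)"
proof -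
  have i: "integrable (levy_measure \<alpha>) (levy_ker (- (\<i> * of_real t)))"
    by (rule integrable_levy_ker[OF \<alpha>]) simp
  have re: "Re (levy_ker (- (\<i> * of_real t)) x) = - (1 - cos (t * x))" for x
    unfolding levy_ker_imaginary by (simp add: Re_exp)
  have 1: "integrable (levy_measure \<alpha>) (\<lambda>x. 1 - cos (t * x))"
    using integrable_minus[OF integrable_Re[OF i]] by (simp add: re)
  have "Re (levy_exponent \<alpha> (- (\<i> * of_real t))) = (\<integral>x. - (1 - cos (t * x)) \<partial>levy_measure \<alpha>)"
    unfolding levy_exponent_def using integral_Re[OF i] by (simp add: re)
  also have "\<dots> = - (\<integral>x. 1 - cos (t * x) \<partial>levy_measure \<alpha>)" by (rule Bochner_Integration.integral_minus)
  finally have "norm (stable_cf \<alpha> t) = exp (- (\<integral>x. 1 - cos (t * x) \<partial>levy_measure \<alpha>))"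
    unfolding stable_cf_levy[OF \<alpha>] by simp
  then show ?thesis using 1 \<alpha> by (simp add: norm_stable_cf has_bochner_integral_iff)
qed

lemma kappa_pos:
  assumes \<alpha>: "0 < \<alpha>" "\<alpha> < 2"
  shows "0 < kappa \<alpha>"
proof (cases \<alpha> "1::real" rule: linorder_cases)
  case less
  then show ?thesis using \<alpha> Gamma_real_pos[of "2 - \<alpha>"]
    by (auto simp: kappa_def intro!: divide_pos_pos mult_pos_pos cos_gt_zero)
next
  case equal
  then show ?thesis by (simp add: kappa_def)
next
  case greater
  have "cos (pi * \<alpha> / 2) < 0"
  proof -
    have "0 < cos (pi - pi * \<alpha> / 2)"
      by (rule cos_gt_zero_pi) (use greater \<alpha> in \<open>auto simp: field_simps\<close>)
    then show ?thesis by (simp add: cos_diff)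
  qed
  then show ?thesis using \<alpha> greater Gamma_real_pos[of "2 - \<alpha>"]
    by (simp add: kappa_def zero_less_divide_iff mult_less_0_iff)
qed

section \<open>Domains of attraction on the half line\<close>

text \<open>The assumption \<open>tail_lim\<close> is the sequential form of conditions (i) and
  (iii) together. It mentions no slowly varying function, and it is also the form in which the
  necessity proof delivers the tail condition.\<close>

locale attracted = real_distribution M for M :: "real measure" +
  fixes \<alpha> :: real and b :: "nat \<Rightarrow> real"
  assumes alpha: "0 < \<alpha>" "\<alpha> < 2"
    and nonneg: "AE x in M. 0 \<le> x"
    and b_pos: "\<And>d. 0 < b d"
    and b_lim: "filterlim b at_top sequentially"
    and tail_lim: "\<And>x. 0 < x \<Longrightarrow> (\<lambda>d. real d * measure M {b d * x<..}) \<longlonglongrightarrow> x powr (- \<alpha>)"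
begin

abbreviation T :: "real \<Rightarrow> real" where "T x \<equiv> measure M {x<..}"

lemma T_antimono: "x \<le> y \<Longrightarrow> T y \<le> T x"
  by (rule finite_measure_mono) auto

lemma T_le_1: "T x \<le> 1" by simp

lemma T_eq: "T x = 1 - cdf M x"
proof -
  have "{x<..} = UNIV - {..x}" by auto
  then show ?thesis using prob_compl[of "{..x}"] by (simp add: cdf_def)
qed

lemma T_pos: "0 < T x"
proof -
  have "\<forall>\<^sub>F d in sequentially. 0 < real d * T (b d * 1)"
    using order_tendstoD(1)[OF tail_lim[of 1], of 0] by simp
  moreover have "\<forall>\<^sub>F d in sequentially. x \<le> b d"
    using b_lim by (simp add: filterlim_at_top)
  ultimately have "\<forall>\<^sub>F d in sequentially. 0 < T x"
  proof eventually_elim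
    case (elim d)
    then have "0 < T (b d)" by (simp add: zero_less_mult_iff)
    then show ?case using T_antimono[OF elim(2)] by linarith
  qed
  then show ?thesis by simp
qed

lemma T_lim: "(T \<longlongrightarrow> 0) at_top"
  unfolding T_eq using cdf_lim_at_top_prob tendsto_diff[OF tendsto_const[of 1]] by fastforce

text \<open>The limit is given only along the points \<open>b d * x\<close>, and \<open>b\<close>
  may be irregular. A real \<open>x\<close> is therefore matched with an integer \<open>D x\<close>
  close to \<open>1 / T x\<close>; then \<open>b (D x)\<close> is asymptotically equal to
  \<open>x\<close>.\<close>

lemma T_regular:
  assumes c: "0 < c"
  shows "((\<lambda>x. T (c * x) / T x) \<longlongrightarrow> c powr (- \<alpha>)) at_top"
proof -
  \<comment> \<open>Rounding up gives \<open>1 \<le> D x * T x \<le> 1 + T x\<close>, so this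
    product tends to 1.\<close>
  define D where "D x = nat \<lceil>1 / T x\<rceil>" for x
  have D1: "1 / T x \<le> real (D x)" "real (D x) \<le> 1 / T x + 1" for x
    using T_pos[of x] by (auto simp: D_def)
  have inv: "filterlim (\<lambda>x. 1 / T x) at_top at_top"
    using filterlim_inverse_at_top[OF T_lim] T_pos by (simp add: inverse_eq_divide)
  have "filterlim (\<lambda>x. real (D x)) at_top at_top"
    by (rule filterlim_at_top_mono[OF inv]) (use D1 in auto)
  then have Dlim: "filterlim D sequentially at_top"
    by (rule filterlim_sequentially_iff_filterlim_real[THEN iffD2])
  have DT: "1 \<le> real (D x) * T x" "real (D x) * T x \<le> 1 + T x" for x
    using D1[of x] T_pos[of x] by (simp_all add: field_simps)
  have DTlim: "((\<lambda>x. real (D x) * T x) \<longlongrightarrow> 1) at_top"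
  proof (rule tendsto_sandwich[OF _ _ tendsto_const])
    show "((\<lambda>x. 1 + T x) \<longlongrightarrow> 1) at_top" using tendsto_add[OF tendsto_const T_lim] by simp
  qed (use DT in auto)
  have tl: "((\<lambda>x. real (D x) * T (b (D x) * y)) \<longlongrightarrow> y powr (- \<alpha>)) at_top" if "0 < y" for y
    using filterlim_compose[OF tail_lim[OF that] Dlim] .
  \<comment> \<open>If \<open>x\<close> exceeded \<open>b (D x) * (1 + e)\<close>, monotonicity of
    \<open>T\<close> would push \<open>D x * T x\<close> below 1.\<close>
  have up: "\<forall>\<^sub>F x in at_top. x \<le> b (D x) * (1 + e)" if e: "0 < e" for e
  proof -
    have "(1 + e) powr (- \<alpha>) < 1" using e alpha by (simp add: powr_less_one)
    then have "\<forall>\<^sub>F x in at_top. real (D x) * T (b (D x) * (1 + e)) < 1"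
      using tl[of "1 + e"] e by (intro order_tendstoD) auto
    then show ?thesis
    proof eventually_elim
      case (elim x)
      have "real (D x) * T (b (D x) * (1 + e)) < real (D x) * T x" using elim DT(1)[of x] by simp
      then have "T (b (D x) * (1 + e)) < T x" by (simp add: mult_less_cancel_left)
      then show ?case using T_antimono[of "b (D x) * (1 + e)" x] by linarith
    qed
  qed
  have lo: "\<forall>\<^sub>F x in at_top. b (D x) * (1 - e) \<le> x" if e: "0 < e" "e < 1" for e
  proof -
    have "1 powr (- \<alpha>) < (1 - e) powr (- \<alpha>)" using e alpha by (intro powr_less_mono2_neg) auto
    then have "1 < (1 - e) powr (- \<alpha>)" by simp
    \<comment> \<open>\<open>m\<close> separates 1, the limit of \<open>D x * T x\<close>, from the
      larger limit \<open>(1 - e) powr (- \<alpha>)\<close> at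
      \<open>b (D x) * (1 - e)\<close>.\<close>
    then obtain m where m: "1 < m" "m < (1 - e) powr (- \<alpha>)" using dense by blast
    have "\<forall>\<^sub>F x in at_top. m < real (D x) * T (b (D x) * (1 - e))"
      using tl[of "1 - e"] e m by (intro order_tendstoD) auto
    moreover have "\<forall>\<^sub>F x in at_top. real (D x) * T x < m"
      using DTlim m by (intro order_tendstoD) auto
    ultimately show ?thesis
    proof eventually_elim
      case (elim x)
      then have "T x < T (b (D x) * (1 - e))" by (metis mult_less_cancel_left_disj of_nat_less_0_iff order.strict_trans)
      then show ?case using T_antimono[of x "b (D x) * (1 - e)"] by linarith
    qed
  qed
  have DTc: "((\<lambda>x. real (D x) * T (c * x)) \<longlongrightarrow> c powr (- \<alpha>)) at_top"
  proof (rule order_tendstoI)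
    fix a assume a: "a < c powr (- \<alpha>)"
    have "((\<lambda>e. (c * (1 + e)) powr (- \<alpha>)) \<longlongrightarrow> (c * (1 + 0)) powr (- \<alpha>)) (at_right 0)"
      using c by (intro tendsto_intros) auto
    then have "\<forall>\<^sub>F e in at_right 0. a < (c * (1 + e)) powr (- \<alpha>)"
      using a by (intro order_tendstoD(1)) auto
    then obtain e where e: "0 < e" "a < (c * (1 + e)) powr (- \<alpha>)"
      by (metis (mono_tags, lifting) eventually_at_right_field dense)
    have "\<forall>\<^sub>F x in at_top. a < real (D x) * T (b (D x) * (c * (1 + e)))"
      using tl[of "c * (1 + e)"] e c by (intro order_tendstoD) auto
    with up[OF e(1)] show "\<forall>\<^sub>F x in at_top. a < real (D x) * T (c * x)"
    proof eventually_elim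
      case (elim x)
      have "c * x \<le> b (D x) * (c * (1 + e))" using elim(1) c by (simp add: mult.left_commute)
      then have "real (D x) * T (b (D x) * (c * (1 + e))) \<le> real (D x) * T (c * x)"
        by (intro mult_left_mono T_antimono) auto
      then show ?case using elim by linarith
    qed
  next
    fix a assume a: "c powr (- \<alpha>) < a"
    have "((\<lambda>e. (c * (1 - e)) powr (- \<alpha>)) \<longlongrightarrow> (c * (1 - 0)) powr (- \<alpha>)) (at_right 0)"
      using c by (intro tendsto_intros) auto
    then have "\<forall>\<^sub>F e in at_right 0. (c * (1 - e)) powr (- \<alpha>) < a"
      using a by (intro order_tendstoD(2)) auto
    moreover have "\<forall>\<^sub>F e in at_right 0. e < (1::real)"
      by (rule eventually_at_right_field[THEN iffD2]) (auto intro: exI[of _ 1])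
    ultimately have "\<forall>\<^sub>F e in at_right 0. (c * (1 - e)) powr (- \<alpha>) < a \<and> e < 1"
      by eventually_elim simp
    then obtain e where e: "0 < e" "e < 1" "(c * (1 - e)) powr (- \<alpha>) < a"
      by (metis (mono_tags, lifting) eventually_at_right_field dense)
    have "\<forall>\<^sub>F x in at_top. real (D x) * T (b (D x) * (c * (1 - e))) < a"
      using tl[of "c * (1 - e)"] e c by (intro order_tendstoD) auto
    with lo[OF e(1,2)] show "\<forall>\<^sub>F x in at_top. real (D x) * T (c * x) < a"
    proof eventually_elim
      case (elim x)
      have "b (D x) * (c * (1 - e)) \<le> c * x" using elim(1) c by (simp add: mult.left_commute)
      then have "real (D x) * T (c * x) \<le> real (D x) * T (b (D x) * (c * (1 - e)))"
        by (intro mult_left_mono T_antimono) auto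
      then show ?case using elim by linarith
    qed
  qed
  have "((\<lambda>x. real (D x) * T (c * x) / (real (D x) * T x)) \<longlongrightarrow> c powr (- \<alpha>) / 1) at_top"
    by (intro tendsto_divide DTc DTlim) simp
  moreover have "real (D x) * T (c * x) / (real (D x) * T x) = T (c * x) / T x" for x
  proof -
    have "real (D x) \<noteq> 0" using DT(1)[of x] by (metis mult_zero_left not_one_le_zero)
    then show ?thesis by simp
  qed
  ultimately show ?thesis by (simp only: div_by_1)
qed

section \<open>Potter bounds and dominating functions\<close>

lemma T_potter_large:
  assumes \<beta>: "0 \<le> \<beta>" "\<beta> < \<alpha>"
  obtains X where "0 < X" "\<And>x y. X \<le> x \<Longrightarrow> 1 \<le> y \<Longrightarrow> T (x * y) \<le> 2 powr \<beta> * y powr (- \<beta>) * T x"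
proof -
  have "2 powr (- \<alpha>) < 2 powr (- \<beta>)" using \<beta> by simp
  then have "\<forall>\<^sub>F x in at_top. T (2 * x) / T x < 2 powr (- \<beta>)"
    using T_regular[of 2] by (intro order_tendstoD) auto
  then have "\<forall>\<^sub>F x in at_top. T (2 * x) \<le> 2 powr (- \<beta>) * T x"
    by eventually_elim (use T_pos in \<open>simp add: field_simps less_imp_le\<close>)
  then obtain X0 where X0: "\<And>x. X0 \<le> x \<Longrightarrow> T (2 * x) \<le> 2 powr (- \<beta>) * T x"
    by (auto simp: eventually_at_top_linorder)
  define X where "X = max 1 X0"
  \<comment> \<open>Only doubling is iterated. Monotonicity of \<open>T\<close> bridges the gap
    between consecutive powers of 2 and costs the factor \<open>2 powr \<beta>\<close>.\<close>
  have iter: "T (2 ^ n * x) \<le> (2 powr (- \<beta>)) ^ n * T x" if x: "X \<le> x" for n x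
  proof (induction n)
    case (Suc n)
    have "X0 \<le> 2 ^ n * x"
    proof -
      have "1 * x \<le> 2 ^ n * x" using x by (intro mult_right_mono) (auto simp: X_def)
      moreover have "X0 \<le> x" using x by (simp add: X_def)
      ultimately show ?thesis by linarith
    qed
    then have "T (2 ^ Suc n * x) \<le> 2 powr (- \<beta>) * T (2 ^ n * x)" using X0 by (simp add: mult.assoc)
    also have "\<dots> \<le> 2 powr (- \<beta>) * ((2 powr (- \<beta>)) ^ n * T x)" by (intro mult_left_mono Suc) auto
    finally show ?case by simp
  qed simp
  show ?thesis
  proof (rule that[of X])
    fix x y :: real assume x: "X \<le> x" and y: "1 \<le> y"
    define n where "n = nat \<lfloor>log 2 y\<rfloor>"
    have l0: "0 \<le> log 2 y" using y by simp
    have n: "real n \<le> log 2 y" "log 2 y < real n + 1" using l0 by (auto simp: n_def)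
    have x0: "0 < x" using x by (simp add: X_def)
    have "2 powr real n \<le> 2 powr (log 2 y)" using n by (intro powr_mono) auto
    then have "2 ^ n \<le> y" using y by (simp add: powr_realpow)
    then have "T (x * y) \<le> T (2 ^ n * x)" using x0 by (intro T_antimono) (simp add: mult.commute)
    also have "\<dots> \<le> (2 powr (- \<beta>)) ^ n * T x" by (rule iter[OF x])
    also have "(2 powr (- \<beta>)) ^ n = (2::real) powr (- \<beta> * real n)" by (simp add: powr_powr flip: powr_realpow)
    also have "\<dots> \<le> 2 powr (\<beta> - \<beta> * log 2 y)"
      using n \<beta> mult_left_mono[of "log 2 y" "real n + 1" \<beta>] by (intro powr_mono) (auto simp: algebra_simps)
    also have "\<dots> = 2 powr \<beta> * y powr (- \<beta>)"
    proof -
      have "2 powr (log 2 y * \<beta>) = y powr \<beta>" using y by (simp flip: powr_powr)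
      then show ?thesis by (simp add: powr_diff powr_minus mult.commute field_simps)
    qed
    finally show "T (x * y) \<le> 2 powr \<beta> * y powr (- \<beta>) * T x" using T_pos[of x] by (simp add: mult_right_mono)
  qed (simp add: X_def)
qed

lemma T_potter_small:
  assumes \<beta>: "\<alpha> < \<beta>"
  obtains X where "0 < X" "\<And>x y. X \<le> x \<Longrightarrow> 1 \<le> y \<Longrightarrow> T x \<le> 2 powr \<beta> * y powr \<beta> * T (x * y)"
proof -
  have b0: "0 < \<beta>" using \<beta> alpha by simp
  have "2 powr (- \<beta>) < 2 powr (- \<alpha>)" using \<beta> by simp
  then have "\<forall>\<^sub>F x in at_top. 2 powr (- \<beta>) < T (2 * x) / T x"
    using T_regular[of 2] by (intro order_tendstoD) auto
  then have "\<forall>\<^sub>F x in at_top. T x \<le> 2 powr \<beta> * T (2 * x)"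
    by eventually_elim (use T_pos in \<open>simp add: field_simps powr_minus less_imp_le\<close>)
  then obtain X0 where X0: "\<And>x. X0 \<le> x \<Longrightarrow> T x \<le> 2 powr \<beta> * T (2 * x)"
    by (auto simp: eventually_at_top_linorder)
  define X where "X = max 1 X0"
  have iter: "T x \<le> (2 powr \<beta>) ^ n * T (2 ^ n * x)" if x: "X \<le> x" for n x
  proof (induction n)
    case (Suc n)
    have "X0 \<le> 2 ^ n * x"
    proof -
      have "1 * x \<le> 2 ^ n * x" using x by (intro mult_right_mono) (auto simp: X_def)
      moreover have "X0 \<le> x" using x by (simp add: X_def)
      ultimately show ?thesis by linarith
    qed
    then have "T (2 ^ n * x) \<le> 2 powr \<beta> * T (2 ^ Suc n * x)" using X0 by (simp add: mult.assoc)
    then have "(2 powr \<beta>) ^ n * T (2 ^ n * x) \<le> (2 powr \<beta>) ^ n * (2 powr \<beta> * T (2 ^ Suc n * x))"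
      by (intro mult_left_mono) auto
    with Suc have "T x \<le> (2 powr \<beta>) ^ n * (2 powr \<beta> * T (2 ^ Suc n * x))" by linarith
    then show ?case by (simp add: mult_ac)
  qed simp
  show ?thesis
  proof (rule that[of X])
    fix x y :: real assume x: "X \<le> x" and y: "1 \<le> y"
    \<comment> \<open>Rounded up this time, because \<open>T (x * y)\<close> has to be bounded below
      by the value of \<open>T\<close> at the next power of 2.\<close>
    define n where "n = nat \<lceil>log 2 y\<rceil>"
    have l0: "0 \<le> log 2 y" using y by simp
    have n: "log 2 y \<le> real n" "real n \<le> log 2 y + 1" using l0 by (auto simp: n_def)
    have x0: "0 < x" using x by (simp add: X_def)
    have "2 powr (log 2 y) \<le> 2 powr real n" using n by (intro powr_mono) auto
    then have yn: "y \<le> 2 ^ n" using y by (simp add: powr_realpow)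
    have "T x \<le> (2 powr \<beta>) ^ n * T (2 ^ n * x)" by (rule iter[OF x])
    also have "\<dots> \<le> (2 powr \<beta>) ^ n * T (x * y)"
      using x0 yn by (intro mult_left_mono T_antimono) (auto simp: mult.commute)
    also have "(2 powr \<beta>) ^ n = (2::real) powr (\<beta> * real n)" by (simp add: powr_powr flip: powr_realpow)
    also have "\<dots> * T (x * y) \<le> 2 powr (\<beta> + \<beta> * log 2 y) * T (x * y)"
      using n b0 mult_left_mono[of "real n" "log 2 y + 1" \<beta>] by (intro mult_right_mono powr_mono) (auto simp: algebra_simps)
    also have "2 powr (\<beta> + \<beta> * log 2 y) = 2 powr \<beta> * y powr \<beta>"
    proof -
      have "2 powr (log 2 y * \<beta>) = y powr \<beta>" using y by (simp flip: powr_powr)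
      then show ?thesis by (simp add: powr_add mult.commute)
    qed
    finally show "T x \<le> 2 powr \<beta> * y powr \<beta> * T (x * y)" .
  qed (simp add: X_def)
qed

lemma ev_dT: "\<forall>\<^sub>F d in sequentially. real d * T (b d) \<le> 2"
proof -
  have "\<forall>\<^sub>F d in sequentially. real d * T (b d * 1) < 2"
    using tail_lim[of 1] by (intro order_tendstoD) auto
  then show ?thesis by eventually_elim simp
qed

lemma dominate_large:
  assumes \<beta>: "0 \<le> \<beta>" "\<beta> < \<alpha>"
  obtains C where "0 \<le> C" "\<forall>\<^sub>F d in sequentially. \<forall>y\<ge>1. real d * T (b d * y) \<le> C * y powr (- \<beta>)"
proof -
  obtain X where X: "0 < X" "\<And>x y. X \<le> x \<Longrightarrow> 1 \<le> y \<Longrightarrow> T (x * y) \<le> 2 powr \<beta> * y powr (- \<beta>) * T x"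
    using T_potter_large[OF \<beta>] by blast
  have "\<forall>\<^sub>F d in sequentially. X \<le> b d" using b_lim by (simp add: filterlim_at_top)
  with ev_dT have "\<forall>\<^sub>F d in sequentially. \<forall>y\<ge>1. real d * T (b d * y) \<le> (2 * 2 powr \<beta>) * y powr (- \<beta>)"
  proof eventually_elim
    case (elim d)
    show ?case
    proof (intro allI impI)
      fix y :: real assume "1 \<le> y"
      then have "real d * T (b d * y) \<le> real d * (2 powr \<beta> * y powr (- \<beta>) * T (b d))"
        using X(2)[OF elim(2)] by (intro mult_left_mono) auto
      also have "\<dots> = (real d * T (b d)) * (2 powr \<beta> * y powr (- \<beta>))" by simp
      also have "\<dots> \<le> 2 * (2 powr \<beta> * y powr (- \<beta>))" by (intro mult_right_mono elim(1)) auto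
      finally show "real d * T (b d * y) \<le> (2 * 2 powr \<beta>) * y powr (- \<beta>)" by simp
    qed
  qed
  then show ?thesis by (rule that[rotated]) simp
qed

text \<open>The Potter bound works only while \<open>b d * y\<close> is above its threshold
  \<open>X\<close>. Below it \<open>T\<close> is bounded by 1, and comparing \<open>T X\<close> with
  \<open>T (b d)\<close> shows \<open>d \<le> C1 * (b d / X) powr \<beta>\<close>, which is at most
  \<open>C1 * y powr (- \<beta>)\<close> there.\<close>

lemma dominate_small:
  assumes \<beta>: "\<alpha> < \<beta>"
  obtains C where "0 \<le> C" "\<forall>\<^sub>F d in sequentially. \<forall>y. 0 < y \<and> y \<le> 1 \<longrightarrow> real d * T (b d * y) \<le> C * y powr (- \<beta>)"
    "\<forall>\<^sub>F d in sequentially. real d \<le> C * b d powr \<beta>"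
proof -
  have b0: "0 < \<beta>" using \<beta> alpha by simp
  obtain X where X: "0 < X" "\<And>x y. X \<le> x \<Longrightarrow> 1 \<le> y \<Longrightarrow> T x \<le> 2 powr \<beta> * y powr \<beta> * T (x * y)"
    using T_potter_small[OF \<beta>] by blast
  define C1 where "C1 = 2 * 2 powr \<beta> / T X"
  define C where "C = max (C1 / X powr \<beta>) (max C1 (2 * 2 powr \<beta>))"
  have C1: "0 < C1" using T_pos[of X] by (simp add: C1_def)
  have evX: "\<forall>\<^sub>F d in sequentially. X \<le> b d" using b_lim by (simp add: filterlim_at_top)
  have dX: "\<forall>\<^sub>F d in sequentially. real d \<le> C1 * (b d / X) powr \<beta>"
    using ev_dT evX
  proof eventually_elim
    case (elim d)
    have "T X \<le> 2 powr \<beta> * (b d / X) powr \<beta> * T (X * (b d / X))" using X(1) elim by (intro X(2)) auto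
    then have "real d * T X \<le> real d * (2 powr \<beta> * (b d / X) powr \<beta> * T (b d))"
      using X(1) by (intro mult_left_mono) auto
    also have "\<dots> = (real d * T (b d)) * (2 powr \<beta> * (b d / X) powr \<beta>)" by simp
    also have "\<dots> \<le> 2 * (2 powr \<beta> * (b d / X) powr \<beta>)" by (intro mult_right_mono elim(1)) auto
    finally show ?case using T_pos[of X] by (simp add: C1_def field_simps)
  qed
  have 2: "\<forall>\<^sub>F d in sequentially. real d \<le> C * b d powr \<beta>"
    using dX
  proof eventually_elim
    case (elim d)
    have "C1 * (b d / X) powr \<beta> = (C1 / X powr \<beta>) * b d powr \<beta>"
      using X(1) b_pos[of d] by (simp add: powr_divide)
    also have "\<dots> \<le> C * b d powr \<beta>" by (intro mult_right_mono) (auto simp: C_def)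
    finally show ?case using elim by linarith
  qed
  have 1: "\<forall>\<^sub>F d in sequentially. \<forall>y. 0 < y \<and> y \<le> 1 \<longrightarrow> real d * T (b d * y) \<le> C * y powr (- \<beta>)"
    using ev_dT dX
  proof eventually_elim
    case (elim d)
    show ?case
    proof (intro allI impI, elim conjE)
      fix y :: real assume y: "0 < y" "y \<le> 1"
      show "real d * T (b d * y) \<le> C * y powr (- \<beta>)"
      proof (cases "X \<le> b d * y")
        case True
        have "T (b d * y) \<le> 2 powr \<beta> * (1 / y) powr \<beta> * T (b d * y * (1 / y))"
          using True y by (intro X(2)) auto
        then have "real d * T (b d * y) \<le> real d * (2 powr \<beta> * (1 / y) powr \<beta> * T (b d))"
          using y by (intro mult_left_mono) auto
        also have "\<dots> = (real d * T (b d)) * (2 powr \<beta> * y powr (- \<beta>))"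
          using y by (simp add: powr_divide powr_minus field_simps)
        also have "\<dots> \<le> 2 * (2 powr \<beta> * y powr (- \<beta>))" by (intro mult_right_mono elim(1)) auto
        also have "\<dots> \<le> C * y powr (- \<beta>)" by (simp add: C_def mult_right_mono flip: mult.assoc)
        finally show ?thesis .
      next
        case False
        have "real d * T (b d * y) \<le> real d" using T_le_1 by (intro mult_left_le) auto
        also have "\<dots> \<le> C1 * (b d / X) powr \<beta>" by (rule elim)
        also have "\<dots> \<le> C1 * (1 / y) powr \<beta>"
          using False X(1) y b_pos[of d] C1 b0 by (intro mult_left_mono powr_mono2) (auto simp: field_simps)
        also have "\<dots> = C1 * y powr (- \<beta>)" using y by (simp add: powr_divide powr_minus field_simps)
        also have "\<dots> \<le> C * y powr (- \<beta>)" by (intro mult_right_mono) (auto simp: C_def)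
        finally show ?thesis .
      qed
    qed
  qed
  show ?thesis by (rule that[OF _ 1 2]) (use C1 in \<open>auto simp: C_def\<close>)
qed

lemma d_over_b_square: "(\<lambda>d. real d / (b d)\<^sup>2) \<longlonglongrightarrow> 0"
proof -
  \<comment> \<open>Strictly between \<alpha> and 2, so that the bound
    \<open>C * b d powr \<beta>\<close> for \<open>d\<close> is of smaller order than
    \<open>(b d)\<^sup>2\<close>.\<close>
  define \<beta> where "\<beta> = (\<alpha> + 2) / 2"
  have \<beta>: "\<alpha> < \<beta>" "\<beta> < 2" using alpha by (auto simp: \<beta>_def)
  obtain C where C: "0 \<le> C" "\<forall>\<^sub>F d in sequentially. \<forall>y. 0 < y \<and> y \<le> 1 \<longrightarrow> real d * T (b d * y) \<le> C * y powr (- \<beta>)"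
    "\<forall>\<^sub>F d in sequentially. real d \<le> C * b d powr \<beta>"
    by (rule dominate_small[OF \<beta>(1)])
  have "(\<lambda>d. C * b d powr (\<beta> - 2)) \<longlonglongrightarrow> C * 0"
    using \<beta> b_lim by (intro tendsto_intros tendsto_neg_powr) auto
  then have lim0: "(\<lambda>d. C * b d powr (\<beta> - 2)) \<longlonglongrightarrow> 0" by simp
  show ?thesis
  proof (rule tendsto_sandwich[OF _ _ tendsto_const lim0])
    show "\<forall>\<^sub>F d in sequentially. real d / (b d)\<^sup>2 \<le> C * b d powr (\<beta> - 2)"
      using C(3)
    proof eventually_elim
      case (elim d)
      have "real d / (b d)\<^sup>2 \<le> (C * b d powr \<beta>) / (b d)\<^sup>2" using elim by (intro divide_right_mono) auto
      also have "\<dots> = C * b d powr (\<beta> - 2)" using b_pos[of d] by (simp add: powr_diff)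
      finally show ?case .
    qed
  qed simp
qed

end

section \<open>Convergence of characteristic functions\<close>

lemma integral_Ioo_cut:
  fixes \<kappa> :: "real \<Rightarrow> 'a::{banach, second_countable_topology}"
  assumes "0 \<le> x" "0 \<le> c"
  shows "(\<integral>y. indicator {0<..<x} y *\<^sub>R (indicator {..<c} y *\<^sub>R \<kappa> y) \<partial>lborel)
     = (\<integral>y. indicator {0<..<min x c} y *\<^sub>R \<kappa> y \<partial>lborel)"
  by (intro Bochner_Integration.integral_cong) (auto simp: indicator_def)

lemma integrable_indicator_Ioo_continuous:
  fixes f :: "real \<Rightarrow> 'a::euclidean_space"
  assumes "continuous_on UNIV f"
  shows "integrable lborel (\<lambda>y. indicator {a<..<b} y *\<^sub>R f y)"
proof -
  have "set_integrable lborel {a..b} f"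
    by (rule borel_integrable_atLeastAtMost') (use assms continuous_on_subset in blast)
  then have "set_integrable lborel {a<..<b} f"
    by (rule set_integrable_subset) auto
  then show ?thesis by (simp add: set_integrable_def)
qed

lemma (in prob_space) Cauchy_Schwarz_indicator:
  assumes [measurable]: "g \<in> borel_measurable M" "A \<in> events" and g: "integrable M (\<lambda>x. (g x)\<^sup>2)"
  shows "(expectation (\<lambda>x. g x * indicator A x))\<^sup>2 \<le> prob A * expectation (\<lambda>x. (g x)\<^sup>2)"
proof -
  let ?m = "expectation (\<lambda>x. g x * indicator A x)"
  have i: "integrable M (\<lambda>x. g x * indicator A x)"
  proof (rule Bochner_Integration.integrable_bound)
    show "integrable M (\<lambda>x. (g x)\<^sup>2 + 1)" using g by simp
    show "AE x in M. norm (g x * indicator A x) \<le> norm ((g x)\<^sup>2 + 1)"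
    proof (rule AE_I2)
      fix x
      have "\<bar>g x\<bar> \<le> (g x)\<^sup>2 + 1"
        using sum_squares_bound[of "\<bar>g x\<bar>" 1] by simp
      then show "norm (g x * indicator A x) \<le> norm ((g x)\<^sup>2 + 1)"
        by (auto simp: indicator_def)
    qed
  qed simp
  show ?thesis
  proof (cases "prob A = 0")
    case True
    have "AE x in M. g x * indicator A x = 0"
      using True by (auto simp: prob_eq_0 indicator_def elim: eventually_mono)
    then have "?m = 0" by (rule integral_eq_zero_AE)
    then show ?thesis using True by simp
  next
    case False
    then have p: "0 < prob A" by (simp add: less_le)
    have iA: "integrable M (indicator A :: _ \<Rightarrow> real)"
      by (rule integrable_real_indicator) (simp_all add: less_top[symmetric])
    \<comment> \<open>The coefficient that minimizes the expected square; inserting it gives the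
      Cauchy-Schwarz inequality.\<close>
    define l where "l = ?m / prob A"
    have "0 \<le> expectation (\<lambda>x. (g x - l * indicator A x)\<^sup>2)" by simp
    also have "(\<lambda>x. (g x - l * indicator A x)\<^sup>2) = (\<lambda>x. (g x)\<^sup>2 - 2 * l * (g x * indicator A x) + l\<^sup>2 * indicator A x)"
      by (auto simp: fun_eq_iff indicator_def power2_eq_square algebra_simps)
    also have "expectation \<dots> = expectation (\<lambda>x. (g x)\<^sup>2) - 2 * l * ?m + l\<^sup>2 * prob A"
    proof -
      have "has_bochner_integral M (\<lambda>x. (g x)\<^sup>2 - 2 * l * (g x * indicator A x) + l\<^sup>2 * indicator A x)
         (expectation (\<lambda>x. (g x)\<^sup>2) - 2 * l * ?m + l\<^sup>2 * expectation (indicator A))"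
        by (intro has_bochner_integral_add has_bochner_integral_diff has_bochner_integral_mult_right has_bochner_integral_integrable g i iA)
      then show ?thesis by (simp add: has_bochner_integral_iff)
    qed
    also have "\<dots> = expectation (\<lambda>x. (g x)\<^sup>2) - ?m\<^sup>2 / prob A"
      using p by (simp add: l_def power2_eq_square)
    finally show ?thesis using p by (simp add: field_simps)
  qed
qed

lemma (in real_distribution) integrable_indicator_borel:
  "A \<in> sets borel \<Longrightarrow> integrable M (indicator A :: real \<Rightarrow> real)"
  by (rule integrable_real_indicator) (simp_all add: less_top[symmetric])

lemma (in real_distribution) prob_UNIV: "prob UNIV = 1"
  using prob_space by simp

lemma cmod_1_minus_iexp_square: "(cmod (1 - iexp x))\<^sup>2 = 2 * (1 - cos x)"
  by (simp add: cmod_power2 Re_exp Im_exp power2_diff)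

text \<open>This serves to show that \<open>d\<close> times the square of
  \<open>cmod (char M (t / b d) - 1)\<close> vanishes although only
  \<open>d * (1 - Re (char M (t / b d)))\<close> is known to be bounded. Below \<open>R\<close> the
  integrand is Lipschitz in \<open>s\<close>; above \<open>R\<close> Cauchy-Schwarz brings in the
  small factor \<open>prob {R<..}\<close>, since the square of \<open>cmod (1 - iexp y)\<close> is
  \<open>2 * (1 - cos y)\<close>.\<close>

lemma (in real_distribution) char_diff_1_bound:
  assumes nonneg: "AE x in M. 0 \<le> x" and R: "0 \<le> R"
  shows "(cmod (1 - char M s))\<^sup>2 \<le> 2 * s\<^sup>2 * R\<^sup>2 + 4 * prob {R<..} * (1 - Re (char M s))"
proof -
  let ?g = "\<lambda>x. cmod (1 - iexp (s * x))"
  have ie: "integrable M (\<lambda>x. iexp (s * x))" by (rule integrable_iexp) auto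
  have ig: "integrable M ?g" using ie by (intro integrable_norm Bochner_Integration.integrable_diff) auto
  have igA: "integrable M (\<lambda>x. ?g x * indicator {R<..} x)"
    using ig by (rule integrable_real_mult_indicator[rotated]) auto
  have eq: "(?g x)\<^sup>2 = 2 * (1 - Re (iexp (s * x)))" for x
    unfolding cmod_1_minus_iexp_square by (simp add: Re_exp)
  have ig2: "integrable M (\<lambda>x. (?g x)\<^sup>2)" unfolding eq using integrable_Re[OF ie] by simp
  have Eg2: "expectation (\<lambda>x. (?g x)\<^sup>2) = 2 * (1 - Re (char M s))"
    unfolding eq using integrable_Re[OF ie] integral_Re[OF ie] by (simp add: char_def prob_UNIV)
  have "1 - char M s = (CLINT x|M. 1 - iexp (s * x))"
    unfolding char_def using ie by (simp add: prob_UNIV)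
  then have "cmod (1 - char M s) \<le> expectation ?g" using integral_norm_bound by metis
  also have "\<dots> \<le> expectation (\<lambda>x. \<bar>s\<bar> * R + ?g x * indicator {R<..} x)"
  proof (rule integral_mono_AE)
    show "AE x in M. ?g x \<le> \<bar>s\<bar> * R + ?g x * indicator {R<..} x"
      using nonneg
    proof eventually_elim
      case (elim x)
      have "cmod (iexp (s * x) - 1) \<le> \<bar>s * x\<bar>" using iexp_approx1[of "s * x" 0] by simp
      then have "?g x \<le> \<bar>s\<bar> * x" using elim by (simp add: norm_minus_commute abs_mult)
      moreover have "\<bar>s\<bar> * x \<le> \<bar>s\<bar> * R" if "x \<le> R" using that by (simp add: mult_left_mono)
      ultimately show ?case using R by (cases "x \<le> R") auto
    qed
  qed (use ig igA in auto)
  also have "\<dots> = \<bar>s\<bar> * R + expectation (\<lambda>x. ?g x * indicator {R<..} x)"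
    using igA by (simp add: prob_UNIV)
  finally have "cmod (1 - char M s) \<le> \<bar>s\<bar> * R + expectation (\<lambda>x. ?g x * indicator {R<..} x)" .
  then have "(cmod (1 - char M s))\<^sup>2 \<le> (\<bar>s\<bar> * R + expectation (\<lambda>x. ?g x * indicator {R<..} x))\<^sup>2"
    by (intro power_mono) auto
  also have "\<dots> \<le> 2 * (\<bar>s\<bar> * R)\<^sup>2 + 2 * (expectation (\<lambda>x. ?g x * indicator {R<..} x))\<^sup>2"
    using sum_squares_bound[of "\<bar>s\<bar> * R" "expectation (\<lambda>x. ?g x * indicator {R<..} x)"] by (simp add: power2_sum)
  also have "\<dots> \<le> 2 * (\<bar>s\<bar> * R)\<^sup>2 + 2 * (prob {R<..} * (2 * (1 - Re (char M s))))"
  proof -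
    have "(expectation (\<lambda>x. ?g x * indicator {R<..} x))\<^sup>2 \<le> prob {R<..} * expectation (\<lambda>x. (?g x)\<^sup>2)"
      by (rule Cauchy_Schwarz_indicator[OF _ _ ig2]) auto
    then show ?thesis unfolding Eg2 by simp
  qed
  finally show ?thesis by (simp add: power_mult_distrib algebra_simps)
qed

text \<open>Comparing \<open>d\<close>-th powers inside the unit disc costs only a factor
  \<open>d\<close>, which avoids complex logarithms. The constant \<open>exp 2\<close> arises from
  \<open>cmod z \<le> 2\<close>.\<close>

lemma power_minus_exp_bound:
  fixes z :: complex
  assumes "cmod (1 + z) \<le> 1"
  shows "cmod ((1 + z) ^ d - exp (of_nat d * z)) \<le> real d * (exp 2 * (cmod z)\<^sup>2)"
proof -
  have "Re (1 + z) \<le> 1" using assms complex_Re_le_cmod order_trans by blast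
  then have e: "cmod (exp z) \<le> 1" by simp
  have "cmod z \<le> 2" using assms norm_triangle_ineq4[of "1 + z" 1] by simp
  have "cmod ((1 + z) ^ d - exp z ^ d) \<le> real d * cmod ((1 + z) - exp z)"
    by (rule norm_power_diff[OF assms e])
  also have "cmod ((1 + z) - exp z) = cmod (exp z - 1 - z)" by (simp add: norm_minus_commute algebra_simps)
  also have "\<dots> \<le> exp (cmod z) * (cmod z)\<^sup>2" by (rule norm_exp_diff_2)
  also have "\<dots> \<le> exp 2 * (cmod z)\<^sup>2" using \<open>cmod z \<le> 2\<close> by (intro mult_right_mono) auto
  finally show ?thesis by (simp add: exp_of_nat_mult mult_left_mono)
qed

context attracted
begin

text \<open>By the layer cake formula, \<open>d\<close> times the integral is that of
  \<open>d * T (b d * y)\<close> against \<kappa>, whose pointwise limit is the weight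
  \<open>y powr (- \<alpha>)\<close>. The Potter exponents on either side of \<alpha> dominate it,
  \<open>\<beta>\<^sub>1\<close> near 0 and \<open>\<beta>\<^sub>2\<close> near infinity, so the
  only condition on \<kappa> is integrability against that majorant.\<close>

lemma scaled_integral_lim:
  fixes \<kappa> F :: "real \<Rightarrow> 'a::euclidean_space"
  assumes [measurable]: "\<kappa> \<in> borel_measurable borel" "F \<in> borel_measurable borel"
    and \<beta>: "\<alpha> < \<beta>\<^sub>1" "0 \<le> \<beta>\<^sub>2" "\<beta>\<^sub>2 < \<alpha>"
    and dom: "integrable lborel (\<lambda>y. (indicator {0<..1} y * y powr (- \<beta>\<^sub>1) + indicator {1<..} y * y powr (- \<beta>\<^sub>2)) * norm (\<kappa> y))"
    and F: "\<And>x. 0 \<le> x \<Longrightarrow> (\<integral>y. indicator {0<..<x} y *\<^sub>R \<kappa> y \<partial>lborel) = F x"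
  shows "\<forall>\<^sub>F d in sequentially. integrable M (\<lambda>x. F (x / b d))"
    and "(\<lambda>d. real d *\<^sub>R (\<integral>x. F (x / b d) \<partial>M)) \<longlonglongrightarrow> integral\<^sup>L (levy_measure \<alpha>) F"
    and "integrable (levy_measure \<alpha>) F"
proof -
  obtain C1 where C1: "0 \<le> C1" "\<forall>\<^sub>F d in sequentially. \<forall>y. 0 < y \<and> y \<le> 1 \<longrightarrow> real d * T (b d * y) \<le> C1 * y powr (- \<beta>\<^sub>1)"
    "\<forall>\<^sub>F d in sequentially. real d \<le> C1 * b d powr \<beta>\<^sub>1"
    by (rule dominate_small[OF \<beta>(1)])
  obtain C2 where C2: "0 \<le> C2" "\<forall>\<^sub>F d in sequentially. \<forall>y\<ge>1. real d * T (b d * y) \<le> C2 * y powr (- \<beta>\<^sub>2)"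
    by (rule dominate_large[OF \<beta>(2,3)])
  \<comment> \<open>The common majorant of \<open>d * T (b d * y)\<close> up to the constant
    \<open>C\<close>.\<close>
  define W where "W y = indicator {0<..1} y * y powr (- \<beta>\<^sub>1) + indicator {1<..} y * y powr (- \<beta>\<^sub>2)" for y :: real
  define C where "C = max C1 C2"
  have Wnn: "0 \<le> W y" for y by (auto simp: W_def)
  have [measurable]: "W \<in> borel_measurable borel" unfolding W_def[abs_def] by measurable
  have ev: "\<forall>\<^sub>F d in sequentially. 0 < d \<and> (\<forall>y>0. real d * T (b d * y) \<le> C * W y)"
    using C1(2) C2(2) eventually_gt_at_top[of 0]
  proof eventually_elim
    case (elim d)
    have "real d * T (b d * y) \<le> C * W y" if y: "0 < y" for y
    proof (cases "y \<le> 1")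
      case True
      have "real d * T (b d * y) \<le> C1 * y powr (- \<beta>\<^sub>1)" using elim(1) y True by auto
      also have "\<dots> \<le> C * y powr (- \<beta>\<^sub>1)" by (intro mult_right_mono) (auto simp: C_def)
      finally show ?thesis using y True by (simp add: W_def)
    next
      case False
      have "real d * T (b d * y) \<le> C2 * y powr (- \<beta>\<^sub>2)" using elim(2) False by auto
      also have "\<dots> \<le> C * y powr (- \<beta>\<^sub>2)" by (intro mult_right_mono) (auto simp: C_def)
      finally show ?thesis using False by (simp add: W_def)
    qed
    then show ?case using elim by simp
  qed
  have dom': "integrable lborel (\<lambda>y. C * (W y * norm (\<kappa> y)))" using dom by (simp add: W_def[abs_def])
  have [measurable]: "T \<in> borel_measurable borel"
  proof -
    have "mono (\<lambda>x. - T x)" by (rule monoI) (use T_antimono in auto)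
    then have "(\<lambda>x. - T x) \<in> borel_measurable borel" by (rule borel_measurable_mono)
    then show ?thesis using borel_measurable_uminus_eq by blast
  qed
  define h where "h d y = (indicator {0<..} y * (real d * T (b d * y))) *\<^sub>R \<kappa> y" for d y
  have [measurable]: "h d \<in> borel_measurable borel" for d unfolding h_def[abs_def] by measurable
  have hb: "norm (h d y) \<le> C * (W y * norm (\<kappa> y))" if "\<forall>y>0. real d * T (b d * y) \<le> C * W y" for d y
    using that mult_right_mono[of "real d * T (b d * y)" "C * W y" "norm (\<kappa> y)"] Wnn[of y] C1(1)
    by (cases "0 < y") (auto simp: h_def abs_mult C_def mult.assoc)
  have lim_h: "(\<lambda>d. h d y) \<longlonglongrightarrow> (indicator {0<..} y * y powr (- \<alpha>)) *\<^sub>R \<kappa> y" for y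
    unfolding h_def by (cases "0 < y") (auto intro!: tendsto_intros tail_lim)
  have int_h: "integrable lborel (h d)" if "\<forall>y>0. real d * T (b d * y) \<le> C * W y" for d
    by (rule Bochner_Integration.integrable_bound[OF dom']) (use hb[OF that] in \<open>auto intro: order_trans[OF _ abs_ge_self]\<close>)
  \<comment> \<open>Domination holds only from some index on, so dominated convergence is applied to
    the sequence shifted by \<open>d0\<close>.\<close>
  obtain d0 where d0: "\<And>d. d0 \<le> d \<Longrightarrow> 0 < d \<and> (\<forall>y>0. real d * T (b d * y) \<le> C * W y)"
    using ev by (auto simp: eventually_sequentially)
  have "(\<lambda>d. integral\<^sup>L lborel (h (d + d0))) \<longlonglongrightarrow> (\<integral>y. (indicator {0<..} y * y powr (- \<alpha>)) *\<^sub>R \<kappa> y \<partial>lborel)"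
  proof (rule integral_dominated_convergence[OF _ _ dom'])
    show "AE y in lborel. (\<lambda>d. h (d + d0) y) \<longlonglongrightarrow> (indicator {0<..} y * y powr (- \<alpha>)) *\<^sub>R \<kappa> y"
      by (intro always_eventually allI LIMSEQ_ignore_initial_segment lim_h)
    show "AE y in lborel. norm (h (d + d0) y) \<le> C * (W y * norm (\<kappa> y))" for d
      by (intro always_eventually allI hb) (use d0[of "d + d0"] in auto)
  qed auto
  then have lim: "(\<lambda>d. integral\<^sup>L lborel (h d)) \<longlonglongrightarrow> (\<integral>y. (indicator {0<..} y * y powr (- \<alpha>)) *\<^sub>R \<kappa> y \<partial>lborel)"
    by (rule LIMSEQ_offset)
  have ilim: "integrable lborel (\<lambda>y. (indicator {0<..} y * y powr (- \<alpha>)) *\<^sub>R \<kappa> y)"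
  proof (rule integrable_dominated_convergence[OF _ _ dom'])
    show "AE y in lborel. (\<lambda>d. h (d + d0) y) \<longlonglongrightarrow> (indicator {0<..} y * y powr (- \<alpha>)) *\<^sub>R \<kappa> y"
      by (intro always_eventually allI LIMSEQ_ignore_initial_segment lim_h)
    show "AE y in lborel. norm (h (d + d0) y) \<le> C * (W y * norm (\<kappa> y))" for d
      by (intro always_eventually allI hb) (use d0[of "d + d0"] in auto)
  qed auto
  note L = layer_cake_levy[OF alpha(1) _ _ ilim F, OF _ _ less_imp_le]
  show "integrable (levy_measure \<alpha>) F" using L(1) by simp
  have cake: "integrable M (\<lambda>x. F (x / b d)) \<and> real d *\<^sub>R (\<integral>x. F (x / b d) \<partial>M) = integral\<^sup>L lborel (h d)"
    if d: "0 < d \<and> (\<forall>y>0. real d * T (b d * y) \<le> C * W y)" for d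
  proof -
    define N where "N = distr M borel (\<lambda>x. x / b d)"
    interpret N: real_distribution N unfolding N_def by (rule real_distribution_distr) simp
    have mN: "measure N {y<..} = T (b d * y)" for y
    proof -
      have "(\<lambda>x. x / b d) -` {y<..} \<inter> space M = {b d * y<..}"
        using b_pos[of d] by (auto simp: field_simps)
      then show ?thesis unfolding N_def by (subst measure_distr) auto
    qed
    have eq: "indicator {0<..} y *\<^sub>R (measure N {y<..} *\<^sub>R \<kappa> y) = (1 / real d) *\<^sub>R h d y" for y
      using d by (auto simp: h_def mN indicator_def)
    have i: "integrable lborel (\<lambda>y. indicator {0<..} y *\<^sub>R (measure N {y<..} *\<^sub>R \<kappa> y))"
      unfolding eq using int_h d by auto
    have sf: "sigma_finite_measure N" ..
    note L = layer_cake[OF sf N.events_eq_borel _ _ i]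
    have AE0: "AE x in N. 0 \<le> x"
      unfolding N_def using nonneg b_pos[of d] by (subst AE_distr_iff) (auto simp: zero_le_divide_iff elim: eventually_mono)
    have AEF: "AE x in N. (\<integral>y. indicator {0<..<x} y *\<^sub>R \<kappa> y \<partial>lborel) = F x"
      using AE0 by eventually_elim (rule F)
    have L1: "integrable N (\<lambda>x. \<integral>y. indicator {0<..<x} y *\<^sub>R \<kappa> y \<partial>lborel)"
      by (rule L(1)) (auto simp: N.emeasure_eq_measure)
    then have iF: "integrable N F"
      by (rule integrable_cong_AE_imp) (use AEF in \<open>auto simp: N_def\<close>)
    have "integral\<^sup>L N F = (\<integral>x. \<integral>y. indicator {0<..<x} y *\<^sub>R \<kappa> y \<partial>lborel \<partial>N)"
      by (rule integral_cong_AE) (use AEF borel_measurable_integrable[OF L1] in \<open>auto simp: N_def\<close>)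
    also have "\<dots> = (\<integral>y. (1 / real d) *\<^sub>R h d y \<partial>lborel)"
      unfolding eq[symmetric] by (rule L(2)) (auto simp: N.emeasure_eq_measure)
    also have "\<dots> = (1 / real d) *\<^sub>R integral\<^sup>L lborel (h d)" by simp
    finally have "real d *\<^sub>R integral\<^sup>L N F = integral\<^sup>L lborel (h d)" using d by simp
    then show ?thesis using iF unfolding N_def by (simp add: integrable_distr_eq integral_distr)
  qed
  show "\<forall>\<^sub>F d in sequentially. integrable M (\<lambda>x. F (x / b d))"
    using ev by eventually_elim (use cake in blast)
  have "\<forall>\<^sub>F d in sequentially. integral\<^sup>L lborel (h d) = real d *\<^sub>R (\<integral>x. F (x / b d) \<partial>M)"
    using ev by eventually_elim (use cake in auto)
  with lim have "(\<lambda>d. real d *\<^sub>R (\<integral>x. F (x / b d) \<partial>M)) \<longlonglongrightarrow> (\<integral>y. (indicator {0<..} y * y powr (- \<alpha>)) *\<^sub>R \<kappa> y \<partial>lborel)"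
    by (rule Lim_transform_eventually)
  then show "(\<lambda>d. real d *\<^sub>R (\<integral>x. F (x / b d) \<partial>M)) \<longlonglongrightarrow> integral\<^sup>L (levy_measure \<alpha>) F"
    using L(2) by simp
qed

section \<open>Limits of truncated means and of the Levy kernel\<close>

lemma scaled_min_lim:
  assumes "\<alpha> < 1"
  shows "(\<lambda>d. real d * expectation (\<lambda>x. min (x / b d) 1)) \<longlonglongrightarrow> 1 / (1 - \<alpha>)"
proof -
  \<comment> \<open>Between \<alpha> and 1, so that \<open>y powr (- \<beta>)\<close> is integrable
    at 0. The derivative of \<open>min x 1\<close> vanishes beyond 1, so the exponent 0 is enough at
    infinity.\<close>
  define \<beta> where "\<beta> = (\<alpha> + 1) / 2"
  have \<beta>: "\<alpha> < \<beta>" "\<beta> < 1" using assms by (auto simp: \<beta>_def)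
  have eq: "(indicator {0<..1} y * y powr (- \<beta>) + indicator {1<..} y * y powr (- 0)) * norm (indicator {..<1} y :: real)
      = indicator {0<..<1} y * y powr (- \<beta>)" for y :: real
    by (auto simp: indicator_def)
  have F: "(\<integral>y. indicator {0<..<x} y *\<^sub>R (indicator {..<1} y :: real) \<partial>lborel) = min x 1" if "0 \<le> x" for x :: real
    using integral_Ioo_cut[of x 1 "\<lambda>_. 1::real"] that by simp
  have dom: "integrable lborel (\<lambda>y. (indicator {0<..1} y * y powr (- \<beta>) + indicator {1<..} y * y powr (- 0)) * norm (indicator {..<1} y :: real))"
    unfolding eq using \<beta> has_bochner_integral_powr_unit_interval[of "- \<beta>"] by (simp add: has_bochner_integral_iff)
  have "(\<lambda>d. real d *\<^sub>R expectation (\<lambda>x. min (x / b d) 1)) \<longlonglongrightarrow> (\<integral>x. min x 1 \<partial>levy_measure \<alpha>)"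
    by (rule scaled_integral_lim(2)[OF _ _ \<beta>(1) order_refl alpha(1) dom F]) auto
  then show ?thesis using levy_integral_min[OF alpha(1) assms] by (simp add: has_bochner_integral_iff)
qed

text \<open>A finite mean is not assumed but obtained: the excess over the cutoff is integrable for
  some \<open>d\<close>, and the rest, \<open>min (x / b d) 1\<close>, is bounded.\<close>

lemma scaled_excess_lim:
  assumes "1 < \<alpha>"
  shows "integrable M (\<lambda>x. x)"
    and "(\<lambda>d. real d * (expectation (\<lambda>x. x) / b d - expectation (\<lambda>x. min (x / b d) 1))) \<longlonglongrightarrow> 1 / (\<alpha> - 1)"
proof -
  define \<beta> where "\<beta> = (\<alpha> + 1) / 2"
  have \<beta>: "\<beta> < \<alpha>" "1 < \<beta>" using assms by (auto simp: \<beta>_def)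
  have eq: "(indicator {0<..1} y * y powr (- (\<alpha> + 1)) + indicator {1<..} y * y powr (- \<beta>)) * norm (indicator {1<..} y :: real)
      = (indicator {0<..} y * ((\<beta> - 1) * y powr (- (\<beta> - 1) - 1))) *\<^sub>R (indicator {1<..} y / (\<beta> - 1))" for y :: real
    using \<beta> by (auto simp: indicator_def)
  have "integrable (levy_measure (\<beta> - 1)) (\<lambda>y. indicator {1<..} y / (\<beta> - 1))"
    using emeasure_levy_measure_Ioi[of "\<beta> - 1" 1] \<beta> by (intro integrable_divide integrable_real_indicator) auto
  then have dom: "integrable lborel (\<lambda>y. (indicator {0<..1} y * y powr (- (\<alpha> + 1)) + indicator {1<..} y * y powr (- \<beta>)) * norm (indicator {1<..} y :: real))"
    unfolding eq using \<beta> by (subst (asm) levy_measure_integral(2)) auto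
  have F: "(\<integral>y. indicator {0<..<x} y *\<^sub>R indicator {1<..} y \<partial>lborel) = x - min x 1" if "0 \<le> x" for x :: real
  proof -
    have "(\<integral>y. indicator {0<..<x} y *\<^sub>R (indicator {1<..} y :: real) \<partial>lborel) = (\<integral>y. indicator {1<..<max x 1} y \<partial>lborel)"
      by (intro Bochner_Integration.integral_cong) (auto simp: indicator_def)
    then show ?thesis using that by (simp add: max_def min_def)
  qed
  have *: "\<forall>\<^sub>F d in sequentially. integrable M (\<lambda>x. x / b d - min (x / b d) 1)"
    "(\<lambda>d. real d *\<^sub>R expectation (\<lambda>x. x / b d - min (x / b d) 1)) \<longlonglongrightarrow> (\<integral>x. x - min x 1 \<partial>levy_measure \<alpha>)"
    by (rule scaled_integral_lim[OF _ _ _ _ _ dom F]; use \<beta> alpha in auto)+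
  have im: "integrable M (\<lambda>x. min (x / b d) 1)" for d
    by (rule integrable_const_bound[where B=1]) (use nonneg b_pos[of d] in \<open>auto elim!: eventually_mono\<close>)
  from *(1) obtain d where "integrable M (\<lambda>x. x / b d - min (x / b d) 1)" by (auto simp: eventually_sequentially)
  from Bochner_Integration.integrable_add[OF this im[of d]] have "integrable M (\<lambda>x. b d * (x / b d))" by (intro integrable_mult_right) simp
  then show ix: "integrable M (\<lambda>x. x)" using b_pos[of d] by simp
  have "expectation (\<lambda>x. x / b d - min (x / b d) 1) = expectation (\<lambda>x. x) / b d - expectation (\<lambda>x. min (x / b d) 1)" for d
    using ix im by simp
  then show "(\<lambda>d. real d * (expectation (\<lambda>x. x) / b d - expectation (\<lambda>x. min (x / b d) 1))) \<longlonglongrightarrow> 1 / (\<alpha> - 1)"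
    using *(2) levy_integral_excess[OF assms] by (simp add: has_bochner_integral_iff)
qed

text \<open>The truncated entropy uses \<open>p > exp (- b d)\<close>, that is
  \<open>x < b d\<close>, so the complementary event is the closed half line. Its mass is squeezed
  between the tails at \<open>b d\<close> and at \<open>b d * (1 - e)\<close>.\<close>

lemma prob_ge_lim: "(\<lambda>d. real d * prob {b d..}) \<longlonglongrightarrow> 1"
proof (rule order_tendstoI)
  fix a :: real assume "a < 1"
  then have "\<forall>\<^sub>F d in sequentially. a < real d * T (b d * 1)"
    using order_tendstoD(1)[OF tail_lim[of 1]] by simp
  then show "\<forall>\<^sub>F d in sequentially. a < real d * prob {b d..}"
  proof eventually_elim
    case (elim d)
    have "real d * T (b d) \<le> real d * prob {b d..}" by (intro mult_left_mono finite_measure_mono) auto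
    then show ?case using elim by simp
  qed
next
  fix a :: real assume a: "1 < a"
  have "((\<lambda>e. (1 - e) powr (- \<alpha>)) \<longlongrightarrow> (1 - 0) powr (- \<alpha>)) (at_right 0)"
    by (intro tendsto_intros) auto
  then have "\<forall>\<^sub>F e in at_right 0. (1 - e) powr (- \<alpha>) < a"
    using a by (intro order_tendstoD(2)) auto
  moreover have "\<forall>\<^sub>F e in at_right 0. e < (1::real)"
    by (rule eventually_at_right_field[THEN iffD2]) (auto intro: exI[of _ 1])
  ultimately have "\<forall>\<^sub>F e in at_right 0. (1 - e) powr (- \<alpha>) < a \<and> e < 1"
    by eventually_elim simp
  then obtain e where e: "0 < e" "e < 1" "(1 - e) powr (- \<alpha>) < a"
    by (metis (mono_tags, lifting) eventually_at_right_field dense)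
  then have "\<forall>\<^sub>F d in sequentially. real d * T (b d * (1 - e)) < a"
    using order_tendstoD(2)[OF tail_lim[of "1 - e"]] by simp
  then show "\<forall>\<^sub>F d in sequentially. real d * prob {b d..} < a"
  proof eventually_elim
    case (elim d)
    have "b d * (1 - e) < b d * 1" using e b_pos[of d] by (intro mult_strict_left_mono) auto
    then have "real d * prob {b d..} \<le> real d * T (b d * (1 - e))" by (intro mult_left_mono finite_measure_mono) auto
    then show ?case using elim by simp
  qed
qed

lemma integrable_min_scaled: "integrable M (\<lambda>x. min (x / b d) 1)"
  by (rule integrable_const_bound[where B=1]) (use nonneg b_pos[of d] in \<open>auto elim!: eventually_mono\<close>)

text \<open>\<open>min (x / b d) 1\<close> splits into the part below the cutoff and the indicator
  of the part above it. The limit 1 is the summand 1 in \<open>1 - euler_mascheroni\<close>.\<close>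

lemma truncated_lim:
  "(\<lambda>d. real d * (expectation (\<lambda>x. min (x / b d) 1) - expectation (\<lambda>x. (x / b d) * indicator {..<b d} x))) \<longlonglongrightarrow> 1"
proof -
  have "expectation (\<lambda>x. min (x / b d) 1) - expectation (\<lambda>x. (x / b d) * indicator {..<b d} x) = prob {b d..}" for d
  proof -
    have eq: "min (x / b d) 1 = (x / b d) * indicator {..<b d} x + indicator {b d..} x" for x
      using b_pos[of d] by (auto simp: indicator_def min_def field_simps)
    have i: "integrable M (\<lambda>x. (x / b d) * indicator {..<b d} x)"
      by (rule integrable_const_bound[where B=1]) (use nonneg b_pos[of d] in \<open>auto simp: indicator_def elim!: eventually_mono\<close>)
    have iA: "integrable M (indicator {b d..} :: _ \<Rightarrow> real)"
      by (rule integrable_real_indicator) (simp_all add: less_top[symmetric])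
    show ?thesis unfolding eq using i iA by (subst Bochner_Integration.integral_add) auto
  qed
  then show ?thesis using prob_ge_lim by simp
qed

text \<open>The derivative of the kernel oscillates without decay, so for \<alpha> \<le> 1 the
  Potter majorant is not integrable against it at infinity. The kernel is frozen beyond
  \<open>K\<close>; as it is bounded by \<open>B\<close>, this costs at most \<open>2 * B\<close>
  times the mass beyond \<open>K\<close>, which is close to
  \<open>2 * B * K powr (- \<alpha>)\<close> before the limit and at most that in the limit.\<close>

lemma levy_ker_lim:
  "(\<lambda>d. of_nat d * (CLINT x|M. levy_ker (- (\<i> * of_real t)) (x / b d))) \<longlonglongrightarrow> levy_exponent \<alpha> (- (\<i> * of_real t))"
proof -
  define w where "w = - (\<i> * complex_of_real t)"
  have w0: "0 \<le> Re w" by (simp add: w_def)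
  define B where "B = ker_const (cmod w)"
  have kb: "cmod (levy_ker w x) \<le> B" if "0 \<le> x" for x
  proof (cases "x = 0")
    case True then show ?thesis by (simp add: levy_ker_def B_def ker_const_def add_nonneg_nonneg)
  next
    case False
    have "cmod (levy_ker w x) \<le> B * min (x\<^sup>2) 1"
      unfolding B_def using that False by (intro norm_levy_ker_le w0) auto
    also have "\<dots> \<le> B * 1" by (intro mult_left_mono) (auto simp: B_def ker_const_def add_nonneg_nonneg)
    finally show ?thesis by simp
  qed
  have B0: "0 \<le> B" by (simp add: B_def ker_const_def add_nonneg_nonneg)
  have AEk: "AE x in M. 0 \<le> x / b d" for d using nonneg by eventually_elim (use b_pos[of d] in auto)
  have cut: "(\<lambda>d. of_nat d * (CLINT x|M. levy_ker w (min (x / b d) K))) \<longlonglongrightarrow> (CLINT x|levy_measure \<alpha>. levy_ker w (min x K))"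
    and icut: "integrable (levy_measure \<alpha>) (\<lambda>x. levy_ker w (min x K))" if K: "1 \<le> K" for K
  proof -
    define \<kappa> where "\<kappa> y = indicator {..<K} y *\<^sub>R (- w * exp (- (w * of_real y))) + indicator {..<1} y *\<^sub>R w" for y :: real
    have [measurable]: "\<kappa> \<in> borel_measurable borel" unfolding \<kappa>_def[abs_def] by measurable
    \<comment> \<open>Below 2, so that the order \<open>y\<close> of \<kappa> at 0 compensates
      \<open>y powr (- \<beta>)\<close> to an integrable function.\<close>
    define \<beta> where "\<beta> = (\<alpha> + 2) / 2"
    have \<beta>: "\<alpha> < \<beta>" "\<beta> < 2" using alpha by (auto simp: \<beta>_def)
    define C where "C = (cmod w)\<^sup>2 * exp (cmod w)"
    have F: "(\<integral>y. indicator {0<..<x} y *\<^sub>R \<kappa> y \<partial>lborel) = levy_ker w (min x K)" if x: "0 \<le> x" for x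
    proof -
      let ?f = "\<lambda>y. - w * exp (- (w * of_real y))"
      have c: "continuous_on UNIV ?f" by (intro continuous_intros)
      have i1: "integrable lborel (\<lambda>y. indicator {0<..<x} y *\<^sub>R (indicator {..<K} y *\<^sub>R ?f y))"
      proof -
        have "(\<lambda>y. indicator {0<..<x} y *\<^sub>R (indicator {..<K} y *\<^sub>R ?f y)) = (\<lambda>y. indicator {0<..<min x K} y *\<^sub>R ?f y)"
          by (auto simp: indicator_def fun_eq_iff)
        then show ?thesis using integrable_indicator_Ioo_continuous[OF c, of 0 "min x K"] by (simp only:)
      qed
      have i2: "integrable lborel (\<lambda>y. indicator {0<..<x} y *\<^sub>R (indicator {..<1::real} y *\<^sub>R w))"
      proof -
        have "(\<lambda>y. indicator {0<..<x} y *\<^sub>R (indicator {..<1::real} y *\<^sub>R w)) = (\<lambda>y. indicator {0<..<min x 1} y *\<^sub>R w)"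
          by (auto simp: indicator_def fun_eq_iff)
        then show ?thesis using integrable_indicator_Ioo_continuous[OF continuous_on_const[of UNIV w], of 0 "min x 1"] by (simp only:)
      qed
      have "(\<integral>y. indicator {0<..<x} y *\<^sub>R \<kappa> y \<partial>lborel) =
         (\<integral>y. indicator {0<..<min x K} y *\<^sub>R ?f y \<partial>lborel) + (\<integral>y. indicator {0<..<min x 1} y *\<^sub>R w \<partial>lborel)"
        unfolding \<kappa>_def scaleR_add_right using i1 i2 x K integral_Ioo_cut[of x K ?f] integral_Ioo_cut[of x 1 "\<lambda>_. w"]
        by (subst Bochner_Integration.integral_add) auto
      also have "(\<integral>y. indicator {0<..<min x K} y *\<^sub>R ?f y \<partial>lborel) = exp (- (w * of_real (min x K))) - exp (- (w * of_real 0))"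
      proof (rule integral_Ioo_FTC)
        fix y
        have "((\<lambda>z. exp (- (w * z))) has_field_derivative ?f y) (at (of_real y))"
          by (auto intro!: derivative_eq_intros)
        then show "((\<lambda>y. exp (- (w * complex_of_real y))) has_vector_derivative ?f y) (at y)"
          by (rule has_vector_derivative_real_field)
      qed (use x K in \<open>auto intro!: continuous_intros\<close>)
      also have "(\<integral>y. indicator {0<..<min x 1} y *\<^sub>R w \<partial>lborel) = (min x 1) *\<^sub>R w"
        using x by simp
      finally show ?thesis using K by (simp add: levy_ker_def scaleR_conv_of_real min.assoc min_absorb2)
    qed
    have kb1: "norm (\<kappa> y) \<le> C * y" if y: "0 < y" "y < 1" for y
    proof -
      have "\<kappa> y = - w * (exp (- (w * of_real y)) - 1)" using y K by (simp add: \<kappa>_def algebra_simps)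
      then have "norm (\<kappa> y) = cmod w * cmod (exp (- (w * of_real y)) - 1)" by (simp add: norm_mult)
      also have "\<dots> \<le> cmod w * (exp (cmod w * y) * (cmod w * y))"
        using norm_exp_diff_1[of "- (w * of_real y)"] y by (intro mult_left_mono) (auto simp: norm_mult)
      also have "\<dots> \<le> cmod w * (exp (cmod w) * (cmod w * y))"
        using y by (intro mult_left_mono mult_right_mono) (auto intro: mult_left_le)
      finally show ?thesis by (simp add: C_def power2_eq_square mult_ac)
    qed
    have kb2: "norm (\<kappa> y) \<le> cmod w * indicator {..<K} y" if y: "1 \<le> y" for y
      using y w0 mult_left_mono[of "exp (- (Re w * y))" 1 "cmod w"] by (auto simp: \<kappa>_def norm_mult indicator_def)
    have dom: "integrable lborel (\<lambda>y. (indicator {0<..1} y * y powr (- \<beta>) + indicator {1<..} y * y powr (- 0)) * norm (\<kappa> y))"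
    proof (rule Bochner_Integration.integrable_bound)
      have "integrable lborel (\<lambda>y. indicator {0<..<1::real} y * y powr (1 - \<beta>))"
        using has_bochner_integral_powr_unit_interval[of "1 - \<beta>"] \<beta> by (simp add: has_bochner_integral_iff)
      then show "integrable lborel (\<lambda>y. C * (indicator {0<..<1::real} y * y powr (1 - \<beta>)) + cmod w * indicator {1..K} y)"
        by (intro Bochner_Integration.integrable_add integrable_mult_right integrable_real_indicator) (auto simp: less_top[symmetric] emeasure_lborel_Icc_eq)
      have "AE y in lborel. y \<noteq> (1::real)" by (rule AE_lborel_singleton)
      then show "AE y in lborel. norm ((indicator {0<..1} y * y powr (- \<beta>) + indicator {1<..} y * y powr (- 0)) * norm (\<kappa> y))
         \<le> norm (C * (indicator {0<..<1::real} y * y powr (1 - \<beta>)) + cmod w * indicator {1..K} y)"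
      proof eventually_elim
        case (elim y)
        consider "y \<le> 0" | "0 < y" "y < 1" | "1 < y" using elim by linarith
        then show ?case
        proof cases
          case 2
          have "y powr (- \<beta>) * norm (\<kappa> y) \<le> y powr (- \<beta>) * (C * y)"
            by (intro mult_left_mono kb1 2) auto
          also have "\<dots> = C * y powr (1 - \<beta>)" using 2 by (simp add: powr_diff powr_minus field_simps)
          finally show ?thesis using 2 by (auto simp: indicator_def intro: order_trans[OF _ abs_ge_self])
        next
          case 3
          then show ?thesis using kb2[of y] K by (cases "y < K") (auto simp: indicator_def)
        qed (auto simp: indicator_def)
      qed
    qed simp
    have [measurable]: "(\<lambda>x. levy_ker w (min x K)) \<in> borel_measurable borel" by measurable
    note S = scaled_integral_lim[of \<kappa> "\<lambda>x. levy_ker w (min x K)" \<beta> 0, OF _ _ \<beta>(1) _ alpha(1) dom F]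
    show "(\<lambda>d. of_nat d * (CLINT x|M. levy_ker w (min (x / b d) K))) \<longlonglongrightarrow> (CLINT x|levy_measure \<alpha>. levy_ker w (min x K))"
      using S(2) by (simp add: scaleR_conv_of_real)
    show "integrable (levy_measure \<alpha>) (\<lambda>x. levy_ker w (min x K))" using S(3) by simp
  qed
  have ik: "integrable (levy_measure \<alpha>) (levy_ker w)" by (rule integrable_levy_ker[OF alpha w0])
  have diff_b: "cmod (levy_ker w x - levy_ker w (min x K)) \<le> 2 * B * indicator {K<..} x" if "0 \<le> x" "1 \<le> K" for x K
    using that kb[of x] kb[of K] norm_triangle_ineq4[of "levy_ker w x" "levy_ker w K"] by (auto simp: indicator_def min_def)
  have im: "integrable M (\<lambda>x. levy_ker w (min (x / b d) K))" if "1 \<le> K" for K d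
    by (rule integrable_const_bound[where B=B]) (use AEk[of d] kb that in \<open>auto elim!: eventually_mono\<close>)
  have im': "integrable M (\<lambda>x. levy_ker w (x / b d))" for d
    by (rule integrable_const_bound[where B=B]) (use AEk[of d] kb in \<open>auto elim!: eventually_mono\<close>)
  show ?thesis
    unfolding w_def[symmetric]
  proof (rule LIMSEQ_I)
    fix r :: real assume r: "0 < r"
    have "((\<lambda>K. 2 * B * K powr (- \<alpha>)) \<longlongrightarrow> 2 * B * 0) at_top"
      using alpha by (intro tendsto_intros tendsto_neg_powr filterlim_ident) auto
    then have "\<forall>\<^sub>F K in at_top. 2 * B * K powr (- \<alpha>) < r / 4" using r by (intro order_tendstoD(2)) auto
    then have "\<forall>\<^sub>F K in at_top. 2 * B * K powr (- \<alpha>) < r / 4 \<and> 1 \<le> K"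
      using eventually_ge_at_top[of 1] by eventually_elim simp
    then obtain K where K: "2 * B * K powr (- \<alpha>) < r / 4" "1 \<le> K" by (auto simp: eventually_at_top_linorder)
    have 1: "cmod (levy_exponent \<alpha> w - (CLINT x|levy_measure \<alpha>. levy_ker w (min x K))) \<le> 2 * B * K powr (- \<alpha>)"
    proof -
      have "levy_exponent \<alpha> w - (CLINT x|levy_measure \<alpha>. levy_ker w (min x K)) = (CLINT x|levy_measure \<alpha>. levy_ker w x - levy_ker w (min x K))"
        unfolding levy_exponent_def using ik icut[OF K(2)] by simp
      also have "cmod \<dots> \<le> (\<integral>x. cmod (levy_ker w x - levy_ker w (min x K)) \<partial>levy_measure \<alpha>)"
        by (rule integral_norm_bound)
      also have "\<dots> \<le> (\<integral>x. 2 * B * indicator {K<..} x \<partial>levy_measure \<alpha>)"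
      proof (rule integral_mono_AE)
        show "AE x in levy_measure \<alpha>. cmod (levy_ker w x - levy_ker w (min x K)) \<le> 2 * B * indicator {K<..} x"
          using AE_levy_measure_pos by eventually_elim (use diff_b K in auto)
        have "emeasure (levy_measure \<alpha>) {K<..} < \<infinity>" using emeasure_levy_measure_Ioi[of \<alpha> K] alpha K by simp
        then show "integrable (levy_measure \<alpha>) (\<lambda>x. 2 * B * indicator {K<..} x)"
          by (intro integrable_mult_right integrable_real_indicator) auto
      qed (use ik icut[OF K(2)] in auto)
      also have "\<dots> = 2 * B * K powr (- \<alpha>)" using measure_levy_measure_Ioi[of \<alpha> K] alpha K by simp
      finally show ?thesis .
    qed
    have 2: "cmod (of_nat d * (CLINT x|M. levy_ker w (x / b d)) - of_nat d * (CLINT x|M. levy_ker w (min (x / b d) K))) \<le> 2 * B * (real d * T (b d * K))" for d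
    proof -
      have "(CLINT x|M. levy_ker w (x / b d)) - (CLINT x|M. levy_ker w (min (x / b d) K)) = (CLINT x|M. levy_ker w (x / b d) - levy_ker w (min (x / b d) K))"
        using im'[of d] im[OF K(2), of d] by simp
      also have "cmod \<dots> \<le> expectation (\<lambda>x. 2 * B * indicator {b d * K<..} x)"
      proof -
        have "cmod (CLINT x|M. levy_ker w (x / b d) - levy_ker w (min (x / b d) K)) \<le> expectation (\<lambda>x. cmod (levy_ker w (x / b d) - levy_ker w (min (x / b d) K)))"
          by (rule integral_norm_bound)
        also have "\<dots> \<le> expectation (\<lambda>x. 2 * B * indicator {b d * K<..} x)"
        proof (rule integral_mono_AE)
          show "AE x in M. cmod (levy_ker w (x / b d) - levy_ker w (min (x / b d) K)) \<le> 2 * B * indicator {b d * K<..} x"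
            using AEk[of d]
          proof eventually_elim
            case (elim x)
            have "indicator {K<..} (x / b d) = (indicator {b d * K<..} x :: real)"
              using b_pos[of d] by (auto simp: indicator_def field_simps)
            then show ?case using diff_b[OF elim K(2)] by simp
          qed
        qed (use im'[of d] im[OF K(2), of d] in \<open>auto intro!: integrable_mult_right integrable_indicator_borel\<close>)
        finally show ?thesis .
      qed
      also have "\<dots> = 2 * B * T (b d * K)" by simp
      finally have "cmod ((CLINT x|M. levy_ker w (x / b d)) - (CLINT x|M. levy_ker w (min (x / b d) K))) \<le> 2 * B * T (b d * K)" .
      then have "real d * cmod ((CLINT x|M. levy_ker w (x / b d)) - (CLINT x|M. levy_ker w (min (x / b d) K))) \<le> real d * (2 * B * T (b d * K))"
        by (intro mult_left_mono) auto
      then show ?thesis by (simp add: norm_mult mult_ac flip: right_diff_distrib)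
    qed
    have "(\<lambda>d. 2 * B * (real d * T (b d * K))) \<longlonglongrightarrow> 2 * B * K powr (- \<alpha>)"
      using K by (intro tendsto_intros tail_lim) auto
    then have "\<forall>\<^sub>F d in sequentially. 2 * B * (real d * T (b d * K)) < r / 4" using K by (intro order_tendstoD(2)) auto
    moreover have "\<forall>\<^sub>F d in sequentially. cmod (of_nat d * (CLINT x|M. levy_ker w (min (x / b d) K)) - (CLINT x|levy_measure \<alpha>. levy_ker w (min x K))) < r / 4"
      using tendstoD[OF cut[OF K(2)], of "r / 4"] r by (simp add: dist_norm)
    ultimately have "\<forall>\<^sub>F d in sequentially. cmod (of_nat d * (CLINT x|M. levy_ker w (x / b d)) - levy_exponent \<alpha> w) < r"
    proof eventually_elim
      case (elim d)
      have "cmod (a - e) \<le> cmod (a - c) + cmod (c - f) + cmod (e - f)" for a c e f :: complex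
        using norm_triangle_ineq[of "a - c" "c - e"] norm_triangle_ineq4[of "c - f" "e - f"] by simp
      from this[of "of_nat d * (CLINT x|M. levy_ker w (x / b d))" "levy_exponent \<alpha> w" "of_nat d * (CLINT x|M. levy_ker w (min (x / b d) K))" "CLINT x|levy_measure \<alpha>. levy_ker w (min x K)"]
      show ?case using elim 1 2[of d] K(1) r by linarith
    qed
    then show "\<exists>no. \<forall>n\<ge>no. norm (of_nat n * (CLINT x|M. levy_ker w (x / b n)) - levy_exponent \<alpha> w) < r"
      by (simp add: eventually_sequentially)
  qed
qed

text \<open>Here \<open>a\<close> is the centering already divided by \<open>b\<close>. With
  \<open>z = char - 1\<close>, the product \<open>d * z\<close> is the integral of the Levy kernel
  plus the compensated mean, which \<open>a\<close> removes up to \<open>stable_shift\<close>;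
  replacing \<open>char ^ d\<close> by \<open>exp (d * z)\<close> is allowed once \<open>d\<close>
  times the squared modulus of \<open>z\<close> vanishes.\<close>

lemma char_lim:
  assumes a: "(\<lambda>d. a d - (real d * expectation (\<lambda>x. min (x / b d) 1) - stable_shift \<alpha>)) \<longlonglongrightarrow> 0"
  shows "(\<lambda>d. char M (t / b d) ^ d * iexp (- (t * a d))) \<longlonglongrightarrow> stable_cf \<alpha> t"
proof -
  define w where "w = - (\<i> * complex_of_real t)"
  define z where "z d = char M (t / b d) - 1" for d
  define m where "m d = expectation (\<lambda>x. min (x / b d) 1)" for d
  have zm: "of_nat d * z d = of_nat d * (CLINT x|M. levy_ker w (x / b d)) + \<i> * of_real (t * (real d * m d))" for d
  proof -
    have ie: "has_bochner_integral M (\<lambda>x. iexp (t * (x / b d))) (char M (t / b d))"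
    proof -
      have "(\<lambda>x. iexp (t * (x / b d))) = (\<lambda>x. iexp (t / b d * x))" by (simp add: fun_eq_iff)
      then show ?thesis
        unfolding char_def by (simp only:) (rule has_bochner_integral_integrable, rule integrable_iexp, auto)
    qed
    have c1: "has_bochner_integral M (\<lambda>x. 1 :: complex) 1"
      by (simp add: has_bochner_integral_iff prob_UNIV)
    have im: "has_bochner_integral M (\<lambda>x. \<i> * (of_real t * of_real (min (x / b d) 1))) (\<i> * (of_real t * of_real (m d)))"
      unfolding m_def by (intro has_bochner_integral_mult_right has_bochner_integral_of_real has_bochner_integral_integrable integrable_min_scaled)
    have "has_bochner_integral M (\<lambda>x. iexp (t * (x / b d)) - 1 - \<i> * (of_real t * of_real (min (x / b d) 1)))
       (char M (t / b d) - 1 - \<i> * (of_real t * of_real (m d)))"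
      by (intro has_bochner_integral_diff ie c1 im)
    then have "(CLINT x|M. levy_ker w (x / b d)) = char M (t / b d) - 1 - \<i> * (of_real t * of_real (m d))"
      unfolding w_def levy_ker_imaginary of_real_mult by (rule has_bochner_integral_integral_eq)
    then have "z d = (CLINT x|M. levy_ker w (x / b d)) + \<i> * of_real (t * m d)" by (simp add: z_def)
    then show ?thesis by (simp add: algebra_simps)
  qed
  have E: "(\<lambda>d. of_nat d * (CLINT x|M. levy_ker w (x / b d))) \<longlonglongrightarrow> levy_exponent \<alpha> w"
    using levy_ker_lim[of t] by (simp add: w_def)
  have rho: "real d * (1 - Re (char M (t / b d))) = - Re (of_nat d * (CLINT x|M. levy_ker w (x / b d)))" for d
  proof -
    have "Re (of_nat d * z d) = Re (of_nat d * (CLINT x|M. levy_ker w (x / b d)))"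
      unfolding zm by simp
    moreover have "Re (of_nat d * z d) = real d * (Re (char M (t / b d)) - 1)" by (simp add: z_def)
    ultimately have "Re (of_nat d * (CLINT x|M. levy_ker w (x / b d))) = real d * (Re (char M (t / b d)) - 1)" by (simp only:)
    then have "- Re (of_nat d * (CLINT x|M. levy_ker w (x / b d))) = - (real d * (Re (char M (t / b d)) - 1))" by (rule arg_cong)
    also have "\<dots> = real d * (1 - Re (char M (t / b d)))" by (rule minus_mult_right[THEN trans]) simp
    finally show ?thesis ..
  qed
  have rho_lim: "(\<lambda>d. real d * (1 - Re (char M (t / b d)))) \<longlonglongrightarrow> - Re (levy_exponent \<alpha> w)"
    using tendsto_minus[OF tendsto_Re[OF E]] by (simp only: rho)
  define P where "P = \<bar>Re (levy_exponent \<alpha> w)\<bar> + 1"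
  have sq: "(\<lambda>d. real d * (cmod (z d))\<^sup>2) \<longlonglongrightarrow> 0"
  proof (rule order_tendstoI)
    fix c :: real assume "c < 0"
    then show "\<forall>\<^sub>F d in sequentially. c < real d * (cmod (z d))\<^sup>2"
      by (intro always_eventually allI) (rule order_less_le_trans[of c 0], auto)
  next
    fix c :: real assume c: "0 < c"
    have "\<forall>\<^sub>F R in at_top. T R < c / (8 * P)" using T_lim c by (intro order_tendstoD(2)) (auto simp: P_def add_nonneg_pos)
    then have "\<forall>\<^sub>F R in at_top. T R < c / (8 * P) \<and> 0 \<le> R" using eventually_ge_at_top[of 0] by eventually_elim simp
    \<comment> \<open>\<open>R\<close> is chosen before \<open>d\<close>: it makes the tail part of
      the bound smaller than \<open>c / 2\<close>. The remaining part, a multiple of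
      \<open>d / (b d)\<^sup>2\<close>, tends to 0 for fixed \<open>R\<close>.\<close>
    then obtain R where R: "T R < c / (8 * P)" "0 \<le> R" by (auto simp: eventually_at_top_linorder)
    have P0: "0 < P" by (simp add: P_def add_nonneg_pos)
    have "(\<lambda>d. (2 * t\<^sup>2 * R\<^sup>2) * (real d / (b d)\<^sup>2)) \<longlonglongrightarrow> (2 * t\<^sup>2 * R\<^sup>2) * 0"
      by (intro tendsto_intros d_over_b_square)
    then have "\<forall>\<^sub>F d in sequentially. (2 * t\<^sup>2 * R\<^sup>2) * (real d / (b d)\<^sup>2) < c / 2" using c by (intro order_tendstoD(2)) auto
    moreover have "\<forall>\<^sub>F d in sequentially. real d * (1 - Re (char M (t / b d))) < P"
      using rho_lim by (rule order_tendstoD(2)) (auto simp: P_def)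
    ultimately show "\<forall>\<^sub>F d in sequentially. real d * (cmod (z d))\<^sup>2 < c"
    proof eventually_elim
      case (elim d)
      have "real d * (cmod (z d))\<^sup>2 \<le> real d * (2 * (t / b d)\<^sup>2 * R\<^sup>2 + 4 * T R * (1 - Re (char M (t / b d))))"
        using char_diff_1_bound[OF nonneg R(2), of "t / b d"] by (intro mult_left_mono) (auto simp: z_def norm_minus_commute)
      also have "\<dots> = (2 * t\<^sup>2 * R\<^sup>2) * (real d / (b d)\<^sup>2) + 4 * T R * (real d * (1 - Re (char M (t / b d))))"
        by (simp add: algebra_simps power_divide)
      also have "4 * T R * (real d * (1 - Re (char M (t / b d)))) \<le> 4 * T R * P" using elim(2) by (intro mult_left_mono) auto
      also have "4 * T R * P < c / 2" using R(1) P0 by (simp add: field_simps)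
      finally show ?case using elim(1) by linarith
    qed
  qed
  have "(\<lambda>d. char M (t / b d) ^ d - exp (of_nat d * z d)) \<longlonglongrightarrow> 0"
  proof (rule Lim_null_comparison)
    have "(\<lambda>d. exp 2 * (real d * (cmod (z d))\<^sup>2)) \<longlonglongrightarrow> exp 2 * 0" by (intro tendsto_intros sq)
    then show "(\<lambda>d. exp 2 * (real d * (cmod (z d))\<^sup>2)) \<longlonglongrightarrow> 0" by simp
    show "\<forall>\<^sub>F d in sequentially. norm (char M (t / b d) ^ d - exp (of_nat d * z d)) \<le> exp 2 * (real d * (cmod (z d))\<^sup>2)"
      using power_minus_exp_bound[of "z d" d for d] cmod_char_le_1 by (intro always_eventually allI) (simp add: z_def mult_ac)
  qed
  then have "(\<lambda>d. (char M (t / b d) ^ d - exp (of_nat d * z d)) * iexp (- (t * a d))) \<longlonglongrightarrow> 0"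
    by (rule Lim_null_comparison[rotated, OF tendsto_norm_zero]) (simp add: norm_mult)
  moreover have "(\<lambda>d. exp (of_nat d * z d) * iexp (- (t * a d))) \<longlonglongrightarrow> stable_cf \<alpha> t"
  proof -
    have eq: "exp (of_nat d * z d) * iexp (- (t * a d)) = exp (of_nat d * (CLINT x|M. levy_ker w (x / b d)) +
       \<i> * of_real (t * stable_shift \<alpha> - t * (a d - (real d * m d - stable_shift \<alpha>))))" for d
      unfolding exp_add[symmetric] zm by (simp add: algebra_simps)
    have "(\<lambda>d. exp (of_nat d * (CLINT x|M. levy_ker w (x / b d)) +
       \<i> * of_real (t * stable_shift \<alpha> - t * (a d - (real d * m d - stable_shift \<alpha>))))) \<longlonglongrightarrow>
       exp (levy_exponent \<alpha> w + \<i> * of_real (t * stable_shift \<alpha> - t * 0))"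
      by (intro tendsto_intros E a[folded m_def])
    then show ?thesis unfolding eq by (simp add: stable_cf_levy[OF alpha] w_def)
  qed
  ultimately have "(\<lambda>d. (char M (t / b d) ^ d - exp (of_nat d * z d)) * iexp (- (t * a d)) + exp (of_nat d * z d) * iexp (- (t * a d))) \<longlonglongrightarrow> 0 + stable_cf \<alpha> t"
    by (rule tendsto_add)
  then show ?thesis by (simp add: algebra_simps)
qed

end

section \<open>Existence of the stable law\<close>

text \<open>One construction for three purposes: convolution powers, the combination
  \<open>s * X + r * Y + c\<close> of stable copies, and the symmetrization
  \<open>X - Y\<close>.\<close>

lemma real_distribution_affine_pair:
  assumes "real_distribution M" "real_distribution N"
  shows "real_distribution (distr (M \<Otimes>\<^sub>M N) borel (\<lambda>p. s * fst p + r * snd p + c))"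
    and "char (distr (M \<Otimes>\<^sub>M N) borel (\<lambda>p. s * fst p + r * snd p + c)) t = char M (s * t) * char N (r * t) * iexp (t * c)"
proof -
  interpret M: real_distribution M by fact
  interpret N: real_distribution N by fact
  interpret P: pair_prob_space M N ..
  have [measurable]: "(\<lambda>p. s * fst p + r * snd p + c) \<in> borel_measurable (M \<Otimes>\<^sub>M N)" by measurable
  show "real_distribution (distr (M \<Otimes>\<^sub>M N) borel (\<lambda>p. s * fst p + r * snd p + c))"
    by (rule P.real_distribution_distr) simp
  have i: "integrable (M \<Otimes>\<^sub>M N) (\<lambda>p. iexp (t * (s * fst p + r * snd p + c)))"
    by (rule P.integrable_iexp) auto
  then have i': "integrable (M \<Otimes>\<^sub>M N) (\<lambda>(x, y). iexp (t * (s * x + r * y + c)))" by (simp add: split_beta')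
  have "char (distr (M \<Otimes>\<^sub>M N) borel (\<lambda>p. s * fst p + r * snd p + c)) t = (CLINT p|M \<Otimes>\<^sub>M N. iexp (t * (s * fst p + r * snd p + c)))"
    unfolding char_def by (subst integral_distr) auto
  also have "\<dots> = (CLINT x|M. (CLINT y|N. iexp (t * (s * x + r * y + c))))"
    using P.integral_fst[OF i'] by (simp add: split_beta')
  also have "\<dots> = (CLINT x|M. (CLINT y|N. (iexp (s * t * x) * iexp (t * c)) * iexp (r * t * y)))"
    by (simp add: exp_add[symmetric] algebra_simps)
  also have "\<dots> = (CLINT x|M. (iexp (s * t * x) * iexp (t * c)) * char N (r * t))"
    by (simp only: integral_mult_right_zero char_def)
  also have "\<dots> = (CLINT x|M. iexp (s * t * x)) * iexp (t * c) * char N (r * t)"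
    by (simp only: integral_mult_left_zero)
  finally show "char (distr (M \<Otimes>\<^sub>M N) borel (\<lambda>p. s * fst p + r * snd p + c)) t = char M (s * t) * char N (r * t) * iexp (t * c)"
    by (simp only: char_def mult_ac)
qed

lemma char_distr_affine:
  assumes "real_distribution M"
  shows "real_distribution (distr M borel (\<lambda>x. (x - a) / b))"
    and "char (distr M borel (\<lambda>x. (x - a) / b)) t = char M (t / b) * iexp (- (t * (a / b)))"
proof -
  interpret M: real_distribution M by fact
  show "real_distribution (distr M borel (\<lambda>x. (x - a) / b))" by (rule M.real_distribution_distr) simp
  have "char (distr M borel (\<lambda>x. (x - a) / b)) t = (CLINT x|M. iexp (t * ((x - a) / b)))"
    unfolding char_def by (subst integral_distr) auto
  also have "\<dots> = (CLINT x|M. iexp (t / b * x) * iexp (- (t * (a / b))))"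
    by (simp add: exp_add[symmetric] diff_divide_distrib algebra_simps)
  finally show "char (distr M borel (\<lambda>x. (x - a) / b)) t = char M (t / b) * iexp (- (t * (a / b)))"
    by (simp only: integral_mult_left_zero char_def)
qed

lemma ex_real_distribution_power:
  assumes "real_distribution M"
  shows "\<exists>L. real_distribution L \<and> (\<forall>t. char L t = char M t ^ n)"
proof (induction n)
  case 0
  have "real_distribution (return borel (0::real))"
    by (intro real_distribution.intro prob_space_return real_distribution_axioms.intro) auto
  moreover have "char (return borel 0) t = 1" for t
    unfolding char_def by (subst integral_return) auto
  ultimately show ?case by auto
next
  case (Suc n)
  then obtain L where L: "real_distribution L" "\<forall>t. char L t = char M t ^ n" by auto
  show ?case
    using real_distribution_affine_pair[OF assms L(1), of 1 1 0] L(2) by (intro exI) auto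
qed

text \<open>Averaging \<open>1 - cos (t * x)\<close> over (0,u) gives
  \<open>u - sin (u * x) / x\<close>, which is at least \<open>u / 2\<close> once
  \<open>\<bar>x\<bar> \<ge> 2 / u\<close>. The right-hand side is kept restricted to the tail
  event, so that it can be bounded both by the characteristic function and by the tail mass
  itself.\<close>

lemma (in real_distribution) averaged_tail_bound:
  assumes u: "0 < u"
  shows "u / 2 * prob {x. 2 / u \<le> \<bar>x\<bar>} \<le>
    (\<integral>t. indicator {0<..<u} t * expectation (\<lambda>x. (1 - cos (t * x)) * indicator {x. 2 / u \<le> \<bar>x\<bar>} x) \<partial>lborel)"
proof -
  interpret P: pair_sigma_finite lborel M ..
  let ?A = "{x. 2 / u \<le> \<bar>x\<bar>} :: real set"
  have [measurable]: "?A \<in> sets borel" by simp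
  define h where "h = (\<lambda>(t::real, x). indicator {0<..<u} t * ((1 - cos (t * x)) * indicator ?A x) :: real)"
  have hm [measurable]: "h \<in> borel_measurable (lborel \<Otimes>\<^sub>M M)" unfolding h_def by measurable
  have H: "integrable (lborel \<Otimes>\<^sub>M M) h"
  proof (rule integrableI_bounded_set[where A="{0<..<u} \<times> space M" and B=2])
    show "{0<..<u} \<times> space M \<in> sets (lborel \<Otimes>\<^sub>M M)" by auto
    show "emeasure (lborel \<Otimes>\<^sub>M M) ({0<..<u} \<times> space M) < \<infinity>"
      using u emeasure_space_1 by (subst emeasure_pair_measure_Times) auto
    show "AE p in lborel \<Otimes>\<^sub>M M. p \<in> {0<..<u} \<times> space M \<longrightarrow> norm (h p) \<le> 2"
    proof (intro AE_I2 impI)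
      fix p :: "real \<times> real"
      have "\<bar>1 - cos (fst p * snd p)\<bar> \<le> 2" using cos_le_one[of "fst p * snd p"] cos_ge_minus_one[of "fst p * snd p"] by linarith
      then show "norm (h p) \<le> 2" by (auto simp: h_def split_beta' indicator_def)
    qed
  qed (auto simp: h_def indicator_def)
  then have H': "integrable (lborel \<Otimes>\<^sub>M M) (\<lambda>(t, x). h (t, x))" by simp
  have inner: "(\<integral>t. h (t, x) \<partial>lborel) = (u - sin (u * x) / x) * indicator ?A x" for x
  proof (cases "x \<in> ?A")
    case True
    then have x0: "x \<noteq> 0" using u by auto
    have "(\<integral>t. indicator {0<..<u} t *\<^sub>R (1 - cos (t * x)) \<partial>lborel) = (u - sin (u * x) / x) - (0 - sin (0 * x) / x)"
      using u x0 by (intro integral_Ioo_FTC)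
        (auto intro!: derivative_eq_intros continuous_intros simp flip: has_real_derivative_iff_has_vector_derivative)
    then show ?thesis using True by (simp add: h_def)
  qed (simp add: h_def)
  have "u / 2 * prob ?A = expectation (\<lambda>x. u / 2 * indicator ?A x)" by simp
  also have "\<dots> \<le> expectation (\<lambda>x. \<integral>t. h (t, x) \<partial>lborel)"
  proof (rule integral_mono_AE)
    show "integrable M (\<lambda>x. \<integral>t. h (t, x) \<partial>lborel)" using P.integrable_snd[OF H'] by simp
    show "integrable M (\<lambda>x. u / 2 * indicator ?A x)" by (intro integrable_mult_right integrable_indicator_borel) simp
    show "AE x in M. u / 2 * indicator ?A x \<le> (\<integral>t. h (t, x) \<partial>lborel)"
    proof (rule AE_I2)
      fix x
      show "u / 2 * indicator ?A x \<le> (\<integral>t. h (t, x) \<partial>lborel)"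
      proof (cases "x \<in> ?A")
        case True
        have "\<bar>sin (u * x) / x\<bar> \<le> 1 / \<bar>x\<bar>" unfolding abs_divide by (intro divide_right_mono) auto
        also have "\<dots> \<le> 1 / (2 / u)"
        proof -
          have "0 < 2 / u" using u by simp
          moreover have "2 / u \<le> \<bar>x\<bar>" using True by simp
          ultimately show ?thesis by (intro divide_left_mono mult_pos_pos) linarith+
        qed
        finally have "sin (u * x) / x \<le> 1 / (2 / u)" by (rule abs_le_D1)
        then have "sin (u * x) / x \<le> u / 2" by simp
        then show ?thesis using True by (simp add: inner)
      qed (simp add: inner)
    qed
  qed
  also have "\<dots> = (\<integral>t. expectation (\<lambda>x. h (t, x)) \<partial>lborel)"
    using P.integral_snd[OF H'] P.integral_fst[OF H'] by simp
  also have "\<dots> = (\<integral>t. indicator {0<..<u} t * expectation (\<lambda>x. (1 - cos (t * x)) * indicator ?A x) \<partial>lborel)"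
    by (simp add: h_def)
  finally show ?thesis .
qed

lemma (in real_distribution) Re_char: "Re (char M t) = expectation (\<lambda>x. cos (t * x))"
proof -
  have ie: "integrable M (\<lambda>x. iexp (t * x))" by (rule integrable_iexp) auto
  show ?thesis unfolding char_def using integral_Re[OF ie] by (simp add: Re_exp)
qed

lemma (in real_distribution) integrable_cos: "integrable M (\<lambda>x. cos (t * x))"
  by (rule integrable_const_bound[where B=1]) auto

lemma (in real_distribution) tail_bound_char:
  assumes u: "0 < u"
  shows "prob {x. 2 / u \<le> \<bar>x\<bar>} \<le> 2 / u * (\<integral>t. indicator {0<..<u} t * (1 - Re (char M t)) \<partial>lborel)"
proof -
  have [measurable]: "{x. 2 / u \<le> \<bar>x\<bar>} \<in> sets borel" by simp
  have "u / 2 * prob {x. 2 / u \<le> \<bar>x\<bar>} \<le>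
    (\<integral>t. indicator {0<..<u} t * expectation (\<lambda>x. (1 - cos (t * x)) * indicator {x. 2 / u \<le> \<bar>x\<bar>} x) \<partial>lborel)"
    by (rule averaged_tail_bound[OF u])
  also have "\<dots> \<le> (\<integral>t. indicator {0<..<u} t * (1 - Re (char M t)) \<partial>lborel)"
  proof (rule integral_mono_AE')
    have "integrable lborel (\<lambda>t. indicator {0<..<u} t *\<^sub>R (1 - Re (char M t)))"
      by (rule integrable_indicator_Ioo_continuous)
         (auto intro!: continuous_at_imp_continuous_on continuous_diff continuous_Re isCont_char)
    then show "integrable lborel (\<lambda>t. indicator {0<..<u} t * (1 - Re (char M t)))" by simp
    have le: "expectation (\<lambda>x. (1 - cos (t * x)) * indicator {x. 2 / u \<le> \<bar>x\<bar>} x) \<le> 1 - Re (char M t)" for t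
    proof -
      have "expectation (\<lambda>x. (1 - cos (t * x)) * indicator {x. 2 / u \<le> \<bar>x\<bar>} x) \<le> expectation (\<lambda>x. 1 - cos (t * x))"
        by (rule integral_mono_AE') (use integrable_cos[of t] in \<open>auto simp: indicator_def\<close>)
      also have "\<dots> = 1 - Re (char M t)" using integrable_cos[of t] by (simp add: Re_char prob_UNIV)
      finally show ?thesis .
    qed
    then show "AE t in lborel. indicator {0<..<u} t * expectation (\<lambda>x. (1 - cos (t * x)) * indicator {x. 2 / u \<le> \<bar>x\<bar>} x) \<le> indicator {0<..<u} t * (1 - Re (char M t))"
      by (auto simp: indicator_def)
    show "AE t in lborel. 0 \<le> indicator {0<..<u} t * (1 - Re (char M t))"
      using cmod_char_le_1 complex_Re_le_cmod order_trans by (auto simp: indicator_def) blast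
  qed
  finally show ?thesis using u by (simp add: field_simps)
qed

text \<open>The limit \<open>g\<close> is not presupposed to be a characteristic function.
  Continuity at 0 makes the average of \<open>1 - Re (g t)\<close> near 0 small, which yields
  tightness and hence a candidate for the limit law.\<close>

lemma levy_continuity_existence:
  fixes M :: "nat \<Rightarrow> real measure"
  assumes M: "\<And>n. real_distribution (M n)" and lim: "\<And>t. (\<lambda>n. char (M n) t) \<longlonglongrightarrow> g t" and g: "isCont g 0"
  shows "\<exists>M'. real_distribution M' \<and> (\<forall>t. char M' t = g t)"
proof -
  interpret real_distribution "M n" for n by (rule M)
  have g0: "g 0 = 1"
    using lim[of 0] by (simp add: char_zero LIMSEQ_const_iff)
  have [measurable]: "g \<in> borel_measurable borel"
    by (rule borel_measurable_LIMSEQ_metric[where f="\<lambda>n. char (M n)"]) (use lim in auto)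
  have gle: "cmod (g t) \<le> 1" for t
    by (rule LIMSEQ_le_const2[OF tendsto_norm[OF lim]]) (use cmod_char_le_1 in auto)
  have ev: "\<exists>K. \<forall>\<^sub>F n in sequentially. 1 - \<epsilon> < measure (M n) {- K<..K}" if e: "0 < \<epsilon>" for \<epsilon>
  proof -
    obtain \<delta> where \<delta>: "0 < \<delta>" "\<And>t. \<bar>t\<bar> < \<delta> \<Longrightarrow> cmod (g t - 1) < \<epsilon> / 4"
      using g e unfolding continuous_at_eps_delta g0 by (metis dist_norm diff_zero divide_pos_pos real_norm_def zero_less_numeral)
    define u where "u = \<delta>"
    have u: "0 < u" using \<delta> by (simp add: u_def)
    let ?I = "\<lambda>f. \<integral>t. indicator {0<..<u} t * (1 - Re (f t)) \<partial>lborel"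
    have ind: "integrable lborel (\<lambda>t. c * indicator {0<..<u} t)" for c :: real
      using u by (intro integrable_mult_right integrable_real_indicator) auto
    have bnd: "\<bar>1 - Re z\<bar> \<le> 2" if "cmod z \<le> 1" for z using that abs_Re_le_cmod[of z] by linarith
    have I: "(\<lambda>n. ?I (char (M n))) \<longlonglongrightarrow> ?I g"
    proof (rule integral_dominated_convergence[where w="\<lambda>t. 2 * indicator {0<..<u} t"])
      show "AE t in lborel. (\<lambda>n. indicator {0<..<u} t * (1 - Re (char (M n) t))) \<longlonglongrightarrow> indicator {0<..<u} t * (1 - Re (g t))"
        by (intro always_eventually allI tendsto_intros lim)
      show "AE t in lborel. norm (indicator {0<..<u} t * (1 - Re (char (M n) t))) \<le> 2 * indicator {0<..<u} t" for n
        using bnd[OF cmod_char_le_1] by (intro always_eventually allI) (auto simp: indicator_def)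
    qed (use ind in auto)
    have "?I g \<le> (\<integral>t. (\<epsilon> / 4) * indicator {0<..<u} t \<partial>lborel)"
    proof (rule integral_mono_AE')
      have "1 - Re (g t) \<le> \<epsilon> / 4" if "t \<in> {0<..<u}" for t
        using \<delta>(2)[of t] that abs_Re_le_cmod[of "g t - 1"] by (simp add: u_def)
      then show "AE t in lborel. indicator {0<..<u} t * (1 - Re (g t)) \<le> \<epsilon> / 4 * indicator {0<..<u} t"
        by (auto simp: indicator_def)
      show "integrable lborel (\<lambda>t. (\<epsilon> / 4) * indicator {0<..<u} t)" by (rule ind)
    qed (use e in auto)
    also have "\<dots> = \<epsilon> / 4 * u" using u by simp
    also have "\<dots> < \<epsilon> / 2 * u" using u e by simp
    finally have "\<forall>\<^sub>F n in sequentially. ?I (char (M n)) < \<epsilon> / 2 * u" using I by (intro order_tendstoD(2))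
    then have "\<forall>\<^sub>F n in sequentially. 1 - \<epsilon> < measure (M n) {- (2 / u)<..2 / u}"
    proof eventually_elim
      case (elim n)
      have "prob n {x. 2 / u \<le> \<bar>x\<bar>} \<le> 2 / u * ?I (char (M n))" by (rule tail_bound_char[OF u])
      also have "\<dots> < 2 / u * (\<epsilon> / 2 * u)" using elim u by (intro mult_strict_left_mono) auto
      also have "\<dots> = \<epsilon>" using u by simp
      finally have 1: "prob n {x. 2 / u \<le> \<bar>x\<bar>} < \<epsilon>" .
      have "1 - prob n {x. 2 / u \<le> \<bar>x\<bar>} = prob n (UNIV - {x. 2 / u \<le> \<bar>x\<bar>})"
        using prob_compl[of "{x. 2 / u \<le> \<bar>x\<bar>}" n] by simp
      also have "\<dots> \<le> prob n {- (2 / u)<..2 / u}" by (rule finite_measure_mono) auto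
      finally show ?case using 1 by linarith
    qed
    then show ?thesis by blast
  qed
  have single: "\<exists>K. 1 - \<epsilon> < measure (M n) {- K<..K}" if e: "0 < \<epsilon>" for \<epsilon> n
  proof -
    have *: "(\<Union>k::nat. {- real k<..real k}) = UNIV"
      by (auto, metis leI le_less_trans less_imp_le minus_less_iff reals_Archimedean2)
    have "(\<lambda>k. measure (M n) {- real k<..real k}) \<longlonglongrightarrow> measure (M n) (\<Union>k::nat. {- real k<..real k})"
      by (rule finite_Lim_measure_incseq) (auto simp: incseq_def)
    then have "(\<lambda>k. measure (M n) {- real k<..real k}) \<longlonglongrightarrow> 1" unfolding * prob_UNIV .
    then have "\<forall>\<^sub>F k in sequentially. 1 - \<epsilon> < measure (M n) {- real k<..real k}" using e by (intro order_tendstoD(1)) auto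
    then show ?thesis by (auto simp: eventually_sequentially)
  qed
  have "tight M"
    unfolding tight_def
  proof (intro conjI allI impI M)
    fix \<epsilon> :: real assume e: "0 < \<epsilon>"
    obtain K N where K: "\<And>n. N \<le> n \<Longrightarrow> 1 - \<epsilon> < measure (M n) {- K<..K}"
      using ev[OF e] by (auto simp: eventually_sequentially)
    \<comment> \<open>The estimate holds from \<open>N\<close> on; the finitely many earlier
      measures are tight one by one.\<close>
    obtain k where k: "\<And>n. 1 - \<epsilon> < measure (M n) {- k n<..k n}" using single[OF e] by metis
    define R where "R = Max (insert 1 (insert K (k ` {..<N})))"
    have R: "1 \<le> R" "K \<le> R" "\<And>n. n < N \<Longrightarrow> k n \<le> R"
      unfolding R_def by (rule Max_ge; simp)+
    have "1 - \<epsilon> < measure (M n) {- R<..R}" for n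
    proof (cases "n < N")
      case True
      show ?thesis by (rule order_less_le_trans[OF k[of n] finite_measure_mono]) (use R(3)[OF True] in auto)
    next
      case False
      then show ?thesis by (intro order_less_le_trans[OF K[of n] finite_measure_mono]) (use R(2) in auto)
    qed
    then show "\<exists>a b. a < b \<and> (\<forall>n. 1 - \<epsilon> < measure (M n) {a<..b})"
      using R(1) by (intro exI[of _ "- R"] exI[of _ R]) auto
  qed
  \<comment> \<open>One weakly convergent subsequence suffices: its limit has \<open>g\<close> as
    characteristic function.\<close>
  then obtain r \<nu> where r: "strict_mono (r :: nat \<Rightarrow> nat)" "real_distribution \<nu>" "weak_conv_m (M \<circ> id \<circ> r) \<nu>"
    using tight_imp_convergent_subsubsequence[of M id] strict_mono_id by blast
  have "char \<nu> t = g t" for t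
  proof (rule LIMSEQ_unique)
    show "(\<lambda>n. char ((M \<circ> id \<circ> r) n) t) \<longlonglongrightarrow> char \<nu> t"
      by (rule levy_continuity1[OF _ r(2,3)]) (simp add: M)
    show "(\<lambda>n. char ((M \<circ> id \<circ> r) n) t) \<longlonglongrightarrow> g t"
      using LIMSEQ_subseq_LIMSEQ[OF lim r(1)] by (simp add: o_def)
  qed
  then show ?thesis using r(2) by blast
qed

lemma isCont_stable_cf_0:
  assumes \<alpha>: "0 < \<alpha>" "\<alpha> < 2"
  shows "isCont (stable_cf \<alpha>) 0"
  unfolding continuous_at_sequentially
proof (intro allI impI)
  fix x :: "nat \<Rightarrow> real" assume x: "x \<longlonglongrightarrow> 0"
  have "(\<lambda>n. levy_exponent \<alpha> (- (\<i> * of_real (x n)))) \<longlonglongrightarrow> levy_exponent \<alpha> (- (\<i> * of_real 0))"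
    by (intro tendsto_levy_exponent \<alpha> tendsto_intros x) simp
  then show "(stable_cf \<alpha> \<circ> x) \<longlonglongrightarrow> stable_cf \<alpha> 0"
    unfolding o_def stable_cf_levy[OF \<alpha>] by (intro tendsto_intros x)
qed

text \<open>The Levy measure restricted to \<open>{1<..}\<close> is a probability measure, the
  Pareto law. It satisfies the tail condition with a pure power as scale, so its normalized sums
  have characteristic functions converging to \<open>stable_cf\<close>.\<close>

lemma ex_stable_distribution:
  assumes \<alpha>: "0 < \<alpha>" "\<alpha> < 2"
  shows "\<exists>S. real_distribution S \<and> (\<forall>t. char S t = stable_cf \<alpha> t)"
proof -
  define P where "P = uniform_measure (levy_measure \<alpha>) {1<..}"
  have e1: "emeasure (levy_measure \<alpha>) {1<..} = 1" using emeasure_levy_measure_Ioi[OF \<alpha>(1), of 1] by simp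
  have sP: "sets P = sets borel" by (simp add: P_def)
  have "prob_space P" unfolding P_def by (rule prob_space_uniform_measure) (auto simp: e1)
  then interpret P: real_distribution P
    by (intro real_distribution.intro real_distribution_axioms.intro) (auto simp: sP sets_eq_imp_space_eq[OF sP])
  have tail: "measure P {y<..} = y powr (- \<alpha>)" if "1 \<le> y" for y
  proof -
    have "{1<..} \<inter> {y<..} = {y<..}" using that by auto
    then have "emeasure P {y<..} = ennreal (y powr (- \<alpha>)) / 1"
      unfolding P_def using emeasure_levy_measure_Ioi[OF \<alpha>(1), of y] that by (simp add: e1)
    then show ?thesis by (simp add: measure_def divide_ennreal_def)
  qed
  \<comment> \<open>\<open>Suc\<close> keeps \<open>b 0\<close> positive; the resulting factor
    \<open>d / Suc d\<close> in the tail tends to 1.\<close>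
  define b where "b d = real (Suc d) powr (1 / \<alpha>)" for d
  have b_lim: "filterlim b at_top sequentially"
    unfolding b_def using \<alpha> by real_asymp
  interpret attracted P \<alpha> b
  proof
    show "AE x in P. 0 \<le> x" unfolding P_def
      by (subst AE_uniform_measure) (use AE_levy_measure_pos e1 in \<open>auto elim: eventually_mono\<close>)
    show "filterlim b at_top sequentially" by (rule b_lim)
    fix x :: real assume x: "0 < x"
    have "\<forall>\<^sub>F d in sequentially. 1 / x \<le> b d" using b_lim by (simp add: filterlim_at_top)
    then have "\<forall>\<^sub>F d in sequentially. x powr (- \<alpha>) * (real d / real (Suc d)) = real d * measure P {b d * x<..}"
    proof eventually_elim
      case (elim d)
      then have "1 \<le> b d * x" using x by (simp add: field_simps)
      then have "measure P {b d * x<..} = (b d * x) powr (- \<alpha>)" by (rule tail)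
      also have "\<dots> = x powr (- \<alpha>) / real (Suc d)"
        using x \<alpha> by (simp add: b_def powr_mult powr_powr powr_minus field_simps)
      finally show ?case by simp
    qed
    moreover have "(\<lambda>d. x powr (- \<alpha>) * (real d / real (Suc d))) \<longlonglongrightarrow> x powr (- \<alpha>) * 1"
      by (intro tendsto_intros LIMSEQ_n_over_Suc_n)
    ultimately show "(\<lambda>d. real d * measure P {b d * x<..}) \<longlonglongrightarrow> x powr (- \<alpha>)"
      using Lim_transform_eventually by fastforce
  qed (use \<alpha> in \<open>auto simp: b_def\<close>)
  define a where "a d = real d * P.expectation (\<lambda>x. min (x / b d) 1) - stable_shift \<alpha>" for d
  have "\<forall>d. \<exists>L. real_distribution L \<and> (\<forall>t. char L t = char P t ^ d)"
    using ex_real_distribution_power[OF P.real_distribution_axioms] by blast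
  then obtain L where L: "\<And>d. real_distribution (L d)" "\<And>d t. char (L d) t = char P t ^ d" by metis
  define M where "M d = distr (L d) borel (\<lambda>x. (x - a d * b d) / b d)" for d
  have M: "real_distribution (M d)" "char (M d) t = char P (t / b d) ^ d * iexp (- (t * a d))" for d t
    unfolding M_def using char_distr_affine[OF L(1)[of d], of "a d * b d" "b d"] b_pos[of d] by (auto simp: L(2))
  show ?thesis
  proof (rule levy_continuity_existence[of M])
    show "(\<lambda>d. char (M d) t) \<longlonglongrightarrow> stable_cf \<alpha> t" for t
      unfolding M(2) by (rule char_lim) (simp add: a_def)
  qed (use M(1) isCont_stable_cf_0[OF \<alpha>] in auto)
qed

text \<open>The definite description is resolved by the existence just proved together with the
  uniqueness of a law with given characteristic function.\<close>

lemma stable_cdf_eq: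
  assumes "0 < \<alpha>" "\<alpha> < 2"
  obtains S where "real_distribution S" "\<And>t. char S t = stable_cf \<alpha> t" "stable_cdf \<alpha> = cdf S"
proof -
  obtain S where S: "real_distribution S" "\<And>t. char S t = stable_cf \<alpha> t"
    using ex_stable_distribution[OF assms] by auto
  have "stable_cdf \<alpha> = cdf S"
    unfolding stable_cdf_def
  proof (rule the_equality)
    show "\<exists>M. real_distribution M \<and> (\<forall>t. char M t = stable_cf \<alpha> t) \<and> cdf S = cdf M" using S by blast
    fix F assume "\<exists>M. real_distribution M \<and> (\<forall>t. char M t = stable_cf \<alpha> t) \<and> F = cdf M"
    then obtain M where M: "real_distribution M" "\<forall>t. char M t = stable_cf \<alpha> t" "F = cdf M" by blast
    have "char M = char S" using M(2) S(2) by (simp add: fun_eq_iff)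
    then have "M = S" by (rule Levy_uniqueness[OF M(1) S(1)])
    then show "F = cdf S" using M(3) by simp
  qed
  then show ?thesis using that S by blast
qed

section \<open>The stable distribution function and quantiles\<close>

text \<open>Strict stability up to a drift. The exponent is homogeneous of degree \<alpha>; only for
  \<alpha> = 1 does the logarithm produce an additional term linear in \<open>t\<close>, which the
  drift compensates.\<close>

lemma stable_cf_split:
  assumes \<alpha>: "0 < \<alpha>" and sr: "0 < s" "0 < r" "s powr \<alpha> + r powr \<alpha> = 1"
  shows "stable_cf \<alpha> t = stable_cf \<alpha> (s * t) * stable_cf \<alpha> (r * t) * iexp (t * (if \<alpha> = 1 then s * ln s + r * ln r else 0))"
proof (cases "t = 0")
  case True
  then show ?thesis using \<alpha> by (simp add: stable_cf_def)
next
  case False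
  have abs: "\<bar>c * t\<bar> = c * \<bar>t\<bar>" "sgn (c * t) = sgn t" if "0 < c" for c
    using that by (auto simp: abs_mult sgn_mult)
  show ?thesis
  proof (cases "\<alpha> = 1")
    case True
    have sr1: "s + r = 1" using sr True by simp
    have e: "stable_cf 1 x = exp (of_real (- (pi / 2) * \<bar>x\<bar>) - \<i> * of_real (x * ln \<bar>x\<bar>))" for x
    proof -
      have "\<bar>x\<bar> * sgn x = x" by (simp add: sgn_if)
      then have "- (complex_of_real (pi / 2 * \<bar>x\<bar>)) * (1 - \<i> * complex_of_real (sgn x * (- (2 / pi) * ln \<bar>x\<bar>)))
         = of_real (- (pi / 2) * \<bar>x\<bar>) - \<i> * of_real (x * ln \<bar>x\<bar>)"
        by (simp add: complex_eq_iff)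
      then show ?thesis by (simp add: stable_cf_def kappa_def omega_def)
    qed
    have l: "ln \<bar>c * t\<bar> = ln c + ln \<bar>t\<bar>" if "0 < c" for c using that False by (simp add: abs ln_mult)
    have A: "- (pi / 2) * \<bar>t\<bar> = - (pi / 2) * \<bar>s * t\<bar> + - (pi / 2) * \<bar>r * t\<bar>"
    proof -
      have "\<bar>s * t\<bar> + \<bar>r * t\<bar> = (s + r) * \<bar>t\<bar>" by (simp only: abs sr distrib_right)
      then show ?thesis by (simp only: sr1 mult_1 distrib_left[symmetric])
    qed
    have B: "t * ln \<bar>t\<bar> = s * t * ln \<bar>s * t\<bar> + r * t * ln \<bar>r * t\<bar> - t * (s * ln s + r * ln r)"
    proof -
      have "t * ln \<bar>t\<bar> = (s + r) * (t * ln \<bar>t\<bar>)" by (simp add: sr1)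
      then show ?thesis unfolding l[OF sr(1)] l[OF sr(2)] by (simp add: algebra_simps)
    qed
    have "of_real (- (pi / 2) * \<bar>t\<bar>) - \<i> * of_real (t * ln \<bar>t\<bar>) =
      (of_real (- (pi / 2) * \<bar>s * t\<bar>) - \<i> * of_real (s * t * ln \<bar>s * t\<bar>)) +
      (of_real (- (pi / 2) * \<bar>r * t\<bar>) - \<i> * of_real (r * t * ln \<bar>r * t\<bar>)) + \<i> * of_real (t * (s * ln s + r * ln r))"
      unfolding A B of_real_add of_real_diff by (simp only: algebra_simps)
    then show ?thesis unfolding True e by (simp add: exp_add[symmetric] del: of_real_mult)
  next
    case False
    define E where "E = - (complex_of_real (kappa \<alpha> * \<bar>t\<bar> powr \<alpha>)) * (1 - \<i> * complex_of_real (sgn t * tan (pi * \<alpha> / 2)))"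
    have e: "stable_cf \<alpha> (c * t) = exp (of_real (c powr \<alpha>) * E)" if "0 < c" for c
      using that False by (simp add: stable_cf_def abs omega_def powr_mult E_def mult_ac)
    have "stable_cf \<alpha> (s * t) * stable_cf \<alpha> (r * t) = exp (of_real (s powr \<alpha> + r powr \<alpha>) * E)"
      unfolding e[OF sr(1)] e[OF sr(2)] exp_add[symmetric] by (simp add: algebra_simps)
    then show ?thesis using False e[of 1] by (simp add: sr)
  qed
qed

text \<open>A gap \<open>(x, y)\<close> in the support is impossible: for iid copies, \<open>s X\<^sub>1 + r X\<^sub>2 + c\<close> has the law of \<open>X\<close> whenever
  \<open>s\<^sup>\<alpha> + r\<^sup>\<alpha> = 1\<close>, so the support contains the continuous path \<open>s x + r y + c\<close> from \<open>y\<close> to \<open>x\<close>.\<close>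

lemma stable_cdf_strict:
  assumes \<alpha>: "0 < \<alpha>" "\<alpha> < 2" and S: "real_distribution S" "\<And>t. char S t = stable_cf \<alpha> t"
    and pq: "p < q" "0 < cdf S p" "cdf S q < 1"
  shows "cdf S p < cdf S q"
proof (rule ccontr)
  interpret S: real_distribution S by fact
  let ?F = "cdf S"
  assume "\<not> ?F p < ?F q"
  then have eq: "?F p = ?F q" using S.cdf_nondecreasing[of p q] pq by simp
  \<comment> \<open>\<open>Inf A\<close> and the supremum of the set \<open>B\<close> below are the
    ends of the flat stretch of the distribution function around \<open>(p, q)\<close>. Both are
    points of the support, as every neighbourhood has positive mass.\<close>
  define A where "A = {z. ?F p \<le> ?F z}"
  define B where "B = {z. ?F z \<le> ?F p}"
  have "\<forall>\<^sub>F z in at_bot. ?F z < ?F p" using S.cdf_lim_at_bot pq(2) by (rule order_tendstoD(2))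
  then obtain z0 where z0: "?F z0 < ?F p" by (auto simp: eventually_at_bot_linorder)
  have bA: "bdd_below A"
  proof (rule bdd_belowI)
    fix z assume "z \<in> A"
    then have "\<not> z \<le> z0" using S.cdf_nondecreasing[of z z0] z0 by (auto simp: A_def)
    then show "z0 \<le> z" by simp
  qed
  have "\<forall>\<^sub>F z in at_top. ?F p < ?F z" using S.cdf_lim_at_top_prob pq(3) eq by (intro order_tendstoD(1)) auto
  then obtain z1 where z1: "?F p < ?F z1" by (auto simp: eventually_at_top_linorder)
  have bB: "bdd_above B"
  proof (rule bdd_aboveI)
    fix z assume "z \<in> B"
    then have "\<not> z1 \<le> z" using S.cdf_nondecreasing[of z1 z] z1 by (auto simp: B_def)
    then show "z \<le> z1" by simp
  qed
  define x where "x = Inf A"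
  define y where "y = Sup B"
  have pA: "p \<in> A" by (simp add: A_def)
  have qB: "q \<in> B" using eq by (simp add: B_def)
  have x: "x \<le> p" unfolding x_def by (rule cInf_lower[OF pA bA])
  have y: "q \<le> y" unfolding y_def by (rule cSup_upper[OF qB bB])
  have prob: "S.prob {u - \<delta><..u + \<delta>} = ?F (u + \<delta>) - ?F (u - \<delta>)" if "0 < \<delta>" for u \<delta>
    using S.cdf_diff_eq[of "u - \<delta>" "u + \<delta>"] that by simp
  have px: "0 < S.prob {x - \<delta><..x + \<delta>}" if d: "0 < \<delta>" for \<delta>
  proof -
    have "x - \<delta> \<notin> A" using cInf_lower[OF _ bA, of "x - \<delta>"] d by (auto simp: x_def)
    moreover obtain z where "z \<in> A" "z < x + \<delta>" using cInf_lessD[of A "x + \<delta>"] pA d by (auto simp: x_def)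
    ultimately show ?thesis using S.cdf_nondecreasing[of z "x + \<delta>"] prob[OF d, of x] by (auto simp: A_def)
  qed
  have py: "0 < S.prob {y - \<delta><..y + \<delta>}" if d: "0 < \<delta>" for \<delta>
  proof -
    have "y + \<delta> \<notin> B" using cSup_upper[OF _ bB, of "y + \<delta>"] d by (auto simp: y_def)
    moreover obtain z where "z \<in> B" "y - \<delta> < z" using less_cSupD[of B "y - \<delta>"] qB d by (auto simp: y_def)
    ultimately show ?thesis using S.cdf_nondecreasing[of "y - \<delta>" z] prob[OF d, of y] by (auto simp: B_def)
  qed
  define r where "r s = (1 - s powr \<alpha>) powr (1 / \<alpha>)" for s
  define c where "c s = (if \<alpha> = 1 then s * ln s + r s * ln (r s) else 0)" for s
  \<comment> \<open>A path that tends to \<open>y\<close> as \<open>s\<close> tends to 0 and to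
    \<open>x\<close> as \<open>s\<close> tends to 1, so it passes through the midpoint
    \<open>m\<close> of the supposed gap.\<close>
  define g where "g s = s * x + r s * y + c s" for s
  define m where "m = (p + q) / 2"
  have r01: "0 < r s" "r s < 1" if "0 < s" "s < 1" for s
  proof -
    have "s powr \<alpha> < 1" using that \<alpha> powr_less_mono2[of \<alpha> s 1] by simp
    moreover have "0 < s powr \<alpha>" using that by simp
    ultimately have 1: "0 < 1 - s powr \<alpha>" "1 - s powr \<alpha> < 1" by auto
    show "0 < r s" using 1 by (simp add: r_def)
    show "r s < 1" using 1 \<alpha> powr_less_mono2[of "1/\<alpha>" "1 - s powr \<alpha>" 1] by (simp add: r_def)
  qed
  have rs: "s powr \<alpha> + r s powr \<alpha> = 1" if "0 < s" "s < 1" for s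
  proof -
    have "s powr \<alpha> < 1" using that \<alpha> powr_less_mono2[of \<alpha> s 1] by simp
    then show ?thesis using \<alpha> by (simp add: r_def powr_powr)
  qed
  have cont: "continuous_on {s0..s1} g" if "0 < s0" "s1 < 1" for s0 s1
  proof -
    have "continuous_on {s0..s1} r"
      unfolding r_def
    proof (intro continuous_on_powr continuous_intros ballI)
      fix s assume "s \<in> {s0..s1}"
      then have "0 < r s" using r01[of s] that by simp
      then show "1 - s powr \<alpha> \<noteq> 0" by (auto simp: r_def)
    qed (use that in auto)
    moreover have "r s \<noteq> 0" if "s \<in> {s0..s1}" for s using r01(1)[of s] that \<open>0 < s0\<close> \<open>s1 < 1\<close> by auto
    ultimately show ?thesis
      unfolding g_def c_def using that by (cases "\<alpha> = 1") (auto intro!: continuous_intros)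
  qed
  have lim0: "(g \<longlongrightarrow> y) (at_right 0)"
  proof (cases "\<alpha> = 1")
    case True
    have "((\<lambda>s. s * x + (1 - s powr 1) powr (1 / 1) * y + (s * ln s + (1 - s powr 1) powr (1 / 1) * ln ((1 - s powr 1) powr (1 / 1)))) \<longlongrightarrow> y) (at_right 0)"
      by real_asymp
    then show ?thesis unfolding g_def[abs_def] c_def r_def True by simp
  next
    case False
    have "((\<lambda>s. s * x + (1 - s powr \<alpha>) powr (1 / \<alpha>) * y) \<longlongrightarrow> 0 * x + (1 - 0 powr \<alpha>) powr (1 / \<alpha>) * y) (at_right 0)"
      using \<alpha> by (intro tendsto_intros tendsto_powr2) (auto simp: eventually_at_filter)
    then show ?thesis unfolding g_def[abs_def] c_def r_def using False by simp
  qed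
  have lim1: "(g \<longlongrightarrow> x) (at_left 1)"
  proof (cases "\<alpha> = 1")
    case True
    have "((\<lambda>s. s * x + (1 - s powr 1) powr (1 / 1) * y + (s * ln s + (1 - s powr 1) powr (1 / 1) * ln ((1 - s powr 1) powr (1 / 1)))) \<longlongrightarrow> x) (at_left 1)"
      by real_asymp
    then show ?thesis unfolding g_def[abs_def] c_def r_def True by simp
  next
    case False
    have ev: "\<forall>\<^sub>F s in at_left (1::real). 0 \<le> 1 - s powr \<alpha>"
    proof -
      have "\<forall>\<^sub>F s in at_left (1::real). 0 < s \<and> s < 1"
        by (rule eventually_at_leftI[of 0]) auto
      then show ?thesis
        by eventually_elim (use \<alpha> in \<open>simp add: powr_le1\<close>)
    qed
    have "((\<lambda>s. s * x + (1 - s powr \<alpha>) powr (1 / \<alpha>) * y) \<longlongrightarrow> 1 * x + (1 - 1 powr \<alpha>) powr (1 / \<alpha>) * y) (at_left 1)"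
      using \<alpha> ev by (intro tendsto_intros tendsto_powr2) auto
    then show ?thesis unfolding g_def[abs_def] c_def r_def using False \<alpha> by simp
  qed
  have "\<forall>\<^sub>F s in at_right 0. m < g s" using lim0 y pq by (intro order_tendstoD(1)) (auto simp: m_def)
  then obtain e0 where e0: "0 < e0" "\<And>s. 0 < s \<Longrightarrow> s < e0 \<Longrightarrow> m < g s" by (auto simp: eventually_at_right_field)
  have "\<forall>\<^sub>F s in at_left 1. g s < m" using lim1 x pq by (intro order_tendstoD(2)) (auto simp: m_def)
  then obtain e1 where e1: "e1 < 1" "\<And>s. e1 < s \<Longrightarrow> s < 1 \<Longrightarrow> g s < m" by (auto simp: eventually_at_left_field)
  define s0 where "s0 = min (e0 / 2) (1 / 3)"
  define s1 where "s1 = max ((e1 + 1) / 2) (2 / 3)"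
  have s0: "0 < s0" "m < g s0" using e0(1) e0(2)[of s0] by (auto simp: s0_def min_def)
  have s1: "s1 < 1" "g s1 < m" using e1(1) e1(2)[of s1] by (auto simp: s1_def max_def)
  have "s0 \<le> s1" by (simp add: s0_def s1_def min_def max_def)
  then obtain s where s: "s0 \<le> s" "s \<le> s1" "g s = m"
    using IVT2'[of g s1 m s0] s0 s1 cont[OF s0(1) s1(1)] by auto
  have s01: "0 < s" "s < 1" using s s0 s1 by auto
  let ?L = "distr (S \<Otimes>\<^sub>M S) borel (\<lambda>u. s * fst u + r s * snd u + c s)"
  have "char ?L t = char S t" for t
    unfolding real_distribution_affine_pair(2)[OF S(1) S(1)] S(2)
    using stable_cf_split[OF \<alpha>(1) s01(1) r01(1)[OF s01] rs[OF s01], of t] by (simp add: c_def)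
  then have L: "?L = S"
    by (intro Levy_uniqueness real_distribution_affine_pair(1) S(1)) auto
  \<comment> \<open>As \<open>s\<close> and \<open>r s\<close> are below 1, moving each coordinate
    by at most \<delta> moves the combination by at most \<open>2 * \<delta>\<close>, while
    \<open>m\<close> is at distance \<open>4 * \<delta>\<close> from both \<open>p\<close> and
    \<open>q\<close>.\<close>
  define \<delta> where "\<delta> = (q - p) / 8"
  have \<delta>: "0 < \<delta>" using pq by (simp add: \<delta>_def)
  interpret P: pair_prob_space S S ..
  have "0 < S.prob {x - \<delta><..x + \<delta>} * S.prob {y - \<delta><..y + \<delta>}" using px[OF \<delta>] py[OF \<delta>] by simp
  also have "\<dots> = measure (S \<Otimes>\<^sub>M S) ({x - \<delta><..x + \<delta>} \<times> {y - \<delta><..y + \<delta>})"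
    by (simp add: measure_def S.emeasure_pair_measure_Times enn2real_mult)
  also have "\<dots> \<le> measure (S \<Otimes>\<^sub>M S) ((\<lambda>u. s * fst u + r s * snd u + c s) -` {p<..q} \<inter> space (S \<Otimes>\<^sub>M S))"
  proof (rule P.finite_measure_mono)
    show "{x - \<delta><..x + \<delta>} \<times> {y - \<delta><..y + \<delta>} \<subseteq> (\<lambda>u. s * fst u + r s * snd u + c s) -` {p<..q} \<inter> space (S \<Otimes>\<^sub>M S)"
    proof (clarsimp simp: space_pair_measure)
      fix u v assume u: "x - \<delta> < u" "u \<le> x + \<delta>" and v: "y - \<delta> < v" "v \<le> y + \<delta>"
      have "\<bar>s * u + r s * v + c s - m\<bar> = \<bar>s * (u - x) + r s * (v - y)\<bar>"
        unfolding s(3)[symmetric] g_def by (simp add: algebra_simps)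
      also have "\<dots> \<le> \<bar>s\<bar> * \<bar>u - x\<bar> + \<bar>r s\<bar> * \<bar>v - y\<bar>" by (metis abs_mult abs_triangle_ineq)
      also have "\<dots> \<le> 1 * \<delta> + 1 * \<delta>" using u v s01 r01[OF s01] by (intro add_mono mult_mono) auto
      finally have ab: "\<bar>s * u + r s * v + c s - m\<bar> \<le> 2 * \<delta>" by simp
      have "q = p + 8 * \<delta>" "m = p + 4 * \<delta>" by (simp_all add: \<delta>_def m_def field_simps)
      with abs_le_D1[OF ab] abs_le_D2[OF ab] \<delta> show "p < s * u + r s * v + c s \<and> s * u + r s * v + c s \<le> q"
        by (intro conjI; linarith)
    qed
  qed measurable
  also have "\<dots> = measure ?L {p<..q}" by (subst measure_distr) auto
  also have "\<dots> = ?F q - ?F p" unfolding L using S.cdf_diff_eq[OF pq(1)] by simp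
  finally show False using eq by simp
qed

section \<open>Quantile asymptotics and weak convergence\<close>

lemma gen_inverse_cdf_le_iff:
  assumes "real_distribution S" "0 < u" "u < 1"
  shows "gen_inverse (cdf S) u \<le> x \<longleftrightarrow> u \<le> cdf S x"
proof -
  interpret real_distribution S by fact
  interpret right_continuous_mono "cdf S" 0 1
    by standard (auto intro: cdf_nondecreasing cdf_is_right_cont cdf_lim_at_top_prob cdf_lim_at_bot monoI)
  show ?thesis using pseudoinverse[OF assms(2,3), of x] by (simp add: gen_inverse_def)
qed

lemma (in real_distribution) ex_isCont_cdf:
  assumes "(x::real) < y"
  shows "\<exists>z. x < z \<and> z < y \<and> isCont (cdf M) z"
proof -
  have "countable {a. \<not> isCont (cdf M) a}"
    by (rule mono_ctble_discont) (auto intro: monoI cdf_nondecreasing)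
  moreover have "uncountable {x<..<y}" using assms by (simp add: uncountable_open_interval)
  ultimately have "\<not> {x<..<y} \<subseteq> {a. \<not> isCont (cdf M) a}" using countable_subset by blast
  then show ?thesis by auto
qed

text \<open>\<open>n d u\<close> stands for the number of eigenvalues carrying mass
  \<open>u\<close>, and only two inequalities about it enter. \<open>upper\<close> counts the
  eigenvalues down to level \<open>exp (- q)\<close>; \<open>lower\<close> says that
  \<open>n\<close> eigenvalues carry at most the mass above that level plus
  \<open>n * exp (- q)\<close>. The slack in \<open>ln n\<close> is bounded or a small multiple of
  \<open>b d\<close>, hence invisible at scale \<open>b\<close>.\<close>

lemma quantile_asymptotics_iff_weak_conv:
  fixes L :: "nat \<Rightarrow> real measure" and n :: "nat \<Rightarrow> real \<Rightarrow> real"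
  assumes L: "\<And>d. real_distribution (L d)" and S: "real_distribution S"
    and b: "\<And>d. 0 < b d" "filterlim b at_top sequentially"
    and strict: "\<And>p q. p < q \<Longrightarrow> 0 < cdf S p \<Longrightarrow> cdf S q < 1 \<Longrightarrow> cdf S p < cdf S q"
    and n_pos: "\<And>d u. 0 < u \<Longrightarrow> u < 1 \<Longrightarrow> 0 < n d u"
    and upper: "\<And>d u q. 0 < u \<Longrightarrow> u < 1 \<Longrightarrow> u \<le> cdf (L d) q \<Longrightarrow> n d u \<le> exp q"
    and lower: "\<And>d u q. 0 < u \<Longrightarrow> u < 1 \<Longrightarrow> u \<le> cdf (L d) q + n d u * exp (- q)"
  shows "(\<forall>u. 0 < u \<and> u < 1 \<longrightarrow> (\<lambda>d. (ln (n d u) - a d - gen_inverse (cdf S) u * b d) / b d) \<longlonglongrightarrow> 0)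
    \<longleftrightarrow> weak_conv_m (\<lambda>d. distr (L d) borel (\<lambda>x. (x - a d) / b d)) S"
proof -
  interpret S: real_distribution S by fact
  have H: "cdf (distr (L d) borel (\<lambda>x. (x - a d) / b d)) x = cdf (L d) (a d + x * b d)" for d x
  proof -
    interpret Ld: real_distribution "L d" by (rule L)
    have "(\<lambda>x. (x - a d) / b d) -` {..x} \<inter> space (L d) = {..a d + x * b d}"
      using b(1)[of d] by (auto simp: field_simps)
    then show ?thesis unfolding cdf_def by (subst measure_distr) auto
  qed
  have cdf01: "0 \<le> cdf (L d) x" "cdf (L d) x \<le> 1" for d x
  proof -
    interpret Ld: real_distribution "L d" by (rule L)
    show "0 \<le> cdf (L d) x" "cdf (L d) x \<le> 1" by (auto simp: cdf_def)
  qed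
  show ?thesis
  proof
    assume as: "\<forall>u. 0 < u \<and> u < 1 \<longrightarrow> (\<lambda>d. (ln (n d u) - a d - gen_inverse (cdf S) u * b d) / b d) \<longlonglongrightarrow> 0"
    have up: "\<forall>\<^sub>F d in sequentially. ln (n d u) < a d + (gen_inverse (cdf S) u + \<delta>) * b d"
      and lo: "\<forall>\<^sub>F d in sequentially. a d + (gen_inverse (cdf S) u - \<delta>) * b d < ln (n d u)"
      if "0 < u" "u < 1" "0 < \<delta>" for u \<delta>
    proof -
      have l: "(\<lambda>d. (ln (n d u) - a d - gen_inverse (cdf S) u * b d) / b d) \<longlonglongrightarrow> 0" using as that by blast
      have "\<forall>\<^sub>F d in sequentially. (ln (n d u) - a d - gen_inverse (cdf S) u * b d) / b d < \<delta>"
        using order_tendstoD(2)[OF l that(3)] .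
      then show "\<forall>\<^sub>F d in sequentially. ln (n d u) < a d + (gen_inverse (cdf S) u + \<delta>) * b d"
        by eventually_elim (use b(1) in \<open>simp add: divide_less_eq algebra_simps\<close>)
      have "\<forall>\<^sub>F d in sequentially. - \<delta> < (ln (n d u) - a d - gen_inverse (cdf S) u * b d) / b d"
        using order_tendstoD(1)[OF l, of "- \<delta>"] that(3) by simp
      then show "\<forall>\<^sub>F d in sequentially. a d + (gen_inverse (cdf S) u - \<delta>) * b d < ln (n d u)"
        by eventually_elim (use b(1) in \<open>simp add: less_divide_eq algebra_simps\<close>)
    qed
    show "weak_conv_m (\<lambda>d. distr (L d) borel (\<lambda>x. (x - a d) / b d)) S"
      unfolding weak_conv_m_def weak_conv_def H
    proof (intro allI impI)
      fix x assume cx: "isCont (cdf S) x"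
      show "(\<lambda>d. cdf (L d) (a d + x * b d)) \<longlonglongrightarrow> cdf S x"
      proof (rule order_tendstoI)
        fix c assume c: "c < cdf S x"
        show "\<forall>\<^sub>F d in sequentially. c < cdf (L d) (a d + x * b d)"
        proof (cases "c < 0")
          case True
          then show ?thesis by (intro always_eventually allI) (rule order_less_le_trans[OF _ cdf01(1)])
        next
          case False
          obtain u where u: "c < u" "u < cdf S x" using c dense by blast
          have u01: "0 < u" "u < 1" using u False S.cdf_bounded_prob[of x] by auto
          have "\<forall>\<^sub>F z in at_left x. u < cdf S z"
            using cx u(2) by (intro order_tendstoD(1)[of _ "cdf S x"])
               (auto simp: continuous_at isCont_def intro: tendsto_within_subset)
          \<comment> \<open>Continuity at \<open>x\<close> supplies a point left of \<open>x\<close>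
            that is still above level \<open>u\<close>, so the quantile \<open>y\<close> lies
            strictly below \<open>x\<close>.\<close>
          then obtain z where z: "z < x" "u < cdf S z" by (auto simp: eventually_at_left_field) (metis dense)
          define y where "y = gen_inverse (cdf S) u"
          have yx: "y < x" using gen_inverse_cdf_le_iff[OF S u01, of z] z by (simp add: y_def)
          \<comment> \<open>Half of the gap bounds \<open>ln n\<close> by
            \<open>a d + (y + \<delta>) * b d\<close>; the other half makes the error
            \<open>n * exp (- q)\<close> at most \<open>exp (- (\<delta> * b d))\<close>.\<close>
          define \<delta> where "\<delta> = (x - y) / 2"
          have \<delta>: "0 < \<delta>" using yx by (simp add: \<delta>_def)
          have "((\<lambda>v. exp (- (\<delta> * v))) \<longlongrightarrow> 0) at_top" using \<delta> by real_asymp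
          from filterlim_compose[OF this b(2)] have "(\<lambda>d. exp (- (\<delta> * b d))) \<longlonglongrightarrow> 0" .
          then have "\<forall>\<^sub>F d in sequentially. exp (- (\<delta> * b d)) < u - c" using u by (intro order_tendstoD(2)) auto
          with up[OF u01 \<delta>] show ?thesis
          proof eventually_elim
            case (elim d)
            let ?q = "a d + x * b d"
            have "n d u = exp (ln (n d u))" using n_pos[OF u01] by simp
            also have "\<dots> \<le> exp (a d + (y + \<delta>) * b d)" using elim(1) by (simp add: y_def)
            finally have "n d u * exp (- ?q) \<le> exp (a d + (y + \<delta>) * b d) * exp (- ?q)" by (intro mult_right_mono) auto
            also have "\<dots> = exp (- (\<delta> * b d))"
              unfolding exp_add[symmetric] by (simp add: \<delta>_def field_simps)
            finally show ?case using lower[OF u01, of d ?q] elim(2) by linarith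
          qed
        qed
      next
        fix c assume c: "cdf S x < c"
        show "\<forall>\<^sub>F d in sequentially. cdf (L d) (a d + x * b d) < c"
        proof (cases "1 < c")
          case True
          then show ?thesis by (intro always_eventually allI) (rule order_le_less_trans[OF cdf01(2)])
        next
          case False
          obtain u where u: "cdf S x < u" "u < c" using c dense by blast
          have u01: "0 < u" "u < 1" using u False S.cdf_nonneg[of x] by auto
          define y where "y = gen_inverse (cdf S) u"
          have yx: "x < y" using gen_inverse_cdf_le_iff[OF S u01, of x] u by (simp add: y_def)
          have "0 < y - x" using yx by simp
          from lo[OF u01 this] show ?thesis
          proof eventually_elim
            case (elim d)
            then have l: "a d + x * b d < ln (n d u)" by (simp add: y_def)
            show ?case
            proof (rule ccontr)
              assume "\<not> ?thesis"
              then have "u \<le> cdf (L d) (a d + x * b d)" using u by simp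
              then have "n d u \<le> exp (a d + x * b d)" by (rule upper[OF u01])
              then have "ln (n d u) \<le> a d + x * b d" using n_pos[OF u01, of d] by (metis exp_gt_zero ln_exp ln_le_cancel_iff)
              with l show False by simp
            qed
          qed
        qed
      qed
    qed
  next
    assume wc: "weak_conv_m (\<lambda>d. distr (L d) borel (\<lambda>x. (x - a d) / b d)) S"
    then have wc: "(\<lambda>d. cdf (L d) (a d + x * b d)) \<longlonglongrightarrow> cdf S x" if "isCont (cdf S) x" for x
      using that unfolding weak_conv_m_def weak_conv_def H by blast
    show "\<forall>u. 0 < u \<and> u < 1 \<longrightarrow> (\<lambda>d. (ln (n d u) - a d - gen_inverse (cdf S) u * b d) / b d) \<longlonglongrightarrow> 0"
    proof (intro allI impI, elim conjE)
      fix u :: real assume u01: "0 < u" "u < 1"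
      define y where "y = gen_inverse (cdf S) u"
      show "(\<lambda>d. (ln (n d u) - a d - gen_inverse (cdf S) u * b d) / b d) \<longlonglongrightarrow> 0"
      proof (rule order_tendstoI)
        fix \<delta> :: real assume \<delta>: "0 < \<delta>"
        obtain x where x: "y < x" "x < y + \<delta>" "isCont (cdf S) x" using S.ex_isCont_cdf[of y "y + \<delta>"] \<delta> by auto
        have uy: "u \<le> cdf S y" using gen_inverse_cdf_le_iff[OF S u01, of y] by (simp add: y_def)
        have "u < cdf S x"
        proof (cases "cdf S x < 1")
          case True
          then show ?thesis using strict[OF x(1)] uy u01 by linarith
        qed (use u01 in simp)
        then have "\<forall>\<^sub>F d in sequentially. u < cdf (L d) (a d + x * b d)" using wc[OF x(3)] by (rule order_tendstoD(1)[rotated])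
        then show "\<forall>\<^sub>F d in sequentially. (ln (n d u) - a d - gen_inverse (cdf S) u * b d) / b d < \<delta>"
        proof eventually_elim
          case (elim d)
          then have "n d u \<le> exp (a d + x * b d)" by (intro upper[OF u01]) simp
          then have "ln (n d u) \<le> a d + x * b d" using n_pos[OF u01, of d] by (metis exp_gt_zero ln_exp ln_le_cancel_iff)
          moreover have "x * b d < (y + \<delta>) * b d" using x b(1)[of d] by simp
          ultimately show ?case using b(1)[of d] by (simp add: divide_less_eq y_def algebra_simps)
        qed
      next
        fix \<delta>' :: real assume "\<delta>' < 0"
        define \<delta> where "\<delta> = - \<delta>'"
        have \<delta>: "0 < \<delta>" using \<open>\<delta>' < 0\<close> by (simp add: \<delta>_def)
        obtain x where x: "y - \<delta> < x" "x < y" "isCont (cdf S) x" using S.ex_isCont_cdf[of "y - \<delta>" y] \<delta> by auto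
        have ux: "cdf S x < u" using gen_inverse_cdf_le_iff[OF S u01, of x] x by (simp add: y_def)
        \<comment> \<open>With half of the gap as margin, the term \<open>n * exp (- q)\<close> must
          supply mass at least \<open>c\<close>. So \<open>ln n\<close> is at least
          \<open>q + ln c\<close>, and the constant \<open>ln c\<close> is negligible against
          \<open>b d\<close>.\<close>
        define c where "c = (u - cdf S x) / 2"
        have c: "0 < c" using ux by (simp add: c_def)
        have "cdf S x < u - c" using ux by (simp add: c_def field_simps)
        then have "\<forall>\<^sub>F d in sequentially. cdf (L d) (a d + x * b d) < u - c" using wc[OF x(3)] by (rule order_tendstoD(2)[rotated])
        moreover have "\<forall>\<^sub>F d in sequentially. - ln c / (x - (y - \<delta>)) < b d"
          using b(2) by (simp add: filterlim_at_top_dense)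
        ultimately show "\<forall>\<^sub>F d in sequentially. \<delta>' < (ln (n d u) - a d - gen_inverse (cdf S) u * b d) / b d"
        proof eventually_elim
          case (elim d)
          let ?q = "a d + x * b d"
          have "c \<le> n d u * exp (- ?q)" using lower[OF u01, of d ?q] elim(1) by linarith
          then have "ln c \<le> ln (n d u * exp (- ?q))" using c n_pos[OF u01, of d] by simp
          also have "\<dots> = ln (n d u) - ?q" using n_pos[OF u01, of d] by (simp add: ln_mult)
          finally have "ln c + ?q \<le> ln (n d u)" by simp
          moreover have "- ln c < b d * (x - (y - \<delta>))"
          proof -
            have D: "0 < x - (y - \<delta>)" using x by simp
            show ?thesis using mult_strict_right_mono[OF elim(2) D] D by simp
          qed
          ultimately have "a d + (y - \<delta>) * b d < ln (n d u)" by (simp add: algebra_simps)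
          then show ?case using b(1)[of d] by (simp add: less_divide_eq y_def \<delta>_def algebra_simps)
        qed
      qed
    qed
  qed
qed

section \<open>Necessity of the tail condition\<close>

lemma char_uminus: "char M (- t) = cnj (char M t)"
proof -
  have "char M (- t) = (CLINT x|M. cnj (iexp (t * x)))" unfolding char_def by (simp add: exp_cnj)
  also have "\<dots> = cnj (char M t)" unfolding char_def by simp
  finally show ?thesis .
qed

text \<open>For \<open>0 \<le> z < 1\<close>, \<open>- ln (1 - z)\<close> lies between
  \<open>z\<close> and \<open>z / (1 - z)\<close>, and the two bounds merge as \<open>z\<close>
  tends to 0.\<close>

lemma power_to_linear_rate:
  fixes z :: "nat \<Rightarrow> real"
  assumes z: "\<And>d. 0 \<le> z d" "\<And>d. z d \<le> 1" "z \<longlonglongrightarrow> 0"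
    and lim: "(\<lambda>d. (1 - z d) ^ d) \<longlonglongrightarrow> exp (- c)"
  shows "(\<lambda>d. real d * z d) \<longlonglongrightarrow> c"
proof -
  have ev: "\<forall>\<^sub>F d in sequentially. z d < 1" using z(3) by (rule order_tendstoD(2)) simp
  have "(\<lambda>d. ln ((1 - z d) ^ d)) \<longlonglongrightarrow> ln (exp (- c))" by (intro tendsto_ln lim) simp
  then have "(\<lambda>d. - ln ((1 - z d) ^ d)) \<longlonglongrightarrow> - ln (exp (- c))" by (rule tendsto_minus)
  moreover have "\<forall>\<^sub>F d in sequentially. - ln ((1 - z d) ^ d) = - (real d * ln (1 - z d))"
    using ev by eventually_elim (simp add: ln_realpow)
  ultimately have l: "(\<lambda>d. - (real d * ln (1 - z d))) \<longlonglongrightarrow> c"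
    using Lim_transform_eventually by fastforce
  show ?thesis
  proof (rule tendsto_sandwich)
    show "\<forall>\<^sub>F d in sequentially. real d * z d \<le> - (real d * ln (1 - z d))"
      using ev
    proof eventually_elim
      case (elim d)
      have "ln (1 - z d) \<le> - z d" using elim ln_add_one_self_le_self2[of "- z d"] by simp
      then have "real d * ln (1 - z d) \<le> real d * (- z d)" by (intro mult_left_mono) auto
      then show ?case by simp
    qed
    have "(\<lambda>d. (1 - z d) * - (real d * ln (1 - z d))) \<longlonglongrightarrow> (1 - 0) * c" by (intro tendsto_intros l z(3))
    then show "(\<lambda>d. (1 - z d) * - (real d * ln (1 - z d))) \<longlonglongrightarrow> c" by simp
    show "\<forall>\<^sub>F d in sequentially. (1 - z d) * - (real d * ln (1 - z d)) \<le> real d * z d"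
      using ev
    proof eventually_elim
      case (elim d)
      have "ln (inverse (1 - z d)) \<le> inverse (1 - z d) - 1" using elim by (intro ln_le_minus_one) simp
      then have "- ln (1 - z d) \<le> inverse (1 - z d) - 1" using elim by (simp add: ln_inverse)
      then have "(1 - z d) * - ln (1 - z d) \<le> (1 - z d) * (inverse (1 - z d) - 1)" using elim by (intro mult_left_mono) auto
      also have "\<dots> = z d" using elim by (simp add: right_diff_distrib)
      finally have "real d * ((1 - z d) * - ln (1 - z d)) \<le> real d * z d" by (intro mult_left_mono) auto
      then show ?case by (simp add: mult_ac)
    qed
  qed (rule l)
qed

text \<open>The measures \<open>d * Q d\<close> accumulate infinite mass at 0, so they have no limit
  among finite measures. The factor \<open>1 - cos (\<delta> * x)\<close> vanishes to second order
  there, and on the side of characteristic functions it acts as a second difference, which expresses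
  everything through \<open>1 - Re (char Q t)\<close> at three points.\<close>

definition tilted :: "real \<Rightarrow> real measure \<Rightarrow> real measure" where
  "tilted \<delta> Q = density Q (\<lambda>x. ennreal ((1 - cos (\<delta> * x)) / (1 - Re (char Q \<delta>))))"

lemma tilted:
  assumes "real_distribution Q" and E: "0 < 1 - Re (char Q \<delta>)"
  shows "real_distribution (tilted \<delta> Q)"
    and "char (tilted \<delta> Q) t = (char Q t - (char Q (t + \<delta>) + char Q (t - \<delta>)) / 2) / of_real (1 - Re (char Q \<delta>))"
    and "f \<in> borel_measurable borel \<Longrightarrow> integral\<^sup>L (tilted \<delta> Q) f = (\<integral>x. (1 - cos (\<delta> * x)) * f x \<partial>Q) / (1 - Re (char Q \<delta>))"
proof -
  interpret Q: real_distribution Q by fact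
  let ?E = "1 - Re (char Q \<delta>)"
  have nn: "0 \<le> (1 - cos (\<delta> * x)) / ?E" for x using E by simp
  have i: "integrable Q (\<lambda>x. 1 - cos (\<delta> * x))" using Q.integrable_cos[of \<delta>] by simp
  have int: "(\<integral>x. 1 - cos (\<delta> * x) \<partial>Q) = ?E" using Q.integrable_cos[of \<delta>] by (simp add: Q.Re_char Q.prob_UNIV)
  have "emeasure (tilted \<delta> Q) (space (tilted \<delta> Q)) = (\<integral>\<^sup>+x. ennreal ((1 - cos (\<delta> * x)) / ?E) \<partial>Q)"
    unfolding tilted_def by (subst emeasure_density) auto
  also have "\<dots> = ennreal (\<integral>x. (1 - cos (\<delta> * x)) / ?E \<partial>Q)"
    using i nn by (intro nn_integral_eq_integral) auto
  also have "\<dots> = 1" using int E by simp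
  finally have "prob_space (tilted \<delta> Q)" by (rule prob_spaceI)
  then show "real_distribution (tilted \<delta> Q)"
    by (intro real_distribution.intro real_distribution_axioms.intro) (auto simp: tilted_def)
  show "integral\<^sup>L (tilted \<delta> Q) f = (\<integral>x. (1 - cos (\<delta> * x)) * f x \<partial>Q) / ?E" if "f \<in> borel_measurable borel"
    unfolding tilted_def using that nn by (subst integral_real_density) auto
  have ie: "has_bochner_integral Q (\<lambda>x. iexp (s * x)) (char Q s)" for s
    unfolding char_def by (rule has_bochner_integral_integrable) (rule Q.integrable_iexp, auto)
  have eq: "((1 - cos (\<delta> * x)) / ?E) *\<^sub>R iexp (t * x) = (iexp (t * x) - (iexp ((t + \<delta>) * x) + iexp ((t - \<delta>) * x)) / 2) / of_real ?E" for x
  proof -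
    have "iexp ((t + \<delta>) * x) + iexp ((t - \<delta>) * x) = iexp (t * x) * (iexp (\<delta> * x) + iexp (- (\<delta> * x)))"
      by (simp add: distrib_left exp_add[symmetric] algebra_simps)
    also have "iexp (\<delta> * x) + iexp (- (\<delta> * x)) = 2 * of_real (cos (\<delta> * x))"
      by (simp add: complex_eq_iff Re_exp Im_exp)
    finally show ?thesis by (simp add: scaleR_conv_of_real algebra_simps diff_divide_distrib)
  qed
  have "char (tilted \<delta> Q) t = (CLINT x|tilted \<delta> Q. iexp (t * x))" by (simp only: char_def)
  also have "\<dots> = (CLINT x|Q. ((1 - cos (\<delta> * x)) / ?E) *\<^sub>R iexp (t * x))"
    unfolding tilted_def using nn by (subst integral_density) auto
  also have "\<dots> = (char Q t - (char Q (t + \<delta>) + char Q (t - \<delta>)) / 2) / of_real ?E"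
    unfolding eq
    by (intro has_bochner_integral_integral_eq has_bochner_integral_divide has_bochner_integral_diff has_bochner_integral_add ie)
  finally show "char (tilted \<delta> Q) t = (char Q t - (char Q (t + \<delta>) + char Q (t - \<delta>)) / 2) / of_real ?E" .
qed

lemma integral_lborel_fold:
  fixes h :: "real \<Rightarrow> 'a::{banach, second_countable_topology}"
  assumes h1: "integrable lborel (\<lambda>x. indicator {0<..} x *\<^sub>R h x)"
    and h2: "integrable lborel (\<lambda>x. indicator {0<..} x *\<^sub>R h (- x))"
    and [measurable]: "h \<in> borel_measurable borel"
  shows "has_bochner_integral lborel h (\<integral>x. indicator {0<..} x *\<^sub>R (h x + h (- x)) \<partial>lborel)"
proof -
  have "has_bochner_integral lborel (\<lambda>x. indicator {0<..} x *\<^sub>R h (- x)) (\<integral>x. indicator {0<..} x *\<^sub>R h (- x) \<partial>lborel)"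
    by (rule has_bochner_integral_integrable[OF h2])
  then have "has_bochner_integral lborel (\<lambda>x. indicator {0<..} (- x) *\<^sub>R h x) (\<integral>x. indicator {0<..} x *\<^sub>R h (- x) \<partial>lborel)"
    using lborel_has_bochner_integral_real_affine_iff[of "- 1" "\<lambda>x. indicator {0<..} x *\<^sub>R h (- x)" _ 0] by simp
  from has_bochner_integral_add[OF has_bochner_integral_integrable[OF h1] this]
  have "has_bochner_integral lborel (\<lambda>x. indicator {0<..} x *\<^sub>R h x + indicator {0<..} (- x) *\<^sub>R h x)
    ((\<integral>x. indicator {0<..} x *\<^sub>R h x \<partial>lborel) + (\<integral>x. indicator {0<..} x *\<^sub>R h (- x) \<partial>lborel))" .
  moreover have "AE x in lborel. indicator {0<..} x *\<^sub>R h x + indicator {0<..} (- x) *\<^sub>R h x = h x"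
    using AE_lborel_singleton[of 0] by eventually_elim (auto simp: indicator_def)
  ultimately have "has_bochner_integral lborel h
    ((\<integral>x. indicator {0<..} x *\<^sub>R h x \<partial>lborel) + (\<integral>x. indicator {0<..} x *\<^sub>R h (- x) \<partial>lborel))"
    by (subst (asm) has_bochner_integral_cong_AE) auto
  then show ?thesis using h1 h2 by (simp add: scaleR_add_right)
qed

lemma levy_measure_fold:
  fixes g :: "real \<Rightarrow> 'a::{banach, second_countable_topology}"
  assumes \<alpha>: "0 < \<alpha>" and [measurable]: "g \<in> borel_measurable borel"
    and g: "integrable (levy_measure \<alpha>) g" "integrable (levy_measure \<alpha>) (\<lambda>x. g (- x))"
  shows "has_bochner_integral lborel (\<lambda>x. (\<alpha> * \<bar>x\<bar> powr (- \<alpha> - 1)) *\<^sub>R g x) (\<integral>x. g x + g (- x) \<partial>levy_measure \<alpha>)"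
proof -
  let ?h = "\<lambda>x. (\<alpha> * \<bar>x\<bar> powr (- \<alpha> - 1)) *\<^sub>R g x"
  have e1: "indicator {0<..} x *\<^sub>R ?h x = (indicator {0<..} x * (\<alpha> * x powr (- \<alpha> - 1))) *\<^sub>R g x"
   and e2: "indicator {0<..} x *\<^sub>R ?h (- x) = (indicator {0<..} x * (\<alpha> * x powr (- \<alpha> - 1))) *\<^sub>R g (- x)"
   and e3: "indicator {0<..} x *\<^sub>R (?h x + ?h (- x)) = (indicator {0<..} x * (\<alpha> * x powr (- \<alpha> - 1))) *\<^sub>R (g x + g (- x))" for x
    by (auto simp: indicator_def scaleR_add_right)
  have "has_bochner_integral lborel ?h (\<integral>x. indicator {0<..} x *\<^sub>R (?h x + ?h (- x)) \<partial>lborel)"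
  proof (rule integral_lborel_fold)
    show "integrable lborel (\<lambda>x. indicator {0<..} x *\<^sub>R ?h x)" unfolding e1 using g(1) \<alpha> by (simp add: levy_measure_integral)
    show "integrable lborel (\<lambda>x. indicator {0<..} x *\<^sub>R ?h (- x))" unfolding e2 using g(2) \<alpha> by (simp add: levy_measure_integral)
  qed simp
  then show ?thesis unfolding e3 using \<alpha> by (simp add: levy_measure_integral)
qed

text \<open>The two-sided Levy density under the same tilting. The normalizer is twice the value of
  \<open>levy_integral_cos\<close> at \<delta>, one half for each side.\<close>

definition tilted_stable :: "real \<Rightarrow> real \<Rightarrow> real measure" where
  "tilted_stable \<alpha> \<delta> = density lborel
    (\<lambda>x. ennreal (\<alpha> * \<bar>x\<bar> powr (- \<alpha> - 1) * ((1 - cos (\<delta> * x)) / (2 * kappa \<alpha> * \<delta> powr \<alpha>))))"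

lemma tilted_stable:
  assumes \<alpha>: "0 < \<alpha>" "\<alpha> < 2" and \<delta>: "0 < \<delta>"
  shows "real_distribution (tilted_stable \<alpha> \<delta>)"
    and "char (tilted_stable \<alpha> \<delta>) t = of_real (((\<bar>t + \<delta>\<bar> powr \<alpha> + \<bar>t - \<delta>\<bar> powr \<alpha>) / 2 - \<bar>t\<bar> powr \<alpha>) / \<delta> powr \<alpha>)"
    and "0 < x1 \<Longrightarrow> x1 < x2 \<Longrightarrow> (\<And>x. x1 < x \<Longrightarrow> x \<le> x2 \<Longrightarrow> cos (\<delta> * x) \<noteq> 1) \<Longrightarrow>
       (\<integral>x. indicator {x1<..x2} x / (1 - cos (\<delta> * x)) \<partial>tilted_stable \<alpha> \<delta>) = (x1 powr (- \<alpha>) - x2 powr (- \<alpha>)) / (2 * kappa \<alpha> * \<delta> powr \<alpha>)"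
proof -
  let ?D = "2 * kappa \<alpha> * \<delta> powr \<alpha>"
  have D: "0 < ?D" using kappa_pos[OF \<alpha>] \<delta> by simp
  define k where "k x = (1 - cos (\<delta> * x)) / ?D" for x
  have [measurable]: "k \<in> borel_measurable borel" unfolding k_def by measurable
  have knn: "0 \<le> k x" for x using D by (simp add: k_def)
  have keven: "k (- x) = k x" for x by (simp add: k_def)
  have kint: "has_bochner_integral (levy_measure \<alpha>) k (1 / 2)"
  proof -
    have "has_bochner_integral (levy_measure \<alpha>) (\<lambda>x. (1 - cos (\<delta> * x)) / ?D) ((kappa \<alpha> * \<bar>\<delta>\<bar> powr \<alpha>) / ?D)"
      by (intro has_bochner_integral_divide levy_integral_cos[OF \<alpha>])
    then show ?thesis using \<delta> kappa_pos[OF \<alpha>] unfolding k_def[abs_def] by simp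
  qed
  have ki: "integrable (levy_measure \<alpha>) k" using kint by (simp add: has_bochner_integral_iff)
  have def: "tilted_stable \<alpha> \<delta> = density lborel (\<lambda>x. ennreal (\<alpha> * \<bar>x\<bar> powr (- \<alpha> - 1) * k x))"
    by (simp add: tilted_stable_def k_def)
  have dnn: "0 \<le> \<alpha> * \<bar>x\<bar> powr (- \<alpha> - 1) * k x" for x using knn \<alpha> by simp
  have tot: "has_bochner_integral lborel (\<lambda>x. \<alpha> * \<bar>x\<bar> powr (- \<alpha> - 1) * k x) 1"
  proof -
    have "has_bochner_integral lborel (\<lambda>x. (\<alpha> * \<bar>x\<bar> powr (- \<alpha> - 1)) *\<^sub>R k x) (\<integral>x. k x + k (- x) \<partial>levy_measure \<alpha>)"
      using ki \<alpha> by (intro levy_measure_fold) (auto simp: keven)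
    moreover have "(\<integral>x. k x + k (- x) \<partial>levy_measure \<alpha>) = 1" using kint by (simp add: keven has_bochner_integral_iff)
    ultimately show ?thesis by simp
  qed
  have "emeasure (tilted_stable \<alpha> \<delta>) (space (tilted_stable \<alpha> \<delta>)) = (\<integral>\<^sup>+x. ennreal (\<alpha> * \<bar>x\<bar> powr (- \<alpha> - 1) * k x) \<partial>lborel)"
    unfolding def by (subst emeasure_density) auto
  also have "\<dots> = 1" using tot dnn by (subst nn_integral_eq_integral) (auto simp: has_bochner_integral_iff)
  finally have "prob_space (tilted_stable \<alpha> \<delta>)" by (rule prob_spaceI)
  then show "real_distribution (tilted_stable \<alpha> \<delta>)"
    by (intro real_distribution.intro real_distribution_axioms.intro) (auto simp: def)
  have "char (tilted_stable \<alpha> \<delta>) t = (CLBINT x. (\<alpha> * \<bar>x\<bar> powr (- \<alpha> - 1)) *\<^sub>R (k x *\<^sub>R iexp (t * x)))"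
    unfolding char_def def using dnn by (subst integral_density) auto
  also have "\<dots> = (CLINT x|levy_measure \<alpha>. k x *\<^sub>R iexp (t * x) + k (- x) *\<^sub>R iexp (t * - x))"
  proof (intro has_bochner_integral_integral_eq levy_measure_fold)
    show "complex_integrable (levy_measure \<alpha>) (\<lambda>x. k x *\<^sub>R iexp (t * x))"
      by (rule Bochner_Integration.integrable_bound[OF ki]) (auto simp: knn)
    show "complex_integrable (levy_measure \<alpha>) (\<lambda>x. k (- x) *\<^sub>R iexp (t * - x))"
      by (rule Bochner_Integration.integrable_bound[OF ki]) (auto simp: knn keven)
  qed (use \<alpha> in auto)
  also have "\<dots> = (CLINT x|levy_measure \<alpha>. of_real (2 / ?D * ((1 - cos ((t + \<delta>) * x)) / 2 + (1 - cos ((t - \<delta>) * x)) / 2 - (1 - cos (t * x)))))"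
  proof (rule Bochner_Integration.integral_cong[OF refl])
    fix x
    have 1: "iexp (t * x) + iexp (t * - x) = of_real (2 * cos (t * x))" by (simp add: complex_eq_iff Re_exp Im_exp)
    \<comment> \<open>Product formula: \<open>(1 - cos (\<delta> * x)) * cos (t * x)\<close> is a
      second difference of cosines in \<open>t\<close>, to which \<open>levy_integral_cos\<close>
      applies termwise.\<close>
    have 2: "cos ((t + \<delta>) * x) + cos ((t - \<delta>) * x) = 2 * (cos (t * x) * cos (\<delta> * x))"
      by (simp add: distrib_right left_diff_distrib cos_add cos_diff)
    have "k x * (2 * cos (t * x)) = 2 / ?D * ((1 - cos ((t + \<delta>) * x)) / 2 + (1 - cos ((t - \<delta>) * x)) / 2 - (1 - cos (t * x)))"
    proof -
      have "(1 - cos ((t + \<delta>) * x)) / 2 + (1 - cos ((t - \<delta>) * x)) / 2 - (1 - cos (t * x)) = cos (t * x) - (cos ((t + \<delta>) * x) + cos ((t - \<delta>) * x)) / 2"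
        by (simp add: field_simps)
      also have "\<dots> = (1 - cos (\<delta> * x)) * cos (t * x)" unfolding 2 by (simp add: algebra_simps)
      finally show ?thesis by (simp add: k_def)
    qed
    moreover have "k x *\<^sub>R iexp (t * x) + k (- x) *\<^sub>R iexp (t * - x) = of_real (k x * (2 * cos (t * x)))"
      unfolding keven scaleR_add_right[symmetric] 1 by (simp add: scaleR_conv_of_real)
    ultimately show "k x *\<^sub>R iexp (t * x) + k (- x) *\<^sub>R iexp (t * - x) = of_real (2 / ?D * ((1 - cos ((t + \<delta>) * x)) / 2 + (1 - cos ((t - \<delta>) * x)) / 2 - (1 - cos (t * x))))"
      by simp
  qed
  also have "\<dots> = of_real (2 / ?D * ((kappa \<alpha> * \<bar>t + \<delta>\<bar> powr \<alpha>) / 2 + (kappa \<alpha> * \<bar>t - \<delta>\<bar> powr \<alpha>) / 2 - kappa \<alpha> * \<bar>t\<bar> powr \<alpha>))"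
    by (intro has_bochner_integral_integral_eq has_bochner_integral_of_real has_bochner_integral_mult_right
        has_bochner_integral_diff has_bochner_integral_add has_bochner_integral_divide levy_integral_cos \<alpha>)
  also have "2 / ?D * ((kappa \<alpha> * \<bar>t + \<delta>\<bar> powr \<alpha>) / 2 + (kappa \<alpha> * \<bar>t - \<delta>\<bar> powr \<alpha>) / 2 - kappa \<alpha> * \<bar>t\<bar> powr \<alpha>)
     = ((\<bar>t + \<delta>\<bar> powr \<alpha> + \<bar>t - \<delta>\<bar> powr \<alpha>) / 2 - \<bar>t\<bar> powr \<alpha>) / \<delta> powr \<alpha>"
  proof -
    have "(kappa \<alpha> * \<bar>t + \<delta>\<bar> powr \<alpha>) / 2 + (kappa \<alpha> * \<bar>t - \<delta>\<bar> powr \<alpha>) / 2 - kappa \<alpha> * \<bar>t\<bar> powr \<alpha>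
      = kappa \<alpha> * ((\<bar>t + \<delta>\<bar> powr \<alpha> + \<bar>t - \<delta>\<bar> powr \<alpha>) / 2 - \<bar>t\<bar> powr \<alpha>)"
      by (simp add: field_simps)
    then show ?thesis using kappa_pos[OF \<alpha>] by simp
  qed
  finally show "char (tilted_stable \<alpha> \<delta>) t = of_real (((\<bar>t + \<delta>\<bar> powr \<alpha> + \<bar>t - \<delta>\<bar> powr \<alpha>) / 2 - \<bar>t\<bar> powr \<alpha>) / \<delta> powr \<alpha>)" .
  show "(\<integral>x. indicator {x1<..x2} x / (1 - cos (\<delta> * x)) \<partial>tilted_stable \<alpha> \<delta>) = (x1 powr (- \<alpha>) - x2 powr (- \<alpha>)) / ?D"
    if x: "0 < x1" "x1 < x2" and c: "\<And>x. x1 < x \<Longrightarrow> x \<le> x2 \<Longrightarrow> cos (\<delta> * x) \<noteq> 1"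
  proof -
    have "(\<integral>x. indicator {x1<..x2} x / (1 - cos (\<delta> * x)) \<partial>tilted_stable \<alpha> \<delta>)
      = (\<integral>x. (\<alpha> * \<bar>x\<bar> powr (- \<alpha> - 1) * k x) * (indicator {x1<..x2} x / (1 - cos (\<delta> * x))) \<partial>lborel)"
      unfolding def using dnn by (subst integral_real_density) auto
    also have "\<dots> = (\<integral>x. (indicator {0<..} x * (\<alpha> * x powr (- \<alpha> - 1))) *\<^sub>R (indicator {x1<..x2} x / ?D) \<partial>lborel)"
      using x c by (intro Bochner_Integration.integral_cong) (auto simp: indicator_def k_def)
    also have "\<dots> = (\<integral>x. indicator {x1<..x2} x / ?D \<partial>levy_measure \<alpha>)" using \<alpha> by (subst levy_measure_integral) auto
    also have "\<dots> = measure (levy_measure \<alpha>) {x1<..x2} / ?D" by simp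
    also have "measure (levy_measure \<alpha>) {x1<..x2} = x1 powr (- \<alpha>) - x2 powr (- \<alpha>)"
    proof -
      have "{x1<..x2} = {x1<..} - {x2<..}" using x by auto
      then show ?thesis
        using x \<alpha> emeasure_levy_measure_Ioi[of \<alpha> x1] emeasure_levy_measure_Ioi[of \<alpha> x2]
        by (simp only:) (subst measure_Diff, auto simp: measure_levy_measure_Ioi)
    qed
    finally show ?thesis .
  qed
qed

lemma isCont_indicator_divide:
  fixes k :: "real \<Rightarrow> real"
  assumes k: "continuous_on UNIV k" "\<And>x. x1 \<le> x \<Longrightarrow> x \<le> x2 \<Longrightarrow> k x \<noteq> 0" and x: "x \<noteq> x1" "x \<noteq> x2"
  shows "isCont (\<lambda>x. indicator {x1<..x2} x / k x) x"
proof -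
  consider "x < x1 \<or> x2 < x" | "x1 < x" "x < x2" using x by linarith
  then show ?thesis
  proof cases
    case 1
    have "open ({..<x1} \<union> {x2<..})" by auto
    moreover have "x \<in> {..<x1} \<union> {x2<..}" using 1 by auto
    ultimately have "\<forall>\<^sub>F y in nhds x. y \<in> {..<x1} \<union> {x2<..}" by (auto simp: eventually_nhds)
    then have "\<forall>\<^sub>F y in nhds x. indicator {x1<..x2} y / k y = 0" by eventually_elim (auto simp: indicator_def)
    then show ?thesis by (subst isCont_cong[where g="\<lambda>_. 0"]) auto
  next
    case 2
    have "open {x1<..<x2}" "x \<in> {x1<..<x2}" using 2 by auto
    then have "\<forall>\<^sub>F y in nhds x. y \<in> {x1<..<x2}" by (auto simp: eventually_nhds)
    then have "\<forall>\<^sub>F y in nhds x. indicator {x1<..x2} y / k y = 1 / k y" by eventually_elim (auto simp: indicator_def)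
    moreover have "isCont (\<lambda>y. 1 / k y) x"
      using k 2 by (intro continuous_intros) (auto simp: continuous_on_eq_continuous_at)
    ultimately show ?thesis by (subst isCont_cong[where g="\<lambda>y. 1 / k y"]) auto
  qed
qed

text \<open>After tilting, the characteristic functions are second differences of
  \<open>d * (1 - Re (char (Q d) t))\<close> divided by its value at \<delta>, so they converge to
  that of \<open>tilted_stable\<close>. Weak convergence is then tested with the indicator divided
  by \<open>1 - cos (\<delta> * x)\<close>, which undoes the tilting.\<close>

lemma interval_mass_lim:
  fixes Q :: "nat \<Rightarrow> real measure"
  assumes \<alpha>: "0 < \<alpha>" "\<alpha> < 2" and Q: "\<And>d. real_distribution (Q d)"
    and real: "\<And>d t. char (Q d) t = of_real (Re (char (Q d) t))"
    and lim: "\<And>t. (\<lambda>d. real d * (1 - Re (char (Q d) t))) \<longlonglongrightarrow> 2 * kappa \<alpha> * \<bar>t\<bar> powr \<alpha>"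
    and x: "0 < x1" "x1 < x2"
  shows "(\<lambda>d. real d * measure (Q d) {x1<..x2}) \<longlonglongrightarrow> x1 powr (- \<alpha>) - x2 powr (- \<alpha>)"
proof -
  \<comment> \<open>Then \<open>\<delta> * x\<close> stays in (0,1] on the interval, where the
    cosine is bounded away from 1 and dividing by \<open>1 - cos\<close> is harmless.\<close>
  define \<delta> where "\<delta> = 1 / x2"
  have \<delta>: "0 < \<delta>" using x by (simp add: \<delta>_def)
  define A where "A d t = real d * (1 - Re (char (Q d) t))" for d t
  have A: "(\<lambda>d. A d t) \<longlonglongrightarrow> 2 * kappa \<alpha> * \<bar>t\<bar> powr \<alpha>" for t using lim by (simp add: A_def)
  have kp: "0 < kappa \<alpha>" by (rule kappa_pos[OF \<alpha>])
  let ?D = "2 * kappa \<alpha> * \<delta> powr \<alpha>"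
  have D: "0 < ?D" using kp \<delta> by simp
  have A\<delta>: "(\<lambda>d. A d \<delta>) \<longlonglongrightarrow> ?D" using A[of \<delta>] \<delta> by simp
  then have "\<forall>\<^sub>F d in sequentially. 0 < A d \<delta>" using D by (rule order_tendstoD(1))
  \<comment> \<open>Tilting needs a positive normalizer, which is guaranteed only from
    \<open>d0\<close> on; hence the shifted sequence.\<close>
  then obtain d0 where d0: "\<And>d. d0 \<le> d \<Longrightarrow> 0 < A d \<delta>" by (auto simp: eventually_sequentially)
  have pos: "0 < 1 - Re (char (Q (d + d0)) \<delta>)" "0 < d + d0" for d
    using d0[of "d + d0"] by (auto simp: A_def zero_less_mult_iff)
  define W where "W d = tilted \<delta> (Q (d + d0))" for d
  have W: "real_distribution (W d)" for d unfolding W_def by (rule tilted(1)[OF Q pos(1)])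
  have cW: "char (W d) t = of_real (((A (d + d0) (t + \<delta>) + A (d + d0) (t - \<delta>)) / 2 - A (d + d0) t) / A (d + d0) \<delta>)" for d t
  proof -
    let ?Q = "Q (d + d0)" and ?n = "real (d + d0)"
    have eq: "((A (d + d0) (t + \<delta>) + A (d + d0) (t - \<delta>)) / 2 - A (d + d0) t) =
      ?n * (Re (char ?Q t) - (Re (char ?Q (t + \<delta>)) + Re (char ?Q (t - \<delta>))) / 2)"
      by (simp add: A_def field_simps)
    have AZ: "A (d + d0) \<delta> = ?n * (1 - Re (char ?Q \<delta>))" by (simp add: A_def)
    have n0: "?n \<noteq> 0" using pos(2)[of d] by linarith
    have "((A (d + d0) (t + \<delta>) + A (d + d0) (t - \<delta>)) / 2 - A (d + d0) t) / A (d + d0) \<delta> =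
      (Re (char ?Q t) - (Re (char ?Q (t + \<delta>)) + Re (char ?Q (t - \<delta>))) / 2) / (1 - Re (char ?Q \<delta>))"
      unfolding eq AZ by (rule mult_divide_mult_cancel_left[OF n0])
    moreover have "char (W d) t = of_real ((Re (char ?Q t) - (Re (char ?Q (t + \<delta>)) + Re (char ?Q (t - \<delta>))) / 2) / (1 - Re (char ?Q \<delta>)))"
      unfolding W_def tilted(2)[OF Q pos(1)] by (subst (1 2 3) real) simp
    ultimately show ?thesis by simp
  qed
  interpret TS: real_distribution "tilted_stable \<alpha> \<delta>" by (rule tilted_stable(1)[OF \<alpha> \<delta>])
  have wc: "weak_conv_m W (tilted_stable \<alpha> \<delta>)"
  proof (rule levy_continuity[OF W TS.real_distribution_axioms])
    fix t
    have "(\<lambda>d. ((A (d + d0) (t + \<delta>) + A (d + d0) (t - \<delta>)) / 2 - A (d + d0) t) / A (d + d0) \<delta>) \<longlonglongrightarrow>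
      ((2 * kappa \<alpha> * \<bar>t + \<delta>\<bar> powr \<alpha> + 2 * kappa \<alpha> * \<bar>t - \<delta>\<bar> powr \<alpha>) / 2 - 2 * kappa \<alpha> * \<bar>t\<bar> powr \<alpha>) / ?D"
      using D by (intro tendsto_intros LIMSEQ_ignore_initial_segment[OF A] LIMSEQ_ignore_initial_segment[OF A\<delta>]) auto
    also have "((2 * kappa \<alpha> * \<bar>t + \<delta>\<bar> powr \<alpha> + 2 * kappa \<alpha> * \<bar>t - \<delta>\<bar> powr \<alpha>) / 2 - 2 * kappa \<alpha> * \<bar>t\<bar> powr \<alpha>)
       = 2 * kappa \<alpha> * ((\<bar>t + \<delta>\<bar> powr \<alpha> + \<bar>t - \<delta>\<bar> powr \<alpha>) / 2 - \<bar>t\<bar> powr \<alpha>)" by (simp add: field_simps)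
    finally have "(\<lambda>d. ((A (d + d0) (t + \<delta>) + A (d + d0) (t - \<delta>)) / 2 - A (d + d0) t) / A (d + d0) \<delta>) \<longlonglongrightarrow>
      ((\<bar>t + \<delta>\<bar> powr \<alpha> + \<bar>t - \<delta>\<bar> powr \<alpha>) / 2 - \<bar>t\<bar> powr \<alpha>) / \<delta> powr \<alpha>"
      using kp by simp
    then show "(\<lambda>d. char (W d) t) \<longlonglongrightarrow> char (tilted_stable \<alpha> \<delta>) t"
      unfolding cW tilted_stable(2)[OF \<alpha> \<delta>] by (rule tendsto_of_real)
  qed
  define f where "f x = indicator {x1<..x2} x / (1 - cos (\<delta> * x))" for x :: real
  have [measurable]: "f \<in> borel_measurable borel" unfolding f_def by measurable
  have cmono: "cos (\<delta> * x) \<le> cos (\<delta> * x1)" if "x1 \<le> x" "x \<le> x2" for x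
  proof (rule cos_monotone_0_pi_le)
    show "0 \<le> \<delta> * x1" using \<delta> x by simp
    show "\<delta> * x1 \<le> \<delta> * x" using that \<delta> by simp
    have "\<delta> * x \<le> 1" using that x by (simp add: \<delta>_def field_simps)
    then show "\<delta> * x \<le> pi" using pi_gt3 by linarith
  qed
  have c1: "cos (\<delta> * x1) < 1"
  proof -
    have "\<delta> * x1 < 1" using x by (simp add: \<delta>_def field_simps)
    then have "cos (\<delta> * x1) < cos 0" using \<delta> x pi_gt3 by (intro cos_monotone_0_pi) auto
    then show ?thesis by simp
  qed
  have cn1: "cos (\<delta> * x) \<noteq> 1" if "x1 \<le> x" "x \<le> x2" for x using cmono[OF that] c1 by linarith
  have fb: "norm (f x) \<le> 1 / (1 - cos (\<delta> * x1))" for x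
  proof (cases "x \<in> {x1<..x2}")
    case True
    then show ?thesis using cmono[of x] c1 by (auto simp: f_def intro!: divide_left_mono mult_pos_pos)
  qed (use c1 in \<open>auto simp: f_def\<close>)
  \<comment> \<open>The test function can jump only at the two endpoints, which the absolutely
    continuous limit does not charge.\<close>
  have null: "emeasure (tilted_stable \<alpha> \<delta>) {x. \<not> isCont f x} = 0"
  proof -
    have "isCont f x" if "x \<noteq> x1" "x \<noteq> x2" for x
      unfolding f_def by (rule isCont_indicator_divide) (use cn1 that in \<open>auto intro!: continuous_intros\<close>)
    then have "{x. \<not> isCont f x} \<subseteq> {x1, x2}" by auto
    then have "emeasure (tilted_stable \<alpha> \<delta>) {x. \<not> isCont f x} \<le> emeasure (tilted_stable \<alpha> \<delta>) {x1, x2}"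
      by (rule emeasure_mono) auto
    also have "\<dots> = 0"
    proof -
      have "{x1, x2} \<in> null_sets lborel" by (rule finite_imp_null_set_lborel) simp
      then have ae: "AE x in lborel. x \<notin> {x1, x2}" by (rule AE_not_in)
      have "{x1, x2} \<in> null_sets (tilted_stable \<alpha> \<delta>)"
        unfolding tilted_stable_def
        by (subst null_sets_density_iff) (measurable, intro conjI, simp, rule eventually_mono[OF ae], blast)
      then show ?thesis by (rule null_setsD1)
    qed
    finally show ?thesis by simp
  qed
  have "(\<lambda>d. integral\<^sup>L (W d) f) \<longlonglongrightarrow> integral\<^sup>L (tilted_stable \<alpha> \<delta>) f"
    by (rule weak_conv_imp_bdd_ae_continuous_conv[OF W TS.real_distribution_axioms wc null fb]) simp
  moreover have "integral\<^sup>L (tilted_stable \<alpha> \<delta>) f = (x1 powr (- \<alpha>) - x2 powr (- \<alpha>)) / ?D"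
    unfolding f_def by (rule tilted_stable(3)[OF \<alpha> \<delta> x]) (use cn1 in auto)
  moreover have "integral\<^sup>L (W d) f = real (d + d0) * measure (Q (d + d0)) {x1<..x2} / A (d + d0) \<delta>" for d
  proof -
    interpret Qd: real_distribution "Q (d + d0)" by (rule Q)
    have "integral\<^sup>L (W d) f = (\<integral>x. (1 - cos (\<delta> * x)) * f x \<partial>Q (d + d0)) / (1 - Re (char (Q (d + d0)) \<delta>))"
      unfolding W_def by (rule tilted(3)[OF Q pos(1)]) simp
    also have "(\<lambda>x. (1 - cos (\<delta> * x)) * f x) = indicator {x1<..x2}"
      using cn1 by (auto simp: f_def fun_eq_iff indicator_def)
    finally have "integral\<^sup>L (W d) f = measure (Q (d + d0)) {x1<..x2} / (1 - Re (char (Q (d + d0)) \<delta>))" by simp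
    also have "\<dots> = (real (d + d0) * measure (Q (d + d0)) {x1<..x2}) / (real (d + d0) * (1 - Re (char (Q (d + d0)) \<delta>)))"
    proof -
      have n0: "real (d + d0) \<noteq> 0" using pos(2)[of d] by linarith
      show ?thesis using mult_divide_mult_cancel_left[OF n0] by simp
    qed
    finally show ?thesis by (simp only: A_def)
  qed
  ultimately have "(\<lambda>d. real (d + d0) * measure (Q (d + d0)) {x1<..x2} / A (d + d0) \<delta>) \<longlonglongrightarrow> (x1 powr (- \<alpha>) - x2 powr (- \<alpha>)) / ?D"
    by simp
  then have "(\<lambda>d. real (d + d0) * measure (Q (d + d0)) {x1<..x2} / A (d + d0) \<delta> * A (d + d0) \<delta>) \<longlonglongrightarrow> (x1 powr (- \<alpha>) - x2 powr (- \<alpha>)) / ?D * ?D"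
    by (intro tendsto_mult LIMSEQ_ignore_initial_segment[OF A\<delta>])
  moreover have "A (d + d0) \<delta> \<noteq> 0" for d using d0[of "d + d0"] by simp
  ultimately have "(\<lambda>d. real (d + d0) * measure (Q (d + d0)) {x1<..x2}) \<longlonglongrightarrow> x1 powr (- \<alpha>) - x2 powr (- \<alpha>)"
    using D kp \<delta> by simp
  then show ?thesis by (rule LIMSEQ_offset)
qed

text \<open>The convergence in \<open>lim\<close> is only pointwise in \<open>t\<close>. The averaging bound is therefore applied after scaling
  the tail mass down to at most \<open>1/2\<close>, so that the integrand stays below \<open>1\<close> and dominated convergence applies.\<close>

lemma tail_mass_small:
  fixes Q :: "nat \<Rightarrow> real measure"
  assumes \<alpha>: "0 < \<alpha>" "\<alpha> < 2" and Q: "\<And>d. real_distribution (Q d)"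
    and lim: "\<And>t. (\<lambda>d. real d * (1 - Re (char (Q d) t))) \<longlonglongrightarrow> 2 * kappa \<alpha> * \<bar>t\<bar> powr \<alpha>"
    and \<eta>: "0 < \<eta>"
  shows "\<forall>\<^sub>F K in at_top. \<forall>\<^sub>F d in sequentially. real d * measure (Q d) {K<..} < \<eta>"
proof -
  have kp: "0 < kappa \<alpha>" by (rule kappa_pos[OF \<alpha>])
  \<comment> \<open>With \<open>u = 2 / K\<close> the limiting integral is at most
    \<open>2 * kappa \<alpha> * u powr \<alpha> * u\<close>. It has to stay below
    \<open>min \<eta> (1/2)\<close> times the factor \<open>u / 2\<close> of the averaging bound,
    which explains the 4.\<close>
  have "((\<lambda>K. 4 * kappa \<alpha> * (2 / K) powr \<alpha>) \<longlongrightarrow> 0) at_top" using \<alpha> by real_asymp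
  then have "\<forall>\<^sub>F K in at_top. 4 * kappa \<alpha> * (2 / K) powr \<alpha> < min \<eta> (1/2)" using \<eta> by (intro order_tendstoD(2)) auto
  with eventually_gt_at_top[of 0] show ?thesis
  proof eventually_elim
    case (elim K)
    define u where "u = 2 / K"
    have u: "0 < u" "2 / u = K" using elim by (auto simp: u_def)
    define A where "A d t = real d * (1 - Re (char (Q d) t))" for d t
    have A0: "0 \<le> A d t" for d t
    proof -
      interpret real_distribution "Q d" by (rule Q)
      have "Re (char (Q d) t) \<le> 1" using cmod_char_le_1 complex_Re_le_cmod order_trans by blast
      then show ?thesis by (simp add: A_def)
    qed
    have [measurable]: "A d \<in> borel_measurable borel" for d
    proof -
      interpret real_distribution "Q d" by (rule Q)
      show ?thesis unfolding A_def by measurable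
    qed
    let ?I = "\<lambda>f. \<integral>t. indicator {0<..<u} t * min (f t) 1 \<partial>lborel"
    have ind: "integrable lborel (\<lambda>t. indicator {0<..<u} t :: real)"
      using u by (intro integrable_real_indicator) auto
    have "(\<lambda>d. ?I (A d)) \<longlonglongrightarrow> ?I (\<lambda>t. 2 * kappa \<alpha> * \<bar>t\<bar> powr \<alpha>)"
    proof (rule integral_dominated_convergence[OF _ _ ind])
      show "AE t in lborel. (\<lambda>d. indicator {0<..<u} t * min (A d t) 1) \<longlonglongrightarrow> indicator {0<..<u} t * min (2 * kappa \<alpha> * \<bar>t\<bar> powr \<alpha>) 1"
        unfolding A_def by (intro always_eventually allI tendsto_intros lim)
      show "AE t in lborel. norm (indicator {0<..<u} t * min (A d t) 1) \<le> indicator {0<..<u} t" for d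
        using A0 by (intro always_eventually allI) (auto simp: indicator_def min_def)
    qed auto
    moreover have "?I (\<lambda>t. 2 * kappa \<alpha> * \<bar>t\<bar> powr \<alpha>) \<le> (\<integral>t. (2 * kappa \<alpha> * u powr \<alpha>) * indicator {0<..<u} t \<partial>lborel)"
    proof (rule integral_mono_AE')
      show "AE t in lborel. indicator {0<..<u} t * min (2 * kappa \<alpha> * \<bar>t\<bar> powr \<alpha>) 1 \<le> (2 * kappa \<alpha> * u powr \<alpha>) * indicator {0<..<u} t"
      proof (intro always_eventually allI)
        fix t :: real
        have "min (2 * kappa \<alpha> * \<bar>t\<bar> powr \<alpha>) 1 \<le> 2 * kappa \<alpha> * u powr \<alpha>" if "0 < t" "t < u"
          using that kp \<alpha> by (intro min.coboundedI1 mult_left_mono powr_mono2) auto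
        then show "indicator {0<..<u} t * min (2 * kappa \<alpha> * \<bar>t\<bar> powr \<alpha>) 1 \<le> (2 * kappa \<alpha> * u powr \<alpha>) * indicator {0<..<u} t"
          by (auto simp: indicator_def)
      qed
    qed (use ind kp in \<open>auto intro!: integrable_mult_right\<close>)
    moreover have "(\<integral>t. (2 * kappa \<alpha> * u powr \<alpha>) * indicator {0<..<u} t \<partial>lborel) = 2 * kappa \<alpha> * u powr \<alpha> * u" using u by simp
    moreover have "2 * kappa \<alpha> * u powr \<alpha> * u < min \<eta> (1/2) * (u / 2)"
      using mult_strict_right_mono[OF elim(2), of "u / 2"] u by (simp add: u_def)
    ultimately have "\<forall>\<^sub>F d in sequentially. ?I (A d) < min \<eta> (1/2) * (u / 2)"
      by (intro order_tendstoD(2)[of "\<lambda>d. ?I (A d)"]) auto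
    then show ?case
    proof eventually_elim
      case (elim d)
      interpret real_distribution "Q d" by (rule Q)
      let ?S = "{x. 2 / u \<le> \<bar>x\<bar>} :: real set"
      have Sm [measurable]: "?S \<in> sets borel" by simp
      define \<tau> where "\<tau> = real d * prob ?S"
      have \<tau>0: "0 \<le> \<tau>" by (simp add: \<tau>_def)
      \<comment> \<open>The largest factor up to 1 with
        \<open>2 * \<theta> * \<tau> \<le> 1\<close>. It gives
        \<open>\<theta> * \<tau> = min \<tau> (1/2)\<close>, and a bound on this minimum below 1/2
        is a bound on \<tau> itself.\<close>
      define \<theta> where "\<theta> = (if \<tau> \<le> 1/2 then 1 else 1 / (2 * \<tau>))"
      have \<theta>: "0 \<le> \<theta>" "\<theta> \<le> 1" "2 * \<theta> * \<tau> \<le> 1" "\<theta> * \<tau> = min \<tau> (1/2)"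
        using \<tau>0 by (auto simp: \<theta>_def min_def divide_simps)
      define h where "h t = expectation (\<lambda>x. (1 - cos (t * x)) * indicator ?S x)" for t
      have i: "integrable (Q d) (\<lambda>x. (1 - cos (t * x)) * indicator ?S x)" for t
        using integrable_cos[of t] by (intro integrable_real_mult_indicator Bochner_Integration.integrable_diff) auto
      have h1: "real d * h t \<le> A d t" for t
      proof -
        have "h t \<le> expectation (\<lambda>x. 1 - cos (t * x))" unfolding h_def
          by (rule integral_mono_AE') (use integrable_cos[of t] in \<open>auto simp: indicator_def\<close>)
        also have "\<dots> = 1 - Re (char (Q d) t)" using integrable_cos[of t] by (simp add: Re_char prob_UNIV)
        finally show ?thesis by (simp add: A_def mult_left_mono)
      qed
      have h2: "real d * h t \<le> 2 * \<tau>" for t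
      proof -
        have "h t \<le> expectation (\<lambda>x. 2 * indicator ?S x)" unfolding h_def
        proof (rule integral_mono_AE)
          show "integrable (Q d) (\<lambda>x. 2 * indicator ?S x :: real)" by (intro integrable_mult_right integrable_indicator_borel Sm)
          have "1 - cos (t * x) \<le> 2" for x using cos_ge_minus_one[of "t * x"] by linarith
          then show "AE x in Q d. (1 - cos (t * x)) * indicator ?S x \<le> 2 * indicator ?S x" by (auto simp: indicator_def)
        qed (rule i)
        then have "h t \<le> 2 * prob ?S" by simp
        then have "real d * h t \<le> real d * (2 * prob ?S)" by (intro mult_left_mono) auto
        then show ?thesis by (simp add: \<tau>_def)
      qed
      have "(real d * \<theta>) * (u / 2 * prob ?S) \<le> (real d * \<theta>) * (\<integral>t. indicator {0<..<u} t * h t \<partial>lborel)"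
        unfolding h_def using \<theta>(1) by (intro mult_left_mono averaged_tail_bound u(1)) auto
      also have "\<dots> = (\<integral>t. indicator {0<..<u} t * (\<theta> * (real d * h t)) \<partial>lborel)"
        unfolding integral_mult_right_zero[symmetric] by (intro Bochner_Integration.integral_cong) auto
      also have "\<dots> \<le> ?I (A d)"
      proof (rule integral_mono_AE')
        show "integrable lborel (\<lambda>t. indicator {0<..<u} t * min (A d t) 1)"
          by (rule Bochner_Integration.integrable_bound[OF ind]) (use A0 in \<open>auto simp: indicator_def min_def\<close>)
        have "\<theta> * (real d * h t) \<le> min (A d t) 1" for t
        proof (rule min.boundedI)
          show "\<theta> * (real d * h t) \<le> A d t"
            using mult_left_mono[OF h1 \<theta>(1), of t] mult_left_le_one_le[OF A0 \<theta>(1,2), of d t] by linarith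
          show "\<theta> * (real d * h t) \<le> 1" using mult_left_mono[OF h2 \<theta>(1), of t] \<theta>(3) by simp
        qed
        then show "AE t in lborel. indicator {0<..<u} t * (\<theta> * (real d * h t)) \<le> indicator {0<..<u} t * min (A d t) 1"
          by (auto simp: indicator_def)
        show "AE t in lborel. 0 \<le> indicator {0<..<u} t * min (A d t) 1" using A0 by (auto simp: indicator_def)
      qed
      also have "\<dots> < min \<eta> (1/2) * (u / 2)" by (rule elim)
      finally have "(\<theta> * \<tau>) * (u / 2) < min \<eta> (1/2) * (u / 2)" by (simp add: \<tau>_def mult_ac)
      then have "min \<tau> (1/2) < min \<eta> (1/2)" using u(1) by (simp only: \<theta>(4) mult_less_cancel_right)
      then have "\<tau> < \<eta>" by (auto simp: min_def split: if_splits)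
      moreover have "prob {K<..} \<le> prob ?S" by (rule finite_measure_mono) (use u in auto)
      then have "real d * prob {K<..} \<le> \<tau>" unfolding \<tau>_def by (intro mult_left_mono) auto
      ultimately show ?case by linarith
    qed
  qed
qed

text \<open>The tail limit is first proved for the difference of two independent copies and then
  carried back. The factor 2 in its exponent belongs to its two sides: each single side has the
  limit \<open>y powr (- \<alpha>)\<close>, which is therefore the limit for \<open>M\<close>
  too.\<close>

lemma tail_lim_of_char_lim:
  assumes \<alpha>: "0 < \<alpha>" "\<alpha> < 2" and M: "real_distribution M" and nonneg: "AE x in M. 0 \<le> x"
    and b: "\<And>d. 0 < b d" "filterlim b at_top sequentially"
    and lim: "\<And>t. (\<lambda>d. char M (t / b d) ^ d * iexp (- (t * (a d / b d)))) \<longlonglongrightarrow> stable_cf \<alpha> t"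
    and x: "0 < x"
  shows "(\<lambda>d. real d * measure M {b d * x<..}) \<longlonglongrightarrow> x powr (- \<alpha>)"
proof -
  interpret M: real_distribution M by fact
  interpret P: pair_prob_space M M ..
  define N where "N = distr (M \<Otimes>\<^sub>M M) borel (\<lambda>p. 1 * fst p + (- 1) * snd p + 0)"
  have N: "real_distribution N" unfolding N_def by (rule real_distribution_affine_pair[OF M M])
  interpret N: real_distribution N by (rule N)
  have cN: "char N t = of_real ((cmod (char M t))\<^sup>2)" for t
    unfolding N_def real_distribution_affine_pair(2)[OF M M] by (simp add: char_uminus complex_norm_square del: of_real_power)
  define Q where "Q d = distr N borel (\<lambda>x. (x - 0) / b d)" for d
  have Q: "real_distribution (Q d)" and cQ: "char (Q d) t = of_real ((cmod (char M (t / b d)))\<^sup>2)" for d t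
    unfolding Q_def using char_distr_affine[OF N, of 0 "b d"] by (auto simp: cN)
  have bt: "(\<lambda>d. t / b d) \<longlonglongrightarrow> 0" for t
    by (rule real_tendsto_divide_at_top[OF tendsto_const b(2)])
  have limA: "(\<lambda>d. real d * (1 - Re (char (Q d) t))) \<longlonglongrightarrow> 2 * kappa \<alpha> * \<bar>t\<bar> powr \<alpha>" for t
  proof -
    \<comment> \<open>The squared modulus discards the centering factor of modulus 1, so the limit
      becomes one of real powers \<open>(1 - z d) ^ d\<close>.\<close>
    define z where "z d = 1 - (cmod (char M (t / b d)))\<^sup>2" for d
    have z01: "0 \<le> z d" "z d \<le> 1" for d using M.cmod_char_le_1[of "t / b d"] by (auto simp: z_def power_le_one)
    have "(\<lambda>d. char M (t / b d)) \<longlonglongrightarrow> char M 0" by (rule isCont_tendsto_compose[OF M.isCont_char bt])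
    then have "(\<lambda>d. 1 - (cmod (char M (t / b d)))\<^sup>2) \<longlonglongrightarrow> 1 - (cmod (char M 0))\<^sup>2" by (intro tendsto_intros)
    then have z0: "z \<longlonglongrightarrow> 0" by (simp add: z_def[abs_def] M.char_zero)
    have "(\<lambda>d. (cmod (char M (t / b d) ^ d * iexp (- (t * (a d / b d)))))\<^sup>2) \<longlonglongrightarrow> (cmod (stable_cf \<alpha> t))\<^sup>2"
      by (intro tendsto_intros lim)
    moreover have "(cmod (char M (t / b d) ^ d * iexp (- (t * (a d / b d)))))\<^sup>2 = (1 - z d) ^ d" for d
    proof -
      have "cmod (iexp (- (t * (a d / b d)))) = 1" by (rule norm_exp_i_times)
      then show ?thesis unfolding norm_mult norm_power by (simp add: z_def power_mult[symmetric] mult.commute)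
    qed
    moreover have "(cmod (stable_cf \<alpha> t))\<^sup>2 = exp (- (2 * kappa \<alpha> * \<bar>t\<bar> powr \<alpha>))"
      unfolding norm_stable_cf[OF \<alpha>(1)] by (simp add: power2_eq_square exp_add[symmetric])
    ultimately have "(\<lambda>d. (1 - z d) ^ d) \<longlonglongrightarrow> exp (- (2 * kappa \<alpha> * \<bar>t\<bar> powr \<alpha>))" by simp
    from power_to_linear_rate[OF z01 z0 this] show ?thesis by (simp add: z_def cQ)
  qed
  have cQr: "char (Q d) t = of_real (Re (char (Q d) t))" for d t by (simp add: cQ)
  define G where "G d y = measure (Q d) {y<..}" for d y
  have Gsplit: "G d y = measure (Q d) {y<..K} + G d K" if "y \<le> K" for d y K
  proof -
    interpret Qd: real_distribution "Q d" by (rule Q)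
    have "measure (Q d) ({y<..K} \<union> {K<..}) = measure (Q d) {y<..K} + measure (Q d) {K<..}"
      by (rule Qd.finite_measure_Union) auto
    moreover have "{y<..K} \<union> {K<..} = {y<..}" using that by auto
    ultimately show ?thesis unfolding G_def by (simp only:)
  qed
  have Glim: "(\<lambda>d. real d * G d y) \<longlonglongrightarrow> y powr (- \<alpha>)" if y: "0 < y" for y
  proof (rule order_tendstoI)
    fix c assume c: "c < y powr (- \<alpha>)"
    have "((\<lambda>K. y powr (- \<alpha>) - K powr (- \<alpha>)) \<longlongrightarrow> y powr (- \<alpha>) - 0) at_top"
      using \<alpha> by (intro tendsto_intros tendsto_neg_powr filterlim_ident) auto
    then have "\<forall>\<^sub>F K in at_top. c < y powr (- \<alpha>) - K powr (- \<alpha>)" using c by (intro order_tendstoD(1)) auto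
    then have "\<forall>\<^sub>F K in at_top. c < y powr (- \<alpha>) - K powr (- \<alpha>) \<and> y < K"
      using eventually_gt_at_top[of y] by eventually_elim simp
    then obtain K where K: "c < y powr (- \<alpha>) - K powr (- \<alpha>)" "y < K" by (auto simp: eventually_at_top_linorder)
    have "\<forall>\<^sub>F d in sequentially. c < real d * measure (Q d) {y<..K}"
      using interval_mass_lim[OF \<alpha> Q cQr limA y K(2)] K(1) by (rule order_tendstoD(1))
    then show "\<forall>\<^sub>F d in sequentially. c < real d * G d y"
    proof eventually_elim
      case (elim d)
      have "real d * measure (Q d) {y<..K} \<le> real d * G d y"
        using Gsplit[of y K d] K(2) by (intro mult_left_mono) (auto simp: G_def)
      then show ?case using elim by linarith
    qed
  next
    fix c assume c: "y powr (- \<alpha>) < c"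
    define \<eta> where "\<eta> = (c - y powr (- \<alpha>)) / 2"
    have \<eta>: "0 < \<eta>" using c by (simp add: \<eta>_def)
    have "\<forall>\<^sub>F K in at_top. (\<forall>\<^sub>F d in sequentially. real d * measure (Q d) {K<..} < \<eta>) \<and> y < K"
      using tail_mass_small[OF \<alpha> Q limA \<eta>] eventually_gt_at_top[of y] by eventually_elim simp
    then have "\<exists>K. (\<forall>\<^sub>F d in sequentially. real d * measure (Q d) {K<..} < \<eta>) \<and> y < K"
      by (rule eventually_happens'[rotated]) simp
    then obtain K where K: "\<forall>\<^sub>F d in sequentially. real d * measure (Q d) {K<..} < \<eta>" "y < K" by blast
    have "y powr (- \<alpha>) - K powr (- \<alpha>) < c - \<eta>"
    proof -
      have "0 \<le> K powr (- \<alpha>)" by simp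
      moreover have "c - \<eta> = y powr (- \<alpha>) + \<eta>" by (simp add: \<eta>_def field_simps)
      ultimately show ?thesis using \<eta> by linarith
    qed
    then have "\<forall>\<^sub>F d in sequentially. real d * measure (Q d) {y<..K} < c - \<eta>"
      using interval_mass_lim[OF \<alpha> Q cQr limA y K(2)] by (rule order_tendstoD(2)[rotated])
    with K(1) show "\<forall>\<^sub>F d in sequentially. real d * G d y < c"
      by eventually_elim (use Gsplit[of y K] K(2) in \<open>simp add: G_def distrib_left\<close>)
  qed
  let ?T = "\<lambda>y. measure M {y<..}"
  have Geq: "G d y = measure (M \<Otimes>\<^sub>M M) {p. b d * y < fst p - snd p}" for d y
  proof -
    have 1: "(\<lambda>x. (x - 0) / b d) -` {y<..} \<inter> space N = {b d * y<..}"
      using b(1)[of d] by (auto simp: field_simps)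
    have 2: "(\<lambda>p. 1 * fst p + (- 1) * snd p + 0) -` {b d * y<..} \<inter> space (M \<Otimes>\<^sub>M M) = {p. b d * y < fst p - snd p}"
      by (auto simp: space_pair_measure)
    have "G d y = measure N {b d * y<..}" unfolding G_def Q_def by (subst measure_distr) (auto simp: 1[simplified])
    also have "\<dots> = measure (M \<Otimes>\<^sub>M M) {p. b d * y < fst p - snd p}"
      unfolding N_def by (subst measure_distr) (auto simp: 2[simplified])
    finally show ?thesis .
  qed
  have prod: "measure (M \<Otimes>\<^sub>M M) (A \<times> B) = measure M A * measure M B" if "A \<in> sets borel" "B \<in> sets borel" for A B
    using that by (simp add: measure_def M.emeasure_pair_measure_Times enn2real_mult)
  have sets: "{p. c < fst p - snd p} \<in> sets (M \<Otimes>\<^sub>M M)" for c :: real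
  proof -
    have "{p \<in> space (M \<Otimes>\<^sub>M M). c < fst p - snd p} \<in> sets (M \<Otimes>\<^sub>M M)" by measurable
    then show ?thesis by (simp add: space_pair_measure)
  qed
  have AB: "A \<times> B \<in> sets (M \<Otimes>\<^sub>M M)" if "A \<in> sets borel" "B \<in> sets borel" for A B :: "real set"
    using that by (intro pair_measureI) auto
  \<comment> \<open>Subtracting a nonnegative copy can only lower the value.\<close>
  have upper: "G d y \<le> ?T (b d * y)" for d y
  proof -
    have neg: "measure M {..<0} = 0"
      using nonneg by (subst M.prob_eq_0) (auto elim: eventually_mono)
    have "G d y \<le> measure (M \<Otimes>\<^sub>M M) (({b d * y<..} \<times> UNIV) \<union> (UNIV \<times> {..<0}))"
      unfolding Geq by (rule P.finite_measure_mono) (auto intro!: AB sets.Un)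
    also have "\<dots> \<le> measure (M \<Otimes>\<^sub>M M) ({b d * y<..} \<times> UNIV) + measure (M \<Otimes>\<^sub>M M) (UNIV \<times> {..<0})"
      by (rule measure_Un_le) (auto intro!: AB)
    also have "\<dots> = ?T (b d * y)" by (simp add: prod M.prob_UNIV neg)
    finally show ?thesis .
  qed
  \<comment> \<open>The difference exceeds \<open>b d * y\<close> whenever the first copy exceeds
    \<open>b d * y + m\<close> and the second stays below \<open>m\<close>; independence gives the
    product.\<close>
  have lower: "?T (b d * y + m) * (1 - ?T m) \<le> G d y" for d y m
  proof -
    have c: "1 - ?T m = measure M {..m}"
    proof -
      have "UNIV - {..m} = {m<..}" by auto
      then show ?thesis using M.prob_compl[of "{..m}"] by simp
    qed
    have "?T (b d * y + m) * (1 - ?T m) = measure (M \<Otimes>\<^sub>M M) ({b d * y + m<..} \<times> {..m})"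
      unfolding c by (simp add: prod)
    also have "\<dots> \<le> G d y" unfolding Geq by (rule P.finite_measure_mono[OF _ sets]) auto
    finally show ?thesis .
  qed
  show ?thesis
  proof (rule order_tendstoI)
    fix c assume "c < x powr (- \<alpha>)"
    then have "\<forall>\<^sub>F d in sequentially. c < real d * G d x" using Glim[OF x] by (rule order_tendstoD(1)[rotated])
    then show "\<forall>\<^sub>F d in sequentially. c < real d * ?T (b d * x)"
      by eventually_elim (use upper in \<open>meson mult_left_mono of_nat_0_le_iff order_less_le_trans\<close>)
  next
    fix c assume c: "x powr (- \<alpha>) < c"
    have "((\<lambda>e. (x * (1 - e)) powr (- \<alpha>) / (1 - e)) \<longlongrightarrow> (x * (1 - 0)) powr (- \<alpha>) / (1 - 0)) (at_right 0)"
      using x by (intro tendsto_intros) auto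
    then have "\<forall>\<^sub>F e in at_right 0. (x * (1 - e)) powr (- \<alpha>) / (1 - e) < c" using c by (intro order_tendstoD(2)) auto
    moreover have "\<forall>\<^sub>F e in at_right (0::real). e < 1" by (rule eventually_at_right_field[THEN iffD2]) (auto intro: exI[of _ 1])
    ultimately have "\<forall>\<^sub>F e in at_right 0. (x * (1 - e)) powr (- \<alpha>) / (1 - e) < c \<and> e < 1" by eventually_elim simp
    then obtain e where e: "0 < e" "e < 1" "(x * (1 - e)) powr (- \<alpha>) / (1 - e) < c"
      by (metis (mono_tags, lifting) eventually_at_right_field dense)
    have "(?T \<longlongrightarrow> 0) at_top"
    proof -
      have "?T y = 1 - cdf M y" for y
      proof -
        have "{y<..} = UNIV - {..y}" by auto
        then show ?thesis using M.prob_compl[of "{..y}"] by (simp add: cdf_def)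
      qed
      then show ?thesis using M.cdf_lim_at_top_prob tendsto_diff[OF tendsto_const[of 1]] by fastforce
    qed
    then have "\<forall>\<^sub>F m in at_top. ?T m < e" using e by (intro order_tendstoD(2)) auto
    \<comment> \<open>The second copy is at most \<open>m\<close> with probability above
      \<open>1 - e\<close>, and since \<open>b\<close> diverges the fixed shift \<open>m\<close> is
      absorbed by \<open>b d * (x * e)\<close>.\<close>
    then obtain m where m: "?T m < e" by (auto simp: eventually_at_top_linorder)
    have "(x * (1 - e)) powr (- \<alpha>) < c * (1 - e)" using e by (simp add: divide_less_eq)
    then have "\<forall>\<^sub>F d in sequentially. real d * G d (x * (1 - e)) < c * (1 - e)"
      using Glim[of "x * (1 - e)"] e x by (intro order_tendstoD(2)) auto
    moreover have "\<forall>\<^sub>F d in sequentially. m / (x * e) \<le> b d" using b(2) by (simp add: filterlim_at_top)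
    ultimately show "\<forall>\<^sub>F d in sequentially. real d * ?T (b d * x) < c"
    proof eventually_elim
      case (elim d)
      have "m \<le> b d * (x * e)" using elim(2) x e by (simp add: divide_le_eq)
      then have "b d * (x * (1 - e)) + m \<le> b d * x" by (simp add: algebra_simps)
      then have "?T (b d * x) \<le> ?T (b d * (x * (1 - e)) + m)" by (intro M.finite_measure_mono) auto
      then have "?T (b d * x) * (1 - e) \<le> ?T (b d * (x * (1 - e)) + m) * (1 - ?T m)"
        using m e by (intro mult_mono) auto
      also have "\<dots> \<le> G d (x * (1 - e))" by (rule lower)
      finally have "real d * (?T (b d * x) * (1 - e)) \<le> real d * G d (x * (1 - e))" by (intro mult_left_mono) auto
      then have "(real d * ?T (b d * x)) * (1 - e) < c * (1 - e)" using elim(1) by (simp add: mult.assoc)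
      then show ?case using e by simp
    qed
  qed
qed

section \<open>Tensor product eigenvalues\<close>

locale eigenvalues =
  fixes lam :: "nat \<Rightarrow> real"
  assumes lam_nonneg: "\<And>k. 0 \<le> lam k" and lam_summable: "summable lam" and lam_pos: "0 < lam 0"
begin

abbreviation p :: "nat \<Rightarrow> real" where "p \<equiv> barlam lam"

lemma trace_pos: "0 < trace_ev lam"
  unfolding trace_ev_def by (rule suminf_pos2[OF lam_summable lam_nonneg lam_pos])

lemma p_nonneg: "0 \<le> p k"
  using lam_nonneg trace_pos by (simp add: barlam_def)

lemma p_sums: "p sums 1"
proof -
  have "(\<lambda>k. lam k / trace_ev lam) sums (trace_ev lam / trace_ev lam)"
    unfolding trace_ev_def by (intro sums_divide summable_sums lam_summable)
  then show ?thesis using trace_pos by (simp add: barlam_def[abs_def])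
qed

definition P :: "nat pmf" where "P = embed_pmf p"

lemma pmf_P [simp]: "pmf P k = p k"
  unfolding P_def
proof (rule pmf_embed_pmf)
  show "0 \<le> p x" for x by (rule p_nonneg)
  have "(\<integral>\<^sup>+x. ennreal (p x) \<partial>count_space UNIV) = (\<Sum>x. ennreal (p x))" by (rule nn_integral_count_space_nat)
  also have "\<dots> = ennreal (\<Sum>x. p x)"
    by (rule suminf_ennreal2[OF p_nonneg sums_summable[OF p_sums]])
  also have "\<dots> = 1" using sums_unique[OF p_sums] by simp
  finally show "(\<integral>\<^sup>+x. ennreal (p x) \<partial>count_space UNIV) = 1" .
qed

lemma p_le_1: "p k \<le> 1" using pmf_le_1[of P k] by simp

lemma expectation_P:
  fixes f :: "nat \<Rightarrow> real"
  assumes "integrable P f"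
  shows "measure_pmf.expectation P f = (\<Sum>k. p k * f k)"
proof -
  have "integrable (count_space UNIV) (\<lambda>k. pmf P k *\<^sub>R f k)"
    using assms unfolding measure_pmf_eq_density by (subst (asm) integrable_density) (auto simp: p_nonneg)
  moreover have "measure_pmf.expectation P f = (\<integral>k. pmf P k *\<^sub>R f k \<partial>count_space UNIV)"
    unfolding measure_pmf_eq_density by (subst integral_density) (auto simp: p_nonneg)
  ultimately show ?thesis by (simp add: integral_count_space_nat)
qed

text \<open>For \<open>p k = 0\<close> the convention \<open>ln 0 = 0\<close> gives
  \<open>U k = 0\<close>. Such an index has probability 0 under \<open>P\<close>, so the law of
  \<open>U\<close> is not affected.\<close>

definition U :: "nat \<Rightarrow> real" where "U k = - ln (p k)"

lemma U_nonneg: "0 \<le> U k"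
  using p_nonneg[of k] p_le_1[of k] by (cases "p k = 0") (auto simp: U_def)

definition law :: "real measure" where "law = distr P borel U"

lemma real_distribution_law: "real_distribution law"
  unfolding law_def by (rule prob_space.real_distribution_distr[OF measure_pmf.prob_space_axioms]) simp

lemma law_nonneg: "AE x in law. 0 \<le> x"
  unfolding law_def by (subst AE_distr_iff) (auto simp: U_nonneg)

text \<open>For positive eigenvalues \<open>p k < exp (- x)\<close> means \<open>x < U k\<close>;
  vanishing ones contribute 0 to both sides. This identifies condition (i) as a statement about the
  tail of \<open>U\<close>.\<close>

lemma small_tail_eq: "small_tail lam x = measure law {x<..}"
proof -
  have "measure law {x<..} = measure P (U -` {x<..})"
    unfolding law_def by (subst measure_distr) auto
  also have "\<dots> = measure_pmf.expectation P (indicator (U -` {x<..}))" by simp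
  also have "\<dots> = (\<Sum>k. p k * indicator (U -` {x<..}) k)"
    by (rule expectation_P, rule measure_pmf.integrable_const_bound[where B=1]) auto
  also have "(\<lambda>k. p k * indicator (U -` {x<..}) k) = (\<lambda>k. if p k < exp (- x) then p k else 0)"
  proof
    fix k
    show "p k * indicator (U -` {x<..}) k = (if p k < exp (- x) then p k else 0)"
    proof (cases "p k = 0")
      case False
      then have "0 < p k" using p_nonneg[of k] by simp
      then have "p k < exp (- x) \<longleftrightarrow> x < U k"
        unfolding U_def by (metis exp_less_cancel_iff exp_ln minus_less_iff neg_less_iff_less)
      then show ?thesis by (simp add: indicator_def)
    qed simp
  qed
  finally show ?thesis unfolding small_tail_def ..
qed

lemma entropy_eq:
  assumes "integrable law (\<lambda>x. x)"
  shows "entropy_ev lam = (\<integral>x. x \<partial>law)"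
proof -
  have "integrable P U" using assms unfolding law_def by (subst (asm) integrable_distr_eq) auto
  then have "(\<integral>x. x \<partial>law) = (\<Sum>k. p k * U k)"
    unfolding law_def by (subst integral_distr) (auto intro: expectation_P)
  also have "(\<lambda>k. p k * U k) = (\<lambda>k. if p k > 0 then \<bar>ln (p k)\<bar> * p k else 0)"
    using p_nonneg U_nonneg by (auto simp: U_def fun_eq_iff less_le)
  finally show ?thesis unfolding entropy_ev_def ..
qed

lemma truncated_entropy_eq:
  assumes c: "0 < c"
  shows "(\<Sum>k. if p k > exp (- c) then \<bar>ln (p k)\<bar> * p k else 0) = (\<integral>x. x * indicator {..<c} x \<partial>law)"
proof -
  have i: "integrable P (\<lambda>k. U k * indicator {..<c} (U k))"
    by (rule measure_pmf.integrable_const_bound[where B=c]) (use U_nonneg c in \<open>auto simp: indicator_def\<close>)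
  have "(\<integral>x. x * indicator {..<c} x \<partial>law) = (\<Sum>k. p k * (U k * indicator {..<c} (U k)))"
    unfolding law_def by (subst integral_distr) (auto intro: expectation_P[OF i])
  also have "(\<lambda>k. p k * (U k * indicator {..<c} (U k))) = (\<lambda>k. if p k > exp (- c) then \<bar>ln (p k)\<bar> * p k else 0)"
  proof
    fix k
    show "p k * (U k * indicator {..<c} (U k)) = (if p k > exp (- c) then \<bar>ln (p k)\<bar> * p k else 0)"
    proof (cases "p k = 0")
      case False
      then have "0 < p k" using p_nonneg[of k] by simp
      then have "exp (- c) < p k \<longleftrightarrow> U k < c"
        unfolding U_def by (metis exp_less_cancel_iff exp_ln minus_less_iff)
      then show ?thesis using U_nonneg[of k] by (simp add: indicator_def U_def)
    qed simp
  qed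
  finally show ?thesis ..
qed

section \<open>The product law on multi-indices and the eigenvalue count\<close>

definition Pd :: "nat \<Rightarrow> (nat \<Rightarrow> nat) pmf" where "Pd d = Pi_pmf {..<d} undefined (\<lambda>_. P)"

definition Sd :: "nat \<Rightarrow> (nat \<Rightarrow> nat) \<Rightarrow> real" where "Sd d k = (\<Sum>j<d. U (k j))"

definition lawd :: "nat \<Rightarrow> real measure" where "lawd d = distr (Pd d) borel (Sd d)"

lemma real_distribution_lawd: "real_distribution (lawd d)"
  unfolding lawd_def by (rule prob_space.real_distribution_distr[OF measure_pmf.prob_space_axioms]) simp

lemma char_lawd: "char (lawd d) t = char law t ^ d"
proof -
  have ind: "prob_space.indep_vars (measure_pmf (Pd d)) (\<lambda>_. borel) (\<lambda>j k. U (k j)) {..<d}"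
    using prob_space.indep_vars_compose2[OF measure_pmf.prob_space_axioms indep_vars_Pi_pmf[of "{..<d}" undefined "\<lambda>_. P"], of "\<lambda>_. U" "\<lambda>_. borel"]
    by (simp add: Pd_def)
  have eq: "distr (Pd d) borel (\<lambda>k. U (k j)) = law" if "j < d" for j
  proof -
    have "map_pmf (\<lambda>k. k j) (Pd d) = P" unfolding Pd_def using that by (subst Pi_pmf_component) auto
    then have "measure_pmf P = distr (Pd d) (count_space UNIV) (\<lambda>k. k j)" using map_pmf_rep_eq by metis
    then show ?thesis unfolding law_def by (simp add: distr_distr o_def)
  qed
  have "char (lawd d) t = (\<Prod>j<d. char (distr (Pd d) borel (\<lambda>k. U (k j))) t)"
    unfolding lawd_def Sd_def[abs_def] by (rule prob_space.char_distr_sum[OF measure_pmf.prob_space_axioms ind])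
  also have "\<dots> = (\<Prod>j<d. char law t)" by (intro prod.cong) (auto simp: eq)
  finally show ?thesis by simp
qed

lemma pmf_Pd: "k \<in> multi_idx d \<Longrightarrow> pmf (Pd d) k = tensor_barlam lam d k"
  unfolding Pd_def by (subst pmf_Pi') (auto simp: multi_idx_def tensor_barlam_def PiE_def extensional_def)

lemma set_pmf_Pd: "set_pmf (Pd d) \<subseteq> multi_idx d"
  using set_Pi_pmf_subset[of "{..<d}" undefined "\<lambda>_. P"] by (auto simp: Pd_def multi_idx_def PiE_def extensional_def)

lemma tensor_eq_exp:
  assumes "tensor_barlam lam d k \<noteq> 0"
  shows "tensor_barlam lam d k = exp (- Sd d k)"
proof -
  have "0 < p (k j)" if "j < d" for j
    using assms that p_nonneg[of "k j"] by (auto simp: tensor_barlam_def less_le)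
  then have "tensor_barlam lam d k = (\<Prod>j<d. exp (- U (k j)))"
    unfolding tensor_barlam_def U_def by (intro prod.cong) auto
  also have "\<dots> = exp (- Sd d k)" by (simp add: Sd_def exp_sum[symmetric] sum_negf)
  finally show ?thesis .
qed

lemma sum_tensor: "finite A \<Longrightarrow> A \<subseteq> multi_idx d \<Longrightarrow> sum (tensor_barlam lam d) A = measure (Pd d) A"
  by (subst measure_measure_pmf_finite) (auto intro!: sum.cong simp: pmf_Pd)

lemma cdf_lawd: "cdf (lawd d) q = measure (Pd d) {k. Sd d k \<le> q}"
proof -
  have "Sd d -` {..q} \<inter> space (Pd d) = {k. Sd d k \<le> q}" by auto
  then show ?thesis unfolding cdf_def lawd_def by (subst measure_distr) auto
qed

lemma top_sum_upper:
  assumes "A \<subseteq> multi_idx d" "finite A" "card A \<le> n"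
  shows "sum (tensor_barlam lam d) A \<le> top_sum lam d n"
  unfolding top_sum_def
proof (rule cSup_upper)
  show "bdd_above {(\<Sum>k\<in>A. tensor_barlam lam d k) | A. A \<subseteq> multi_idx d \<and> finite A \<and> card A \<le> n}"
    by (rule bdd_aboveI[of _ 1]) (auto simp: sum_tensor)
qed (use assms in auto)

text \<open>The chosen indices are split at level \<open>q\<close>: those with
  \<open>Sd d k \<le> q\<close> carry at most the distribution function, and each of the others
  carries at most \<open>exp (- q)\<close>.\<close>

lemma top_sum_le: "top_sum lam d n \<le> cdf (lawd d) q + real n * exp (- q)"
  unfolding top_sum_def
proof (rule cSup_least)
  show "{(\<Sum>k\<in>A. tensor_barlam lam d k) | A. A \<subseteq> multi_idx d \<and> finite A \<and> card A \<le> n} \<noteq> {}"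
    by (auto intro!: exI[of _ "{}"])
  fix s assume "s \<in> {(\<Sum>k\<in>A. tensor_barlam lam d k) | A. A \<subseteq> multi_idx d \<and> finite A \<and> card A \<le> n}"
  then obtain A where s: "s = sum (tensor_barlam lam d) A" and A: "A \<subseteq> multi_idx d" "finite A" "card A \<le> n" by auto
  let ?B = "{k \<in> A. Sd d k \<le> q}"
  have "s = sum (tensor_barlam lam d) ?B + sum (tensor_barlam lam d) (A - ?B)"
    unfolding s using A by (subst sum.union_disjoint[symmetric]) (auto intro!: sum.cong)
  also have "sum (tensor_barlam lam d) ?B = measure (Pd d) ?B" by (rule sum_tensor) (use A in auto)
  also have "\<dots> \<le> cdf (lawd d) q" unfolding cdf_lawd by (rule measure_pmf.finite_measure_mono) auto
  also have "sum (tensor_barlam lam d) (A - ?B) \<le> (\<Sum>k\<in>A - ?B. exp (- q))"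
  proof (rule sum_mono)
    fix k assume "k \<in> A - ?B"
    then show "tensor_barlam lam d k \<le> exp (- q)"
      using tensor_eq_exp[of d k] by (cases "tensor_barlam lam d k = 0") auto
  qed
  also have "\<dots> = real (card (A - ?B)) * exp (- q)" by simp
  also have "\<dots> \<le> real n * exp (- q)"
    using A card_mono[of A "A - ?B"] by (intro mult_right_mono) auto
  finally show "s \<le> cdf (lawd d) q + real n * exp (- q)" by simp
qed

text \<open>Eigenvalues of size at least \<open>exp (- q)\<close> have total at most 1, which bounds
  the size of every finite subset by \<open>exp q\<close> and hence makes the level set itself
  finite.\<close>

lemma level_set:
  defines "A d q \<equiv> {k \<in> multi_idx d. exp (- q) \<le> tensor_barlam lam d k}"
  shows "finite (A d q)" "real (card (A d q)) \<le> exp q" "cdf (lawd d) q \<le> sum (tensor_barlam lam d) (A d q)"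
proof -
  have bound: "real (card B) \<le> exp q" if B: "B \<subseteq> A d q" "finite B" for B
  proof -
    have "real (card B) * exp (- q) = (\<Sum>k\<in>B. exp (- q))" by simp
    also have "\<dots> \<le> sum (tensor_barlam lam d) B" using B by (intro sum_mono) (auto simp: A_def)
    also have "\<dots> = measure (Pd d) B" by (rule sum_tensor) (use B in \<open>auto simp: A_def\<close>)
    also have "\<dots> \<le> 1" by simp
    finally show ?thesis by (simp add: exp_minus field_simps)
  qed
  show fin: "finite (A d q)"
  proof (rule ccontr)
    assume "infinite (A d q)"
    then obtain B where B: "B \<subseteq> A d q" "finite B" "card B = nat \<lceil>exp q\<rceil> + 1"
      using infinite_arbitrarily_large by blast
    have "exp q < real (card B)" unfolding B(3) by linarith
    with bound[OF B(1,2)] show False by simp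
  qed
  show "real (card (A d q)) \<le> exp q" by (rule bound[OF subset_refl fin])
  \<comment> \<open>A vanishing tensor eigenvalue may still have a small \<open>Sd d k\<close>
    because of \<open>ln 0 = 0\<close>; intersecting with the support removes it without changing
    the measure.\<close>
  have "cdf (lawd d) q = measure (Pd d) ({k. Sd d k \<le> q} \<inter> set_pmf (Pd d))"
    unfolding cdf_lawd by (rule measure_Int_set_pmf[symmetric])
  also have "\<dots> \<le> measure (Pd d) (A d q)"
  proof (rule measure_pmf.finite_measure_mono)
    show "{k. Sd d k \<le> q} \<inter> set_pmf (Pd d) \<subseteq> A d q"
    proof
      fix k assume k: "k \<in> {k. Sd d k \<le> q} \<inter> set_pmf (Pd d)"
      then have i: "k \<in> multi_idx d" using set_pmf_Pd by auto
      have "tensor_barlam lam d k \<noteq> 0" using k pmf_Pd[OF i] by (simp add: set_pmf_iff)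
      then show "k \<in> A d q" using k i tensor_eq_exp[of d k] by (simp add: A_def)
    qed
  qed simp
  also have "\<dots> = sum (tensor_barlam lam d) (A d q)"
    by (rule sum_tensor[symmetric, OF fin]) (auto simp: A_def)
  finally show "cdf (lawd d) q \<le> sum (tensor_barlam lam d) (A d q)" .
qed

lemma tail_sum_level:
  assumes "1 - \<epsilon>\<^sup>2 \<le> cdf (lawd d) q"
  shows "\<exists>n. real n \<le> exp q \<and> tail_sum lam d n \<le> \<epsilon>\<^sup>2"
proof -
  let ?A = "{k \<in> multi_idx d. exp (- q) \<le> tensor_barlam lam d k}"
  have "1 - \<epsilon>\<^sup>2 \<le> sum (tensor_barlam lam d) ?A" using assms level_set(3)[of d q] by linarith
  also have "\<dots> \<le> top_sum lam d (card ?A)" by (rule top_sum_upper) (use level_set(1) in auto)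
  finally show ?thesis using level_set(2)[of d q] by (intro exI[of _ "card ?A"]) (auto simp: tail_sum_def)
qed

lemma n_eps_upper:
  assumes "1 - \<epsilon>\<^sup>2 \<le> cdf (lawd d) q"
  shows "real (n_eps lam d \<epsilon>) \<le> exp q"
proof -
  obtain n where n: "real n \<le> exp q" "tail_sum lam d n \<le> \<epsilon>\<^sup>2" using tail_sum_level[OF assms] by auto
  have "n_eps lam d \<epsilon> \<le> n" unfolding n_eps_def by (rule Least_le[of _ n]) (rule n(2))
  then show ?thesis using n(1) by linarith
qed

lemma n_eps_lower:
  assumes "0 < \<epsilon>"
  shows "1 - \<epsilon>\<^sup>2 \<le> cdf (lawd d) q + real (n_eps lam d \<epsilon>) * exp (- q)"
proof -
  interpret L: real_distribution "lawd d" by (rule real_distribution_lawd)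
  have "\<forall>\<^sub>F x in at_top. 1 - \<epsilon>\<^sup>2 < cdf (lawd d) x"
    using L.cdf_lim_at_top_prob assms by (intro order_tendstoD(1)) auto
  \<comment> \<open>Some \<open>n\<close> satisfies the tail bound because the distribution function
    tends to 1; only then does the minimum in \<open>n_eps\<close> inherit it.\<close>
  then obtain x where "1 - \<epsilon>\<^sup>2 \<le> cdf (lawd d) x" by (auto simp: eventually_at_top_linorder intro: less_imp_le)
  then obtain n where "tail_sum lam d n \<le> \<epsilon>\<^sup>2" using tail_sum_level by blast
  then have "tail_sum lam d (n_eps lam d \<epsilon>) \<le> \<epsilon>\<^sup>2" unfolding n_eps_def by (rule LeastI)
  then show ?thesis using top_sum_le[of d "n_eps lam d \<epsilon>" q] by (simp add: tail_sum_def)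
qed

text \<open>A count of 0 would force the distribution function to stay above
  \<open>1 - \<epsilon>\<^sup>2\<close> at all levels, down to minus infinity. Positivity gives
  \<open>ln (n_eps lam d \<epsilon>)\<close> its meaning.\<close>

lemma n_eps_pos:
  assumes "0 < \<epsilon>" "\<epsilon> < 1"
  shows "0 < n_eps lam d \<epsilon>"
proof (rule ccontr)
  assume "\<not> 0 < n_eps lam d \<epsilon>"
  then have le: "1 - \<epsilon>\<^sup>2 \<le> cdf (lawd d) q" for q using n_eps_lower[OF assms(1), of d q] by simp
  interpret L: real_distribution "lawd d" by (rule real_distribution_lawd)
  have "\<epsilon>\<^sup>2 < 1" using assms by (simp add: power_less_one_iff)
  then have "\<forall>\<^sub>F x in at_bot. cdf (lawd d) x < 1 - \<epsilon>\<^sup>2"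
    using L.cdf_lim_at_bot by (intro order_tendstoD(2)) auto
  then obtain x where "cdf (lawd d) x < 1 - \<epsilon>\<^sup>2" by (auto simp: eventually_at_bot_linorder)
  with le[of x] show False by simp
qed

text \<open>The substitution \<open>u = 1 - \<epsilon>\<^sup>2\<close> translates the statement into
  quantiles of the stable law; weak convergence and convergence of characteristic functions are then
  interchangeable because the limit law exists.\<close>

lemma asymptotics_iff_char_lim:
  assumes \<alpha>: "0 < \<alpha>" "\<alpha> < 2" and b: "\<And>d. 0 < b d" "filterlim b at_top sequentially"
  shows "(\<forall>\<epsilon>. 0 < \<epsilon> \<and> \<epsilon> < 1 \<longrightarrow>
            (\<lambda>d. ln (real (n_eps lam d \<epsilon>)) - a d - gen_inverse (stable_cdf \<alpha>) (1 - \<epsilon>\<^sup>2) * b d) \<in> o(b))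
    \<longleftrightarrow> (\<forall>t. (\<lambda>d. char law (t / b d) ^ d * iexp (- (t * (a d / b d)))) \<longlonglongrightarrow> stable_cf \<alpha> t)"
proof -
  obtain S where S: "real_distribution S" "\<And>t. char S t = stable_cf \<alpha> t" and F: "stable_cdf \<alpha> = cdf S"
    using stable_cdf_eq[OF \<alpha>] by blast
  define n where "n d u = real (n_eps lam d (sqrt (1 - u)))" for d u
  let ?g = "\<lambda>u d. ln (n d u) - a d - gen_inverse (cdf S) u * b d"
  have b0: "\<forall>\<^sub>F d in sequentially. b d \<noteq> 0" using b(1) by (intro always_eventually allI) (metis less_irrefl)
  have o: "f \<in> o(b) \<longleftrightarrow> (\<lambda>d. f d / b d) \<longlonglongrightarrow> 0" for f :: "nat \<Rightarrow> real"
    using smalloI_tendsto[OF _ b0, of f] smalloD_tendsto[of f] by blast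
  have "(\<forall>\<epsilon>. 0 < \<epsilon> \<and> \<epsilon> < 1 \<longrightarrow>
            (\<lambda>d. ln (real (n_eps lam d \<epsilon>)) - a d - gen_inverse (stable_cdf \<alpha>) (1 - \<epsilon>\<^sup>2) * b d) \<in> o(b))
    \<longleftrightarrow> (\<forall>u. 0 < u \<and> u < 1 \<longrightarrow> (\<lambda>d. ?g u d / b d) \<longlonglongrightarrow> 0)" (is "?L \<longleftrightarrow> ?R")
  proof
    assume L: ?L
    show ?R
    proof (intro allI impI, elim conjE)
      fix u :: real assume u: "0 < u" "u < 1"
      have "0 < sqrt (1 - u)" "sqrt (1 - u) < 1" "1 - (sqrt (1 - u))\<^sup>2 = u" using u by (auto simp: real_sqrt_lt_1_iff)
      with L[rule_format, of "sqrt (1 - u)"] show "(\<lambda>d. ?g u d / b d) \<longlonglongrightarrow> 0" by (simp add: o F n_def)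
    qed
  next
    assume R: ?R
    show ?L
    proof (intro allI impI, elim conjE)
      fix \<epsilon> :: real assume e: "0 < \<epsilon>" "\<epsilon> < 1"
      have "0 < 1 - \<epsilon>\<^sup>2" "1 - \<epsilon>\<^sup>2 < 1" "sqrt (1 - (1 - \<epsilon>\<^sup>2)) = \<epsilon>" using e by (auto simp: power_less_one_iff)
      with R[rule_format, of "1 - \<epsilon>\<^sup>2"]
      show "(\<lambda>d. ln (real (n_eps lam d \<epsilon>)) - a d - gen_inverse (stable_cdf \<alpha>) (1 - \<epsilon>\<^sup>2) * b d) \<in> o(b)"
        by (simp add: o F n_def)
    qed
  qed
  also have "\<dots> \<longleftrightarrow> weak_conv_m (\<lambda>d. distr (lawd d) borel (\<lambda>x. (x - a d) / b d)) S"
  proof (rule quantile_asymptotics_iff_weak_conv[OF real_distribution_lawd S(1) b])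
    show "\<And>p q. p < q \<Longrightarrow> 0 < cdf S p \<Longrightarrow> cdf S q < 1 \<Longrightarrow> cdf S p < cdf S q"
      by (rule stable_cdf_strict[OF \<alpha> S])
  next
    fix d :: nat and u q :: real assume u: "0 < u" "u < 1"
    have e: "0 < sqrt (1 - u)" "sqrt (1 - u) < 1" "1 - (sqrt (1 - u))\<^sup>2 = u" using u by (auto simp: real_sqrt_lt_1_iff)
    show "0 < n d u" using n_eps_pos[OF e(1,2)] by (simp add: n_def)
    show "u \<le> cdf (lawd d) q + n d u * exp (- q)" using n_eps_lower[OF e(1), of d q] by (simp add: n_def e(3))
    assume "u \<le> cdf (lawd d) q"
    then show "n d u \<le> exp q" unfolding n_def by (intro n_eps_upper) (simp add: e(3))
  qed
  also have "\<dots> \<longleftrightarrow> (\<forall>t. (\<lambda>d. char (distr (lawd d) borel (\<lambda>x. (x - a d) / b d)) t) \<longlonglongrightarrow> char S t)"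
  proof
    let ?M = "\<lambda>d. distr (lawd d) borel (\<lambda>x. (x - a d) / b d)"
    have M: "real_distribution (?M d)" for d by (rule char_distr_affine(1)[OF real_distribution_lawd])
    show "\<forall>t. (\<lambda>d. char (?M d) t) \<longlonglongrightarrow> char S t" if "weak_conv_m ?M S"
      using levy_continuity1[OF M S(1) that] by blast
    show "weak_conv_m ?M S" if "\<forall>t. (\<lambda>d. char (?M d) t) \<longlonglongrightarrow> char S t"
      by (rule levy_continuity[OF M S(1)]) (use that in blast)
  qed
  finally show ?thesis
    by (simp add: char_distr_affine(2)[OF real_distribution_lawd] char_lawd S(2))
qed

text \<open>The three definitions of \<open>a_star\<close> describe one centering, the compensated
  mean minus \<open>stable_shift\<close>, in units of \<open>b\<close> and up to a vanishing error.
  For \<alpha> < 1 the compensated mean converges to the shift; for \<alpha> > 1 it differs from the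
  full mean by the excess; for \<alpha> = 1 it differs from the truncated mean by the limit 1 of
  \<open>truncated_lim\<close>.\<close>

lemma a_star_lim:
  assumes \<alpha>: "0 < \<alpha>" "\<alpha> < 2" and b: "\<And>d. 0 < b d" "filterlim b at_top sequentially"
    and tail: "\<And>x. 0 < x \<Longrightarrow> (\<lambda>d. real d * measure law {b d * x<..}) \<longlonglongrightarrow> x powr (- \<alpha>)"
  shows "(\<lambda>d. a_star lam \<alpha> b d / b d - (real d * (\<integral>x. min (x / b d) 1 \<partial>law) - stable_shift \<alpha>)) \<longlonglongrightarrow> 0"
proof -
  interpret A: attracted law \<alpha> b
    using real_distribution_law by (intro attracted.intro attracted_axioms.intro \<alpha> law_nonneg b tail)
  let ?m = "\<lambda>d. \<integral>x. min (x / b d) 1 \<partial>law"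
  consider "\<alpha> < 1" | "\<alpha> = 1" | "1 < \<alpha>" by linarith
  then show ?thesis
  proof cases
    case 1
    have "(\<lambda>d. 1 / (1 - \<alpha>) - real d * ?m d) \<longlonglongrightarrow> 1 / (1 - \<alpha>) - 1 / (1 - \<alpha>)"
      by (intro tendsto_intros A.scaled_min_lim 1)
    then show ?thesis using 1 by (simp add: a_star_def stable_shift_def)
  next
    case 2
    have "(\<lambda>d. 1 - real d * (?m d - (\<integral>x. (x / b d) * indicator {..<b d} x \<partial>law))) \<longlonglongrightarrow> 1 - 1"
      by (intro tendsto_intros A.truncated_lim)
    moreover have "a_star lam \<alpha> b d / b d - (real d * ?m d - stable_shift \<alpha>)
       = 1 - real d * (?m d - (\<integral>x. (x / b d) * indicator {..<b d} x \<partial>law))" for d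
    proof -
      have "(\<integral>x. (x / b d) * indicator {..<b d} x \<partial>law) = (\<integral>x. x * indicator {..<b d} x \<partial>law) / b d"
        by simp
      then show ?thesis using b(1)[of d] 2
        by (simp add: a_star_def stable_shift_def truncated_entropy_eq field_simps)
    qed
    ultimately show ?thesis by simp
  next
    case 3
    note E = A.scaled_excess_lim[OF 3]
    have "(\<lambda>d. real d * ((\<integral>x. x \<partial>law) / b d - ?m d) + 1 / (1 - \<alpha>)) \<longlonglongrightarrow> 1 / (\<alpha> - 1) + 1 / (1 - \<alpha>)"
      by (intro tendsto_intros E(2))
    moreover have "1 / (\<alpha> - 1) + 1 / (1 - \<alpha>) = 0" using 3 by (simp add: field_simps)
    moreover have "a_star lam \<alpha> b d / b d - (real d * ?m d - stable_shift \<alpha>) = real d * ((\<integral>x. x \<partial>law) / b d - ?m d) + 1 / (1 - \<alpha>)" for d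
      using 3 by (simp add: a_star_def stable_shift_def entropy_eq[OF E(1)] right_diff_distrib)
    ultimately show ?thesis by simp
  qed
qed

text \<open>The left-hand side yields the tail limit for whatever centering \<open>a\<close> it
  holds with. Under the tail limit it holds with \<open>a_star\<close>, and subtracting the two
  expansions leaves exactly the difference of the centerings.\<close>

theorem asymptotics_iff:
  assumes \<alpha>: "0 < \<alpha>" "\<alpha> < 2" and b: "\<And>d. 0 < b d" "filterlim b at_top sequentially"
  shows "(\<forall>\<epsilon>. 0 < \<epsilon> \<and> \<epsilon> < 1 \<longrightarrow>
            (\<lambda>d. ln (real (n_eps lam d \<epsilon>)) - a d - gen_inverse (stable_cdf \<alpha>) (1 - \<epsilon>\<^sup>2) * b d) \<in> o(b))
    \<longleftrightarrow> (\<forall>x>0. (\<lambda>d. real d * small_tail lam (b d * x)) \<longlonglongrightarrow> x powr (- \<alpha>)) \<and> (\<lambda>d. a d - a_star lam \<alpha> b d) \<in> o(b)"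
    (is "?L a \<longleftrightarrow> ?T \<and> ?A")
proof -
  have star: "?L (a_star lam \<alpha> b)" if T: ?T
  proof -
    have tail: "(\<lambda>d. real d * measure law {b d * x<..}) \<longlonglongrightarrow> x powr (- \<alpha>)" if "0 < x" for x
      using T that by (simp add: small_tail_eq)
    interpret A: attracted law \<alpha> b
      using real_distribution_law by (intro attracted.intro attracted_axioms.intro \<alpha> law_nonneg b tail)
    show ?thesis
      unfolding asymptotics_iff_char_lim[OF \<alpha> b]
      using A.char_lim[OF a_star_lim[OF \<alpha> b tail]] by blast
  qed
  have T: ?T if L: "?L a"
    using tail_lim_of_char_lim[OF \<alpha> real_distribution_law law_nonneg b] L
    unfolding asymptotics_iff_char_lim[OF \<alpha> b] small_tail_eq by blast
  have shift: "(\<lambda>d. g d - a' d) \<in> o(b) \<longleftrightarrow> (\<lambda>d. a'' d - a' d) \<in> o(b)" if "(\<lambda>d. g d - a'' d) \<in> o(b)" for g a' a'' :: "nat \<Rightarrow> real"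
  proof
    assume "(\<lambda>d. g d - a' d) \<in> o(b)"
    from sum_in_smallo(2)[OF this that] show "(\<lambda>d. a'' d - a' d) \<in> o(b)" by simp
  next
    assume "(\<lambda>d. a'' d - a' d) \<in> o(b)"
    from sum_in_smallo(1)[OF this that] show "(\<lambda>d. g d - a' d) \<in> o(b)" by simp
  qed
  have eqv: "?L a \<longleftrightarrow> ?A" if T: ?T
  proof -
    let ?g = "\<lambda>\<epsilon> d. ln (real (n_eps lam d \<epsilon>)) - gen_inverse (stable_cdf \<alpha>) (1 - \<epsilon>\<^sup>2) * b d"
    have s: "(\<lambda>d. ?g \<epsilon> d - a_star lam \<alpha> b d) \<in> o(b)" if "0 < \<epsilon>" "\<epsilon> < 1" for \<epsilon>
      using star[OF T] that by (simp add: algebra_simps)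
    have "?L a \<longleftrightarrow> (\<forall>\<epsilon>. 0 < \<epsilon> \<and> \<epsilon> < 1 \<longrightarrow> (\<lambda>d. ?g \<epsilon> d - a d) \<in> o(b))" by (simp add: algebra_simps)
    also have "\<dots> \<longleftrightarrow> (\<forall>\<epsilon>::real. 0 < \<epsilon> \<and> \<epsilon> < 1 \<longrightarrow> (\<lambda>d. a_star lam \<alpha> b d - a d) \<in> o(b))"
      using shift[OF s] by blast
    also have "\<dots> \<longleftrightarrow> (\<lambda>d. a_star lam \<alpha> b d - a d) \<in> o(b)"
      using dense[of "0::real" 1] by auto
    also have "\<dots> \<longleftrightarrow> ?A"
      using landau_o.small.uminus_in_iff[of "\<lambda>d. a d - a_star lam \<alpha> b d"] by simp
    finally show ?thesis .
  qed
  show ?thesis using T eqv by blast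
qed

end

section \<open>Slow variation and de Bruijn conjugates\<close>

text \<open>The uniform convergence theorem for slow variation, in logarithmic coordinates. If it
  fails along \<open>x n\<close> and \<open>u n\<close>, most \<open>w\<close> are good for the base
  point \<open>x n\<close> and most are good for \<open>x n + u n\<close>; one \<open>w\<close>
  common to both, after translation by \<open>u n\<close>, compares the two base points and
  contradicts the failure.\<close>

lemma additive_uniform_convergence:
  fixes H :: "real \<Rightarrow> real"
  assumes [measurable]: "H \<in> borel_measurable borel"
    and H: "\<And>u. ((\<lambda>x. H (x + u) - H x) \<longlongrightarrow> 0) at_top" and \<epsilon>: "0 < \<epsilon>"
  shows "\<exists>X. \<forall>x\<ge>X. \<forall>u\<in>{0..1}. \<bar>H (x + u) - H x\<bar> < \<epsilon>"
proof (rule ccontr)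
  assume "\<not> ?thesis"
  then have "\<forall>n::nat. \<exists>x u. real n \<le> x \<and> u \<in> {0..1} \<and> \<epsilon> \<le> \<bar>H (x + u) - H x\<bar>" by (force simp: not_less)
  then obtain x u where x: "\<And>n. real n \<le> x n" and u: "\<And>n. u n \<in> {0..1}" and bad: "\<And>n. \<epsilon> \<le> \<bar>H (x n + u n) - H (x n)\<bar>"
    by metis
  \<comment> \<open>Each fixed \<open>w\<close> is good from some index on, so the increasing
    measurable sets of good points exhaust \<open>{0..2}\<close> and their measure passes
    7/4.\<close>
  have grow: "\<exists>n. 7/4 < measure lborel {w \<in> {0..2}. \<forall>m\<ge>n. \<bar>H (z m + w) - H (z m)\<bar> < \<epsilon> / 2}"
    if z: "filterlim z at_top sequentially" for z :: "nat \<Rightarrow> real"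
  proof -
    define V where "V n = {w \<in> {0..2}. \<forall>m\<ge>n. \<bar>H (z m + w) - H (z m)\<bar> < \<epsilon> / 2}" for n
    have Vm: "V n \<in> sets borel" for n
    proof -
      have "{w \<in> space borel. w \<in> {0..2} \<and> (\<forall>m\<in>{n..}. \<bar>H (z m + w) - H (z m)\<bar> < \<epsilon> / 2)} \<in> sets borel"
        by measurable
      then show ?thesis by (simp add: V_def Ball_def)
    qed
    have "(\<Union>n. V n) = {0..2}"
    proof (intro equalityI subsetI)
      fix w :: real assume w: "w \<in> {0..2}"
      have "(\<lambda>m. H (z m + w) - H (z m)) \<longlonglongrightarrow> 0" by (rule filterlim_compose[OF H z])
      then have "\<forall>\<^sub>F m in sequentially. \<bar>H (z m + w) - H (z m)\<bar> < \<epsilon> / 2"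
        using \<epsilon> tendstoD[of _ 0 sequentially "\<epsilon> / 2"] by (force simp: dist_norm)
      then show "w \<in> (\<Union>n. V n)" using w by (auto simp: V_def eventually_sequentially)
    qed (auto simp: V_def)
    moreover have "(\<lambda>n. emeasure lborel (V n)) \<longlonglongrightarrow> emeasure lborel (\<Union>n. V n)"
      by (rule Lim_emeasure_incseq) (use Vm in \<open>auto simp: incseq_def V_def\<close>)
    ultimately have "(\<lambda>n. emeasure lborel (V n)) \<longlonglongrightarrow> ennreal 2" by simp
    then have "\<forall>\<^sub>F n in sequentially. ennreal (7/4) < emeasure lborel (V n)"
      by (rule order_tendstoD(1)) (simp add: ennreal_less_iff)
    then obtain n where n: "ennreal (7/4) < emeasure lborel (V n)" by (auto simp: eventually_sequentially)
    have "emeasure lborel (V n) \<le> emeasure lborel {0..2::real}" by (rule emeasure_mono) (auto simp: V_def)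
    also have "\<dots> < \<infinity>" by simp
    finally have "emeasure lborel (V n) = ennreal (measure lborel (V n))" by (simp add: emeasure_eq_ennreal_measure)
    with n have "7/4 < measure lborel (V n)" by (simp add: ennreal_less_iff)
    then show ?thesis unfolding V_def by blast
  qed
  have xl: "filterlim x at_top sequentially"
    by (rule filterlim_at_top_mono[OF filterlim_real_sequentially]) (use x in auto)
  have xul: "filterlim (\<lambda>n. x n + u n) at_top sequentially"
    by (rule filterlim_at_top_mono[OF xl]) (use u in auto)
  define V where "V n = {w \<in> {0..2}. \<forall>m\<ge>n. \<bar>H (x m + w) - H (x m)\<bar> < \<epsilon> / 2}" for n
  define W where "W n = {w \<in> {0..2}. \<forall>m\<ge>n. \<bar>H (x m + u m + w) - H (x m + u m)\<bar> < \<epsilon> / 2}" for n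
  have meas: "V n \<in> sets borel" "W n \<in> sets borel" for n
  proof -
    have "{w \<in> space borel. w \<in> {0..2} \<and> (\<forall>m\<in>{n..}. \<bar>H (x m + w) - H (x m)\<bar> < \<epsilon> / 2)} \<in> sets borel"
      "{w \<in> space borel. w \<in> {0..2} \<and> (\<forall>m\<in>{n..}. \<bar>H (x m + u m + w) - H (x m + u m)\<bar> < \<epsilon> / 2)} \<in> sets borel"
      by measurable
    then show "V n \<in> sets borel" "W n \<in> sets borel" by (simp_all add: V_def W_def Ball_def)
  qed
  have fin: "A \<subseteq> {c..e} \<Longrightarrow> A \<in> fmeasurable lborel" if "A \<in> sets borel" for A :: "real set" and c e
    by (rule fmeasurableI2[of "{c..e}"]) (use that in \<open>auto intro!: fmeasurableI simp: emeasure_lborel_Icc_eq\<close>)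
  obtain n1 where n1: "7/4 < measure lborel (V n1)" using grow[OF xl] unfolding V_def by blast
  obtain n2 where n2: "7/4 < measure lborel (W n2)" using grow[OF xul] unfolding W_def by blast
  define n where "n = max n1 n2"
  have Vn: "V n \<in> fmeasurable lborel" by (rule fin[OF meas(1), of _ 0 2]) (auto simp: V_def)
  have Wn: "W n \<in> fmeasurable lborel" by (rule fin[OF meas(2), of _ 0 2]) (auto simp: W_def)
  have "measure lborel (V n1) \<le> measure lborel (V n)"
    by (rule measure_mono_fmeasurable[OF _ _ Vn]) (use meas in \<open>auto simp: V_def n_def\<close>)
  with n1 have V: "7/4 < measure lborel (V n)" by simp
  have "measure lborel (W n2) \<le> measure lborel (W n)"
    by (rule measure_mono_fmeasurable[OF _ _ Wn]) (use meas in \<open>auto simp: W_def n_def\<close>)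
  with n2 have W: "7/4 < measure lborel (W n)" by simp
  let ?W = "(+) (u n) ` W n"
  have W': "measure lborel ?W = measure lborel (W n)" "?W \<in> sets borel"
  proof -
    have img: "?W = (\<lambda>v. - u n + v) -` W n \<inter> space borel"
      by (auto simp: image_iff) (metis add.commute diff_add_cancel uminus_add_conv_diff)
    show "?W \<in> sets borel" unfolding img by (rule measurable_sets[OF _ meas(2)]) simp
    have "measure lborel (W n) = measure (distr lborel borel ((+) (- u n))) (W n)"
      by (simp add: lborel_distr_plus)
    also have "\<dots> = measure lborel ?W" unfolding img by (subst measure_distr) (use meas in auto)
    finally show "measure lborel ?W = measure lborel (W n)" ..
  qed
  have Wf: "?W \<in> fmeasurable lborel"
    by (rule fin[OF W'(2), of 0 3]) (use u[of n] in \<open>auto simp: W_def\<close>)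
  \<comment> \<open>Both sets lie in \<open>{0..3}\<close>, yet their measures add up to more than
    7/2.\<close>
  have "V n \<inter> ?W \<noteq> {}"
  proof
    assume "V n \<inter> ?W = {}"
    then have "measure lborel (V n \<union> ?W) = measure lborel (V n) + measure lborel ?W"
      using Vn Wf by (intro measure_Un_AE) (auto simp: fmeasurable_def)
    moreover have "measure lborel (V n \<union> ?W) \<le> measure lborel {0..3::real}"
      by (rule measure_mono_fmeasurable[OF _ _ fin[of "{0..3}" 0 3]]) (use u[of n] meas W' in \<open>auto simp: V_def W_def\<close>)
    ultimately show False using V W W'(1) by simp
  qed
  then obtain w where w: "w \<in> W n" "u n + w \<in> V n" by auto
  have "\<bar>H (x n + (u n + w)) - H (x n)\<bar> < \<epsilon> / 2" using w(2) by (simp add: V_def)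
  moreover have "\<bar>H (x n + u n + w) - H (x n + u n)\<bar> < \<epsilon> / 2" using w(1) by (simp add: W_def)
  ultimately have "\<bar>H (x n + u n) - H (x n)\<bar> < \<epsilon>" unfolding add.assoc abs_less_iff by linarith
  with bad[of n] show False by simp
qed

text \<open>In logarithmic coordinates uniform convergence limits the change of \<open>H\<close> to
  less than 1/2 per unit step, so \<open>x + H x\<close> still grows at least like
  \<open>x / 2\<close>.\<close>

lemma slowly_varying_times_id_at_top:
  assumes "slowly_varying \<psi>"
  shows "filterlim (\<lambda>y. y * \<psi> y) at_top at_top"
proof -
  obtain t where pos: "\<And>x. t \<le> x \<Longrightarrow> 0 < \<psi> x" and m: "(\<lambda>x. indicator {t..} x * \<psi> x) \<in> borel_measurable borel"
    and sv: "\<And>c. 0 < c \<Longrightarrow> ((\<lambda>x. \<psi> (c * x) / \<psi> x) \<longlongrightarrow> 1) at_top"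
    using assms unfolding slowly_varying_def by blast
  \<comment> \<open>The conjugate is controlled only from \<open>t\<close> on; below
    \<open>t\<close> it is replaced by 1 to obtain a measurable function on the whole line.\<close>
  define g where "g x = indicator {t..} x * \<psi> x + indicator {..<t} x" for x
  have [measurable]: "g \<in> borel_measurable borel" unfolding g_def[abs_def] using m by measurable
  have geq: "g x = \<psi> x" if "t \<le> x" for x using that by (simp add: g_def)
  define H where "H x = ln (g (exp x))" for x
  have [measurable]: "H \<in> borel_measurable borel" unfolding H_def[abs_def] by measurable
  have Hlim: "((\<lambda>x. H (x + v) - H x) \<longlongrightarrow> 0) at_top" for v
  proof -
    have "((\<lambda>x. \<psi> (exp v * exp x) / \<psi> (exp x)) \<longlongrightarrow> 1) at_top"
      by (rule filterlim_compose[OF sv exp_at_top]) simp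
    then have "((\<lambda>x. ln (\<psi> (exp v * exp x) / \<psi> (exp x))) \<longlongrightarrow> ln 1) at_top" by (intro tendsto_ln) auto
    moreover have "\<forall>\<^sub>F x in at_top. ln (\<psi> (exp v * exp x) / \<psi> (exp x)) = H (x + v) - H x"
    proof -
      have "\<forall>\<^sub>F x in at_top. t \<le> exp x" using exp_at_top by (simp add: filterlim_at_top)
      moreover have "\<forall>\<^sub>F x in at_top. t \<le> exp (x + v)"
        using filterlim_compose[OF exp_at_top filterlim_tendsto_add_at_top[OF tendsto_const filterlim_ident], of v]
        by (simp add: filterlim_at_top add.commute)
      ultimately show ?thesis
      proof eventually_elim
        case (elim x)
        then show ?case using pos[of "exp x"] pos[of "exp (x + v)"]
          by (simp add: H_def geq exp_add mult.commute ln_div)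
      qed
    qed
    ultimately show ?thesis using Lim_transform_eventually by fastforce
  qed
  have "\<exists>X. \<forall>x\<ge>X. \<forall>v\<in>{0..1}. \<bar>H (x + v) - H x\<bar> < 1/2"
    by (rule additive_uniform_convergence) (simp_all add: Hlim)
  then obtain X where X: "\<And>x v. X \<le> x \<Longrightarrow> v \<in> {0..1} \<Longrightarrow> \<bar>H (x + v) - H x\<bar> < 1/2" by blast
  have iter: "H X - real n / 2 \<le> H (X + real n)" for n
  proof (induction n)
    case (Suc n)
    have "\<bar>H (X + real n + 1) - H (X + real n)\<bar> < 1/2" by (rule X) auto
    then have "H (X + real n) - 1/2 \<le> H (X + real n + 1)" unfolding abs_less_iff by linarith
    moreover have eq: "X + real (Suc n) = X + real n + 1" by simp
    moreover have "real (Suc n) / 2 = real n / 2 + 1/2" by simp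
    ultimately show ?case unfolding eq using Suc by linarith
  qed simp
  have low: "H X - (x - X) / 2 - 1/2 \<le> H x" if x: "X \<le> x" for x
  proof -
    define n where "n = nat \<lfloor>x - X\<rfloor>"
    have n: "real n \<le> x - X" "x - X < real n + 1" using x by (auto simp: n_def)
    have "\<bar>H (X + real n + (x - X - real n)) - H (X + real n)\<bar> < 1/2" by (rule X) (use n in auto)
    moreover have "X + real n + (x - X - real n) = x" by simp
    ultimately have "\<bar>H x - H (X + real n)\<bar> < 1/2" by (simp only:)
    then have "H (X + real n) - 1/2 \<le> H x" unfolding abs_less_iff by linarith
    moreover have "real n / 2 \<le> (x - X) / 2" using n(1) by (rule divide_right_mono) simp
    ultimately show ?thesis using iter[of n] by linarith
  qed
  have "filterlim (\<lambda>x. 1/2 * x + (H X + X / 2 - 1/2)) at_top at_top"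
    by real_asymp
  then have "filterlim (\<lambda>x. x + H x) at_top at_top"
  proof (rule filterlim_at_top_mono)
    show "\<forall>\<^sub>F x in at_top. 1/2 * x + (H X + X / 2 - 1/2) \<le> x + H x"
      using eventually_ge_at_top[of X]
    proof eventually_elim
      case (elim x)
      then show ?case using low[OF elim] by (simp add: field_simps)
    qed
  qed
  then have "filterlim (\<lambda>y. exp (ln y + H (ln y))) at_top at_top"
    by (intro filterlim_compose[OF exp_at_top] filterlim_compose[OF _ ln_at_top])
  moreover have "\<forall>\<^sub>F y in at_top. exp (ln y + H (ln y)) = y * \<psi> y"
    using eventually_ge_at_top[of t] eventually_gt_at_top[of 0]
    by eventually_elim (simp add: exp_add H_def geq pos)
  ultimately show ?thesis by (subst (asm) filterlim_cong[OF refl refl]) auto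
qed

text \<open>Applied to \<open>R x = T x powr (- 1 / \<alpha>)\<close>, where \<open>T\<close> is the tail. Monotonicity of \<open>R\<close> spares the uniform
  convergence theorem here; it is only needed for an arbitrary conjugate \<open>\<psi>\<close>.\<close>

locale monotone_regularly_varying =
  fixes R :: "real \<Rightarrow> real"
  assumes R_mono: "mono R" and R_pos: "\<And>x. 0 < R x" and R_top: "filterlim R at_top at_top"
    and R_rv: "\<And>c. 0 < c \<Longrightarrow> ((\<lambda>x. R (c * x) / R x) \<longlongrightarrow> c) at_top"
begin

text \<open>Monotonicity inverts regular variation of index 1: \<open>R (a * v x) / R (v x)\<close>
  tends to \<open>a\<close>, so if this lies strictly on one side of the limit \<open>c\<close>,
  then \<open>a * v x\<close> lies on the same side of \<open>u x\<close>.\<close>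

lemma ratio_of_R_ratio:
  assumes v: "filterlim v at_top F" and u: "\<forall>\<^sub>F x in F. 0 < u x" and lim: "((\<lambda>x. R (u x) / R (v x)) \<longlongrightarrow> c) F" and c: "0 < c"
  shows "((\<lambda>x. u x / v x) \<longlongrightarrow> c) F"
proof -
  have v0: "\<forall>\<^sub>F x in F. 0 < v x" using v by (simp add: filterlim_at_top_dense)
  have Rv: "((\<lambda>x. R (a * v x) / R (v x)) \<longlongrightarrow> a) F" if "0 < a" for a
    by (rule filterlim_compose[OF R_rv[OF that] v])
  show ?thesis
  proof (rule order_tendstoI)
    fix a assume a: "a < c"
    show "\<forall>\<^sub>F x in F. a < u x / v x"
    proof (cases "a \<le> 0")
      case True
      show ?thesis using u v0 by eventually_elim (use True in \<open>auto intro: order_le_less_trans\<close>)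
    next
      case False
      obtain m where m: "a < m" "m < c" using a dense by blast
      have "\<forall>\<^sub>F x in F. R (a * v x) / R (v x) < m" using Rv[of a] m False by (intro order_tendstoD(2)) auto
      moreover have "\<forall>\<^sub>F x in F. m < R (u x) / R (v x)" using lim m by (intro order_tendstoD(1)) auto
      ultimately show ?thesis using v0
      proof eventually_elim
        case (elim x)
        then have "R (a * v x) / R (v x) < R (u x) / R (v x)" by simp
        then have "R (a * v x) < R (u x)" using R_pos[of "v x"] by (simp add: divide_less_cancel)
        then have "a * v x < u x" using monoD[OF R_mono, of "u x" "a * v x"] by linarith
        then show ?case using elim by (simp add: less_divide_eq)
      qed
    qed
  next
    fix a assume a: "c < a"
    obtain m where m: "c < m" "m < a" using a dense by blast
    have "\<forall>\<^sub>F x in F. m < R (a * v x) / R (v x)" using Rv[of a] m c a by (intro order_tendstoD(1)) auto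
    moreover have "\<forall>\<^sub>F x in F. R (u x) / R (v x) < m" using lim m by (intro order_tendstoD(2)) auto
    ultimately show "\<forall>\<^sub>F x in F. u x / v x < a" using v0
    proof eventually_elim
      case (elim x)
      then have "R (u x) / R (v x) < R (a * v x) / R (v x)" by simp
      then have "R (u x) < R (a * v x)" using R_pos[of "v x"] by (simp add: divide_less_cancel)
      then have "u x < a * v x" using monoD[OF R_mono, of "a * v x" "u x"] by linarith
      then show ?case using elim by (simp add: divide_less_eq)
    qed
  qed
qed

lemma R_ratio_of_ratio:
  assumes v: "filterlim v at_top F" and lim: "((\<lambda>x. u x / v x) \<longlongrightarrow> 1) F"
  shows "((\<lambda>x. R (u x) / R (v x)) \<longlongrightarrow> 1) F"
proof -
  have v0: "\<forall>\<^sub>F x in F. 0 < v x" using v by (simp add: filterlim_at_top_dense)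
  have Rv: "((\<lambda>x. R (a * v x) / R (v x)) \<longlongrightarrow> a) F" if "0 < a" for a
    by (rule filterlim_compose[OF R_rv[OF that] v])
  show ?thesis
  proof (rule order_tendstoI)
    fix a :: real assume "a < 1"
    then obtain m where m: "max a 0 < m" "m < 1" using dense[of "max a 0" 1] by auto
    have "\<forall>\<^sub>F x in F. a < R (m * v x) / R (v x)" using Rv[of m] m by (intro order_tendstoD(1)) auto
    moreover have "\<forall>\<^sub>F x in F. m < u x / v x" using lim m by (intro order_tendstoD(1)) auto
    ultimately show "\<forall>\<^sub>F x in F. a < R (u x) / R (v x)" using v0
    proof eventually_elim
      case (elim x)
      then have "m * v x \<le> u x" by (simp add: less_divide_eq)
      then have "R (m * v x) / R (v x) \<le> R (u x) / R (v x)" using R_pos[of "v x"] by (intro divide_right_mono monoD[OF R_mono]) auto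
      then show ?case using elim by linarith
    qed
  next
    fix a :: real assume "1 < a"
    then obtain m where m: "1 < m" "m < a" using dense by blast
    have "\<forall>\<^sub>F x in F. R (m * v x) / R (v x) < a" using Rv[of m] m by (intro order_tendstoD(2)) auto
    moreover have "\<forall>\<^sub>F x in F. u x / v x < m" using lim m by (intro order_tendstoD(2)) auto
    ultimately show "\<forall>\<^sub>F x in F. R (u x) / R (v x) < a" using v0
    proof eventually_elim
      case (elim x)
      then have "u x \<le> m * v x" by (simp add: divide_less_eq)
      then have "R (u x) / R (v x) \<le> R (m * v x) / R (v x)" using R_pos[of "v x"] by (intro divide_right_mono monoD[OF R_mono]) auto
      then show ?case using elim by linarith
    qed
  qed
qed

text \<open>An asymptotic inverse of \<open>R\<close>. Restricting to \<open>1 \<le> x\<close>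
  bounds the set from below and keeps the values positive.\<close>

definition Rinv :: "real \<Rightarrow> real" where "Rinv y = Inf {x. 1 \<le> x \<and> y \<le> R x}"

lemma Rinv_nonempty: "{x. 1 \<le> x \<and> y \<le> R x} \<noteq> {}"
proof -
  have "\<forall>\<^sub>F x in at_top. y \<le> R x" using R_top by (simp add: filterlim_at_top)
  then have "\<forall>\<^sub>F x in at_top. 1 \<le> x \<and> y \<le> R x" using eventually_ge_at_top[of 1] by eventually_elim simp
  then show ?thesis by (auto simp: eventually_at_top_linorder)
qed

lemma Rinv_bdd: "bdd_below {x. 1 \<le> x \<and> y \<le> R x}" by (rule bdd_belowI[of _ 1]) auto

lemma Rinv_ge_1: "1 \<le> Rinv y" unfolding Rinv_def by (rule cInf_greatest[OF Rinv_nonempty]) auto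

lemma Rinv_mono: "mono Rinv"
  unfolding Rinv_def by (rule monoI, rule cInf_superset_mono[OF Rinv_nonempty Rinv_bdd]) auto

lemma Rinv_at_top: "filterlim Rinv at_top at_top"
  unfolding filterlim_at_top
proof
  fix Z :: real
  show "\<forall>\<^sub>F y in at_top. Z \<le> Rinv y"
    using eventually_gt_at_top[of "R Z"]
  proof eventually_elim
    case (elim y)
    show ?case unfolding Rinv_def
    proof (rule cInf_greatest[OF Rinv_nonempty])
      fix x assume "x \<in> {x. 1 \<le> x \<and> y \<le> R x}"
      then show "Z \<le> x" using elim monoD[OF R_mono, of x Z] by (cases "x \<le> Z") auto
    qed
  qed
qed

text \<open>\<open>R\<close> may jump, so \<open>R (Rinv y)\<close> is only asymptotically
  \<open>y\<close>. Points \<open>m * Rinv y\<close> with \<open>m\<close> slightly below or above 1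
  fall outside or inside the defining set, and regular variation makes the resulting error factor
  tend to 1.\<close>

lemma R_Rinv: "((\<lambda>y. R (Rinv y) / y) \<longlongrightarrow> 1) at_top"
proof -
  have Rv: "((\<lambda>y. R (a * Rinv y) / R (Rinv y)) \<longlongrightarrow> a) at_top" if "0 < a" for a
    by (rule filterlim_compose[OF R_rv[OF that] Rinv_at_top])
  have "((\<lambda>y. y / R (Rinv y)) \<longlongrightarrow> 1) at_top"
  proof (rule order_tendstoI)
    fix a :: real assume "a < 1"
    then obtain m where m: "max a 0 < m" "m < 1" using dense[of "max a 0" 1] by auto
    have "\<forall>\<^sub>F y in at_top. a < R (m * Rinv y) / R (Rinv y)" using Rv[of m] m by (intro order_tendstoD(1)) auto
    moreover have "\<forall>\<^sub>F y in at_top. 1 / m \<le> Rinv y" using Rinv_at_top by (simp add: filterlim_at_top)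
    ultimately show "\<forall>\<^sub>F y in at_top. a < y / R (Rinv y)"
    proof eventually_elim
      case (elim y)
      have "1 \<le> m * Rinv y" using elim(2) m by (simp add: field_simps)
      moreover have "m * Rinv y < Rinv y" using m Rinv_ge_1[of y] by simp
      then have "m * Rinv y \<notin> {x. 1 \<le> x \<and> y \<le> R x}"
        using cInf_lower[OF _ Rinv_bdd, of "m * Rinv y" y, folded Rinv_def] by linarith
      ultimately have "R (m * Rinv y) < y" by auto
      then have "R (m * Rinv y) / R (Rinv y) < y / R (Rinv y)" using R_pos by (intro divide_strict_right_mono)
      then show ?case using elim by linarith
    qed
  next
    fix a :: real assume "1 < a"
    then obtain m where m: "1 < m" "m < a" using dense by blast
    have "\<forall>\<^sub>F y in at_top. R (m * Rinv y) / R (Rinv y) < a" using Rv[of m] m by (intro order_tendstoD(2)) auto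
    then show "\<forall>\<^sub>F y in at_top. y / R (Rinv y) < a"
    proof eventually_elim
      case (elim y)
      have "Rinv y < m * Rinv y" using m Rinv_ge_1[of y] by simp
      then obtain x where "1 \<le> x" "y \<le> R x" "x < m * Rinv y"
        using cInf_lessD[OF Rinv_nonempty[of y], of "m * Rinv y"] by (auto simp: Rinv_def)
      then have "y \<le> R (m * Rinv y)" using monoD[OF R_mono, of x "m * Rinv y"] by linarith
      then have "y / R (Rinv y) \<le> R (m * Rinv y) / R (Rinv y)" using R_pos[of "Rinv y"] by (intro divide_right_mono) auto
      then show ?case using elim by linarith
    qed
  qed
  then have "((\<lambda>y. inverse (y / R (Rinv y))) \<longlongrightarrow> inverse 1) at_top" by (rule tendsto_inverse) simp
  then show ?thesis by (simp add: divide_inverse mult.commute)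
qed

lemma Rinv_R: "((\<lambda>x. Rinv (R x) / x) \<longlongrightarrow> 1) at_top"
proof (rule order_tendstoI)
  fix a :: real assume "a < 1"
  then obtain m where m: "max a 0 < m" "m < 1" using dense[of "max a 0" 1] by auto
  have "\<forall>\<^sub>F x in at_top. R (m * x) / R x < 1" using R_rv[of m] m by (intro order_tendstoD(2)) auto
  then show "\<forall>\<^sub>F x in at_top. a < Rinv (R x) / x" using eventually_gt_at_top[of 0]
  proof eventually_elim
    case (elim x)
    have lt: "R (m * x) < R x" using elim R_pos[of x] by (simp add: divide_less_eq)
    have "m * x \<le> Rinv (R x)" unfolding Rinv_def
    proof (rule cInf_greatest[OF Rinv_nonempty])
      fix z assume "z \<in> {z. 1 \<le> z \<and> R x \<le> R z}"
      then show "m * x \<le> z" using lt monoD[OF R_mono, of z "m * x"] by (cases "z \<le> m * x") auto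
    qed
    then have "m \<le> Rinv (R x) / x" using elim by (simp add: le_divide_eq)
    then show ?case using m by simp
  qed
next
  fix a :: real assume a: "1 < a"
  show "\<forall>\<^sub>F x in at_top. Rinv (R x) / x < a"
    using eventually_ge_at_top[of 1]
  proof eventually_elim
    case (elim x)
    have "Rinv (R x) \<le> x" unfolding Rinv_def by (rule cInf_lower[OF _ Rinv_bdd]) (use elim in auto)
    then have "Rinv (R x) / x \<le> 1" using elim by simp
    then show ?case using a by simp
  qed
qed

lemma slowly_varying_Rinv: "slowly_varying (\<lambda>y. Rinv y / y)"
  unfolding slowly_varying_def
proof (intro exI[of _ 1] conjI allI impI)
  fix x :: real assume "1 \<le> x"
  then show "0 < Rinv x / x" using Rinv_ge_1[of x] by simp
next
  have [measurable]: "Rinv \<in> borel_measurable borel" by (rule borel_measurable_mono[OF Rinv_mono])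
  show "(\<lambda>x. indicator {1..} x * (Rinv x / x)) \<in> borel_measurable borel" by measurable
next
  fix c :: real assume c: "0 < c"
  have cy: "filterlim (\<lambda>y. c * y) at_top at_top" using c by real_asymp
  have "((\<lambda>y. R (Rinv (c * y)) / (c * y)) \<longlongrightarrow> 1) at_top" by (rule filterlim_compose[OF R_Rinv cy])
  then have "((\<lambda>y. c * (R (Rinv (c * y)) / (c * y)) / (R (Rinv y) / y)) \<longlongrightarrow> c * 1 / 1) at_top"
    by (intro tendsto_intros R_Rinv) auto
  moreover have "\<forall>\<^sub>F y in at_top. c * (R (Rinv (c * y)) / (c * y)) / (R (Rinv y) / y) = R (Rinv (c * y)) / R (Rinv y)"
    using eventually_gt_at_top[of 0] by eventually_elim (use c in simp)
  ultimately have "((\<lambda>y. R (Rinv (c * y)) / R (Rinv y)) \<longlongrightarrow> c) at_top"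
    using Lim_transform_eventually by fastforce
  moreover have "\<forall>\<^sub>F y in at_top. 0 < Rinv (c * y)"
    by (intro always_eventually allI order_less_le_trans[OF zero_less_one Rinv_ge_1])
  ultimately have "((\<lambda>y. Rinv (c * y) / Rinv y) \<longlongrightarrow> c) at_top"
    by (intro ratio_of_R_ratio[OF Rinv_at_top _ _ c])
  then have "((\<lambda>y. Rinv (c * y) / Rinv y / c) \<longlongrightarrow> c / c) at_top" using c by (intro tendsto_intros) auto
  moreover have "\<forall>\<^sub>F y in at_top. Rinv (c * y) / Rinv y / c = (Rinv (c * y) / (c * y)) / (Rinv y / y)"
    using eventually_gt_at_top[of 0] by eventually_elim (use c in simp)
  ultimately show "((\<lambda>y. (Rinv (c * y) / (c * y)) / (Rinv y / y)) \<longlongrightarrow> 1) at_top"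
    using c Lim_transform_eventually by fastforce
qed

text \<open>Conjugacy of \<open>l\<close> and \<psi> says that \<open>x * l x\<close> and
  \<open>y * \<psi> y\<close> are asymptotically inverse to each other. Here they are
  \<open>R\<close> and \<open>Rinv\<close>.\<close>

lemma debruijn_conj_Rinv:
  assumes l: "\<forall>\<^sub>F x in at_top. x * l x = R x"
  shows "debruijn_conj l (\<lambda>y. Rinv y / y)"
  unfolding debruijn_conj_def
proof (intro conjI slowly_varying_Rinv)
  have "\<forall>\<^sub>F x in at_top. Rinv (R x) / x = l x * (Rinv (x * l x) / (x * l x))"
    using l eventually_gt_at_top[of 0]
  proof eventually_elim
    case (elim x)
    then have "l x \<noteq> 0" using R_pos[of x] by auto
    then have "l x * (Rinv (x * l x) / (x * l x)) = Rinv (x * l x) / x" by simp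
    also have "\<dots> = Rinv (R x) / x" unfolding elim(1) ..
    finally show ?case ..
  qed
  with Rinv_R show "((\<lambda>x. l x * (Rinv (x * l x) / (x * l x))) \<longlongrightarrow> 1) at_top"
    by (rule Lim_transform_eventually)
  have "\<forall>\<^sub>F y in at_top. Rinv y * l (Rinv y) = R (Rinv y)"
    using filterlim_iff[THEN iffD1, OF Rinv_at_top] l by blast
  then have "\<forall>\<^sub>F y in at_top. R (Rinv y) / y = Rinv y / y * l (y * (Rinv y / y))"
    using eventually_gt_at_top[of 0] by eventually_elim simp
  with R_Rinv show "((\<lambda>y. Rinv y / y * l (y * (Rinv y / y))) \<longlongrightarrow> 1) at_top"
    by (rule Lim_transform_eventually)
qed

text \<open>By the second conjugacy relation \<open>q = y * \<psi> y\<close> satisfies that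
  \<open>R (q d)\<close> is asymptotic to \<open>y d\<close>, so the condition on \<open>b\<close>
  compares \<open>R (b d)\<close> with \<open>R (q d)\<close>; regular variation and monotonicity
  pass between values and arguments. This works for every conjugate, once \<open>q\<close> is known
  to diverge.\<close>

lemma R_ratio_iff_asymp_equiv:
  assumes l: "\<forall>\<^sub>F x in at_top. x * l x = R x" and \<psi>: "debruijn_conj l \<psi>"
    and b: "\<And>d. 0 < b d" and y: "filterlim y at_top sequentially"
  shows "(\<lambda>d. R (b d) / y d) \<longlonglongrightarrow> 1 \<longleftrightarrow> b \<sim>[sequentially] (\<lambda>d. y d * \<psi> (y d))"
proof -
  define q where "q d = y d * \<psi> (y d)" for d
  have sv: "slowly_varying \<psi>" and c2: "((\<lambda>x. \<psi> x * l (x * \<psi> x)) \<longlongrightarrow> 1) at_top"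
    using \<psi> by (auto simp: debruijn_conj_def)
  have q: "filterlim q at_top sequentially"
    unfolding q_def[abs_def] by (rule filterlim_compose[OF slowly_varying_times_id_at_top[OF sv] y])
  have q0: "\<forall>\<^sub>F d in sequentially. 0 < q d" using q by (simp add: filterlim_at_top_dense)
  have y0: "\<forall>\<^sub>F d in sequentially. 0 < y d" using y by (simp add: filterlim_at_top_dense)
  have "(\<lambda>d. \<psi> (y d) * l (y d * \<psi> (y d))) \<longlonglongrightarrow> 1" by (rule filterlim_compose[OF c2 y])
  moreover have "\<forall>\<^sub>F d in sequentially. \<psi> (y d) * l (y d * \<psi> (y d)) = R (q d) / y d"
  proof -
    have "\<forall>\<^sub>F d in sequentially. q d * l (q d) = R (q d)"
      using filterlim_iff[THEN iffD1, OF q] l by blast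
    then show ?thesis using y0 by eventually_elim (simp add: q_def field_simps)
  qed
  ultimately have Rq: "(\<lambda>d. R (q d) / y d) \<longlonglongrightarrow> 1" by (rule Lim_transform_eventually)
  \<comment> \<open>Asymptotic equivalence counts 0/0 as 1; since \<open>b\<close> is positive, it
    is the plain limit of the quotient.\<close>
  have ae: "b \<sim>[sequentially] q \<longleftrightarrow> (\<lambda>d. b d / q d) \<longlonglongrightarrow> 1"
  proof -
    have "(\<lambda>d. if b d = 0 \<and> q d = 0 then 1 else b d / q d) = (\<lambda>d. b d / q d)" using b by (auto simp: fun_eq_iff) (metis less_irrefl)+
    then show ?thesis unfolding asymp_equiv_def by simp
  qed
  have "(\<lambda>d. R (b d) / y d) \<longlonglongrightarrow> 1 \<longleftrightarrow> (\<lambda>d. R (b d) / R (q d)) \<longlonglongrightarrow> 1"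
  proof
    assume "(\<lambda>d. R (b d) / y d) \<longlonglongrightarrow> 1"
    then have "(\<lambda>d. (R (b d) / y d) / (R (q d) / y d)) \<longlonglongrightarrow> 1 / 1" using Rq by (intro tendsto_divide) auto
    moreover have "\<forall>\<^sub>F d in sequentially. (R (b d) / y d) / (R (q d) / y d) = R (b d) / R (q d)" using y0 by eventually_elim simp
    ultimately show "(\<lambda>d. R (b d) / R (q d)) \<longlonglongrightarrow> 1" using Lim_transform_eventually by fastforce
  next
    assume "(\<lambda>d. R (b d) / R (q d)) \<longlonglongrightarrow> 1"
    then have "(\<lambda>d. (R (b d) / R (q d)) * (R (q d) / y d)) \<longlonglongrightarrow> 1 * 1" using Rq by (intro tendsto_mult)
    moreover have "(R (b d) / R (q d)) * (R (q d) / y d) = R (b d) / y d" for d using less_imp_neq[OF R_pos[of "q d"]] by simp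
    ultimately show "(\<lambda>d. R (b d) / y d) \<longlonglongrightarrow> 1" by (simp only: mult_1)
  qed
  also have "\<dots> \<longleftrightarrow> (\<lambda>d. b d / q d) \<longlonglongrightarrow> 1"
    using ratio_of_R_ratio[OF q _ _ zero_less_one, of b] R_ratio_of_ratio[OF q, of b] b by auto
  finally show ?thesis using ae by (simp add: q_def[abs_def])
qed

end

section \<open>Regular variation of the eigenvalue tail and the scale condition\<close>

lemma slowly_varying_tail_ratio:
  assumes "slowly_varying \<phi>" and T: "\<forall>\<^sub>F x in at_top. T x = x powr (- \<alpha>) * \<phi> x"
  shows "\<forall>\<^sub>F x in at_top. 0 < T x"
    and "0 < c \<Longrightarrow> ((\<lambda>x. T (c * x) / T x) \<longlongrightarrow> c powr (- \<alpha>)) at_top"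
proof -
  obtain t where pos: "\<And>x. t \<le> x \<Longrightarrow> 0 < \<phi> x"
    and sv: "\<And>c. 0 < c \<Longrightarrow> ((\<lambda>x. \<phi> (c * x) / \<phi> x) \<longlongrightarrow> 1) at_top"
    using assms(1) unfolding slowly_varying_def by blast
  show "\<forall>\<^sub>F x in at_top. 0 < T x"
    using T eventually_ge_at_top[of t] eventually_gt_at_top[of 0] by eventually_elim (simp add: pos)
  assume c: "0 < c"
  have cx: "filterlim (\<lambda>x. c * x) at_top at_top" using c by real_asymp
  have "\<forall>\<^sub>F x in at_top. T (c * x) = (c * x) powr (- \<alpha>) * \<phi> (c * x)"
    using filterlim_iff[THEN iffD1, OF cx] T by blast
  then have "\<forall>\<^sub>F x in at_top. c powr (- \<alpha>) * (\<phi> (c * x) / \<phi> x) = T (c * x) / T x"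
    using T eventually_gt_at_top[of 0] by eventually_elim (use c in \<open>simp add: powr_mult\<close>)
  moreover have "((\<lambda>x. c powr (- \<alpha>) * (\<phi> (c * x) / \<phi> x)) \<longlongrightarrow> c powr (- \<alpha>) * 1) at_top"
    by (intro tendsto_intros sv c)
  ultimately show "((\<lambda>x. T (c * x) / T x) \<longlongrightarrow> c powr (- \<alpha>)) at_top"
    using Lim_transform_eventually by fastforce
qed

context eigenvalues
begin

lemma small_tail_antimono: "x \<le> y \<Longrightarrow> small_tail lam y \<le> small_tail lam x"
proof -
  interpret real_distribution law by (rule real_distribution_law)
  show "x \<le> y \<Longrightarrow> small_tail lam y \<le> small_tail lam x" unfolding small_tail_eq by (rule finite_measure_mono) auto
qed

lemma small_tail_lim: "(small_tail lam \<longlongrightarrow> 0) at_top"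
proof -
  interpret real_distribution law by (rule real_distribution_law)
  have "small_tail lam y = 1 - cdf law y" for y
  proof -
    have "{y<..} = UNIV - {..y}" by auto
    then show ?thesis using prob_compl[of "{..y}"] by (simp add: small_tail_eq cdf_def)
  qed
  then have eq: "small_tail lam = (\<lambda>y. 1 - cdf law y)" by (rule ext)
  have "((\<lambda>y. 1 - cdf law y) \<longlongrightarrow> 1 - 1) at_top" by (intro tendsto_intros cdf_lim_at_top_prob)
  then show ?thesis unfolding eq by simp
qed

text \<open>From left to right, regular variation is evaluated along \<open>b d\<close> and
  multiplied by condition (iii). Conversely the slowly varying factor is taken as
  \<open>x powr \<alpha>\<close> times the tail, and \<open>T_regular\<close> supplies the ratio
  limits at all real arguments.\<close>

lemma tail_conditions_iff:
  assumes \<alpha>: "0 < \<alpha>" "\<alpha> < 2" and b: "\<And>d. 0 < b d" "filterlim b at_top sequentially"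
  shows "(\<exists>\<phi>. slowly_varying \<phi> \<and> (\<forall>\<^sub>F x in at_top. small_tail lam x = x powr (- \<alpha>) * \<phi> x))
      \<and> (\<lambda>d. real d * small_tail lam (b d)) \<longlonglongrightarrow> 1
    \<longleftrightarrow> (\<forall>x>0. (\<lambda>d. real d * small_tail lam (b d * x)) \<longlonglongrightarrow> x powr (- \<alpha>))" (is "?L \<longleftrightarrow> ?R")
proof
  assume ?L
  then obtain \<phi> where sv: "slowly_varying \<phi>" and T: "\<forall>\<^sub>F x in at_top. small_tail lam x = x powr (- \<alpha>) * \<phi> x"
    and l: "(\<lambda>d. real d * small_tail lam (b d)) \<longlonglongrightarrow> 1" by blast
  show ?R
  proof (intro allI impI)
    fix x :: real assume x: "0 < x"
    have "(\<lambda>d. small_tail lam (x * b d) / small_tail lam (b d)) \<longlonglongrightarrow> x powr (- \<alpha>)"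
      by (rule filterlim_compose[OF slowly_varying_tail_ratio(2)[OF sv T x] b(2)])
    with l have "(\<lambda>d. (real d * small_tail lam (b d)) * (small_tail lam (x * b d) / small_tail lam (b d))) \<longlonglongrightarrow> 1 * x powr (- \<alpha>)"
      by (rule tendsto_mult)
    moreover have "\<forall>\<^sub>F d in sequentially. 0 < small_tail lam (b d)"
      using filterlim_iff[THEN iffD1, OF b(2)] slowly_varying_tail_ratio(1)[OF sv T] by blast
    then have "\<forall>\<^sub>F d in sequentially. (real d * small_tail lam (b d)) * (small_tail lam (x * b d) / small_tail lam (b d)) = real d * small_tail lam (b d * x)"
      by eventually_elim (simp add: mult.commute)
    ultimately show "(\<lambda>d. real d * small_tail lam (b d * x)) \<longlonglongrightarrow> x powr (- \<alpha>)"
      using Lim_transform_eventually by fastforce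
  qed
next
  assume R: ?R
  have tail: "(\<lambda>d. real d * measure law {b d * x<..}) \<longlonglongrightarrow> x powr (- \<alpha>)" if "0 < x" for x
    using R that by (simp add: small_tail_eq)
  interpret A: attracted law \<alpha> b
    using real_distribution_law by (intro attracted.intro attracted_axioms.intro \<alpha> law_nonneg b tail)
  have pos: "0 < small_tail lam x" for x unfolding small_tail_eq by (rule A.T_pos)
  have reg: "((\<lambda>x. small_tail lam (c * x) / small_tail lam x) \<longlongrightarrow> c powr (- \<alpha>)) at_top" if "0 < c" for c
    unfolding small_tail_eq by (rule A.T_regular[OF that])
  define \<phi> where "\<phi> x = x powr \<alpha> * small_tail lam x" for x
  have [measurable]: "small_tail lam \<in> borel_measurable borel"
  proof -
    have "mono (\<lambda>x. - small_tail lam x)" by (rule monoI) (simp add: small_tail_antimono)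
    then have "(\<lambda>x. - small_tail lam x) \<in> borel_measurable borel" by (rule borel_measurable_mono)
    then show ?thesis using borel_measurable_uminus_eq by blast
  qed
  have "slowly_varying \<phi>"
    unfolding slowly_varying_def
  proof (intro exI[of _ 1] conjI allI impI)
    show "0 < \<phi> x" if "1 \<le> x" for x using that pos[of x] by (simp add: \<phi>_def)
    show "(\<lambda>x. indicator {1..} x * \<phi> x) \<in> borel_measurable borel" unfolding \<phi>_def by measurable
    fix c :: real assume c: "0 < c"
    have "((\<lambda>x. c powr \<alpha> * (small_tail lam (c * x) / small_tail lam x)) \<longlongrightarrow> c powr \<alpha> * c powr (- \<alpha>)) at_top"
      by (intro tendsto_intros reg c)
    moreover have "\<forall>\<^sub>F x in at_top. c powr \<alpha> * (small_tail lam (c * x) / small_tail lam x) = \<phi> (c * x) / \<phi> x"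
      using eventually_gt_at_top[of 0] by eventually_elim (use c in \<open>simp add: \<phi>_def powr_mult\<close>)
    moreover have "c powr \<alpha> * c powr (- \<alpha>) = 1" using c by (simp add: powr_minus)
    ultimately show "((\<lambda>x. \<phi> (c * x) / \<phi> x) \<longlongrightarrow> 1) at_top" using Lim_transform_eventually by fastforce
  qed
  moreover have "\<forall>\<^sub>F x in at_top. small_tail lam x = x powr (- \<alpha>) * \<phi> x"
    using eventually_gt_at_top[of 0] by eventually_elim (simp add: \<phi>_def powr_minus)
  moreover have "(\<lambda>d. real d * small_tail lam (b d)) \<longlonglongrightarrow> 1" using R[rule_format, of 1] by simp
  ultimately show ?L by blast
qed

text \<open>Raising the tail to the power \<open>- 1 / \<alpha>\<close> gives an increasing
  \<open>R\<close> of index 1 with \<open>R x = x * (1 / \<phi> x) powr (1 / \<alpha>)\<close> for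
  large \<open>x\<close>. Condition (iii) then reads that \<open>R (b d)\<close> is asymptotic to
  \<open>d powr (1 / \<alpha>)\<close>, which de Bruijn conjugacy solves for
  \<open>b d\<close>.\<close>

lemma tail_scale_iff_debruijn:
  assumes \<alpha>: "0 < \<alpha>" and b: "\<And>d. 0 < b d"
    and sv: "slowly_varying \<phi>" and T: "\<forall>\<^sub>F x in at_top. small_tail lam x = x powr (- \<alpha>) * \<phi> x"
  shows "(\<exists>\<psi>. debruijn_conj (\<lambda>x. (1 / \<phi> x) powr (1 / \<alpha>)) \<psi>)
    \<and> (\<forall>\<psi>. debruijn_conj (\<lambda>x. (1 / \<phi> x) powr (1 / \<alpha>)) \<psi> \<longrightarrow>
        (((\<lambda>d. real d * small_tail lam (b d)) \<longlonglongrightarrow> 1)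
          \<longleftrightarrow> b \<sim>[sequentially] (\<lambda>d. real d powr (1 / \<alpha>) * \<psi> (real d powr (1 / \<alpha>)))))"
proof -
  have pos: "0 < small_tail lam x" for x
  proof -
    have "\<forall>\<^sub>F y in at_top. x \<le> y \<and> 0 < small_tail lam y"
      using slowly_varying_tail_ratio(1)[OF sv T] eventually_ge_at_top[of x] by eventually_elim simp
    then obtain y where "x \<le> y" "0 < small_tail lam y" by (auto simp: eventually_at_top_linorder)
    then show ?thesis using small_tail_antimono[of x y] by linarith
  qed
  define R where "R x = small_tail lam x powr (- 1 / \<alpha>)" for x
  interpret monotone_regularly_varying R
  proof
    show "0 < R x" for x using pos[of x] by (simp add: R_def)
    show "mono R"
      unfolding R_def using \<alpha> pos small_tail_antimono by (intro monoI powr_mono2') auto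
    have "filterlim (small_tail lam) (at_right 0) at_top"
      using small_tail_lim pos by (intro tendsto_imp_filterlim_at_right) auto
    moreover have "filterlim (\<lambda>u::real. u powr (- 1 / \<alpha>)) at_top (at_right 0)" using \<alpha> by real_asymp
    ultimately show "filterlim R at_top at_top" unfolding R_def[abs_def] by (rule filterlim_compose[rotated])
    fix c :: real assume c: "0 < c"
    have "((\<lambda>x. (small_tail lam (c * x) / small_tail lam x) powr (- 1 / \<alpha>)) \<longlongrightarrow> (c powr (- \<alpha>)) powr (- 1 / \<alpha>)) at_top"
      using c by (intro tendsto_powr slowly_varying_tail_ratio(2)[OF sv T c] tendsto_const) auto
    moreover have "(c powr (- \<alpha>)) powr (- 1 / \<alpha>) = c" using c \<alpha> by (simp add: powr_powr)
    moreover have "(small_tail lam (c * x) / small_tail lam x) powr (- 1 / \<alpha>) = R (c * x) / R x" for x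
      using pos[of "c * x"] pos[of x] by (simp add: R_def powr_divide)
    ultimately show "((\<lambda>x. R (c * x) / R x) \<longlongrightarrow> c) at_top" by simp
  qed
  have l: "\<forall>\<^sub>F x in at_top. x * (1 / \<phi> x) powr (1 / \<alpha>) = R x"
    using T eventually_gt_at_top[of 0]
  proof eventually_elim
    case (elim x)
    have "0 < \<phi> x" using pos[of x] elim by (simp add: zero_less_mult_iff)
    then show ?case using elim \<alpha>
      by (simp add: R_def powr_mult powr_powr powr_divide powr_minus_divide)
  qed
  have "debruijn_conj (\<lambda>x. (1 / \<phi> x) powr (1 / \<alpha>)) (\<lambda>y. Rinv y / y)" by (rule debruijn_conj_Rinv[OF l])
  moreover have "((\<lambda>d. real d * small_tail lam (b d)) \<longlonglongrightarrow> 1)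
          \<longleftrightarrow> b \<sim>[sequentially] (\<lambda>d. real d powr (1 / \<alpha>) * \<psi> (real d powr (1 / \<alpha>)))"
    if \<psi>: "debruijn_conj (\<lambda>x. (1 / \<phi> x) powr (1 / \<alpha>)) \<psi>" for \<psi>
  proof -
    have y: "filterlim (\<lambda>d. real d powr (1 / \<alpha>)) at_top sequentially" using \<alpha> by real_asymp
    have eq1: "(real d * small_tail lam (b d)) powr (- 1 / \<alpha>) = R (b d) / real d powr (1 / \<alpha>)" for d
      using pos[of "b d"] by (simp add: R_def powr_mult powr_minus_divide)
    have eq2: "(R (b d) / real d powr (1 / \<alpha>)) powr (- \<alpha>) = real d * small_tail lam (b d)" for d
    proof -
      have "(R (b d) / real d powr (1 / \<alpha>)) powr (- \<alpha>) = (real d * small_tail lam (b d)) powr (- 1 / \<alpha> * - \<alpha>)"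
        unfolding eq1[symmetric] by (rule powr_powr)
      then show ?thesis using \<alpha> pos[of "b d"] by simp
    qed
    have "((\<lambda>d. real d * small_tail lam (b d)) \<longlonglongrightarrow> 1) \<longleftrightarrow> (\<lambda>d. R (b d) / real d powr (1 / \<alpha>)) \<longlonglongrightarrow> 1"
    proof
      assume "(\<lambda>d. real d * small_tail lam (b d)) \<longlonglongrightarrow> 1"
      then have "(\<lambda>d. (real d * small_tail lam (b d)) powr (- 1 / \<alpha>)) \<longlonglongrightarrow> 1 powr (- 1 / \<alpha>)" by (intro tendsto_powr) auto
      then show "(\<lambda>d. R (b d) / real d powr (1 / \<alpha>)) \<longlonglongrightarrow> 1" unfolding eq1 by simp
    next
      assume "(\<lambda>d. R (b d) / real d powr (1 / \<alpha>)) \<longlonglongrightarrow> 1"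
      then have "(\<lambda>d. (R (b d) / real d powr (1 / \<alpha>)) powr (- \<alpha>)) \<longlonglongrightarrow> 1 powr (- \<alpha>)" by (intro tendsto_powr) auto
      then show "(\<lambda>d. real d * small_tail lam (b d)) \<longlonglongrightarrow> 1" unfolding eq2 by simp
    qed
    also have "\<dots> \<longleftrightarrow> b \<sim>[sequentially] (\<lambda>d. real d powr (1 / \<alpha>) * \<psi> (real d powr (1 / \<alpha>)))"
      by (rule R_ratio_iff_asymp_equiv[OF l \<psi> b y])
    finally show ?thesis .
  qed
  ultimately show ?thesis by blast
qed

end

theorem theorem8:
  fixes lam :: "nat \<Rightarrow> real" and \<alpha> :: real and a b :: "nat \<Rightarrow> real"
  assumes lam_nonneg: "\<And>k. lam k \<ge> 0"
    and lam_mono: "antimono lam"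
    and lam_summable: "summable lam"
    and lam_pos: "lam 0 > 0"
    and alpha: "0 < \<alpha>" "\<alpha> < 2"
    and b_pos: "\<And>d. b d > 0"
    and b_lim: "filterlim b at_top sequentially"
  shows "((\<forall>\<epsilon>. 0 < \<epsilon> \<and> \<epsilon> < 1 \<longrightarrow>
            (\<lambda>d. ln (real (n_eps lam d \<epsilon>)) - a d
                  - gen_inverse (stable_cdf \<alpha>) (1 - \<epsilon>\<^sup>2) * b d) \<in> o(b))
         \<longleftrightarrow>
         ((\<exists>\<phi>. slowly_varying \<phi> \<and>
              (\<forall>\<^sub>F x in at_top. small_tail lam x = x powr (- \<alpha>) * \<phi> x))
          \<and> (\<lambda>d. a d - a_star lam \<alpha> b d) \<in> o(b)
          \<and> (\<lambda>d. real d * small_tail lam (b d)) \<longlonglongrightarrow> 1))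
     \<and> (\<forall>\<phi>. slowly_varying \<phi> \<and>
              (\<forall>\<^sub>F x in at_top. small_tail lam x = x powr (- \<alpha>) * \<phi> x) \<longrightarrow>
          (\<exists>\<psi>. debruijn_conj (\<lambda>x. (1 / \<phi> x) powr (1 / \<alpha>)) \<psi>)
          \<and> (\<forall>\<psi>. debruijn_conj (\<lambda>x. (1 / \<phi> x) powr (1 / \<alpha>)) \<psi> \<longrightarrow>
               (((\<lambda>d. real d * small_tail lam (b d)) \<longlonglongrightarrow> 1)
                \<longleftrightarrow> b \<sim>[sequentially]
                    (\<lambda>d. real d powr (1 / \<alpha>) * \<psi> (real d powr (1 / \<alpha>))))))"
proof -
  interpret eigenvalues lam by standard (rule lam_nonneg lam_summable lam_pos)+
  \<comment> \<open>Folding turns the tail limit at all points back into conditions (i) and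
    (iii).\<close>
  note iff = asymptotics_iff[OF alpha b_pos b_lim, of a, folded tail_conditions_iff[OF alpha b_pos b_lim]]
  show ?thesis
  proof (rule conjI, goal_cases)
    case 1
    show ?case by (rule trans[OF iff], rule iffI; elim conjE; intro conjI; assumption)
  next
    case 2
    show ?case by (intro allI impI, elim conjE, rule tail_scale_iff_debruijn[OF alpha(1) b_pos])
  qed
qed

end
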